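(* Let $k\ge2$ and $l\ge2$ be integers. There exists no connected planar graph such that the degrees of all faces are divisible by $k$, and the degrees of all vertices except one are divisible by $l$ (that is, exactly one vertex has degree not divisible by $l$).
   Context: Planar graphs are finite graphs embedded in the sphere; multiple edges and loops are allowed, a loop contributing two units to the degree of its endpoint. The degree of a face is the number of edges surrounding it, where an edge having the same face on both of its sides is counted twice. *)

theory Defs
  imports "HOL-Analysis.Analysis"
begin

type_synonym point = "real ^ 3"

abbreviation S2 :: "point set" where
  "S2 \<equiv> sphere 0 1"

text \<open>
  A finite graph embedded in the sphere is given by its set of vertices (points) and its set of
  edges. An edge is the point set of a closed curve segment, ends included: an arc between two
  distinct vertices, or a simple closed curve through a single vertex (a loop). The predicate
  \<open>simple_path\<close> covers both cases, since it only allows the two ends of the path to coincide.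
  Distinct edges may have the same ends; they are told apart as point sets.
\<close>

definition joins :: "point set \<Rightarrow> point \<Rightarrow> point \<Rightarrow> bool" where
  "joins e u w \<longleftrightarrow>
     (\<exists>\<gamma>. simple_path \<gamma> \<and> path_image \<gamma> = e \<and> pathstart \<gamma> = u \<and> pathfinish \<gamma> = w)"

definition planar_graph :: "point set \<Rightarrow> point set set \<Rightarrow> bool" where
  "planar_graph V E \<longleftrightarrow>
     finite V \<and> finite E \<and> V \<subseteq> S2 \<and>
     (\<forall>e\<in>E. e \<subseteq> S2 \<and> (\<exists>u w. joins e u w \<and> e \<inter> V = {u, w})) \<and>
     (\<forall>e\<in>E. \<forall>f\<in>E. e \<noteq> f \<longrightarrow> e \<inter> f \<subseteq> V)"

definition adjacency :: "point set \<Rightarrow> point set set \<Rightarrow> (point \<times> point) set" where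
  "adjacency V E = {(u, w). \<exists>e\<in>E. e \<inter> V = {u, w}}"

definition connected_graph :: "point set \<Rightarrow> point set set \<Rightarrow> bool" where
  "connected_graph V E \<longleftrightarrow> V \<noteq> {} \<and> (\<forall>u\<in>V. \<forall>w\<in>V. (u, w) \<in> (adjacency V E)\<^sup>*)"

text \<open>The second summand counts the loops at \<open>v\<close> once more.\<close>

definition vertex_degree :: "point set \<Rightarrow> point set set \<Rightarrow> point \<Rightarrow> nat" where
  "vertex_degree V E v = card {e\<in>E. v \<in> e} + card {e\<in>E. e \<inter> V = {v}}"

definition faces :: "point set \<Rightarrow> point set set \<Rightarrow> point set set" where
  "faces V E = components (S2 - (V \<union> \<Union>E))"

text \<open>
  The number of sides of the edge \<open>e\<close> on which the face \<open>F\<close> lies. An edge bordering \<open>F\<close> has \<open>F\<close> on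
  both of its sides precisely when it borders no other face.
\<close>

definition sides :: "point set \<Rightarrow> point set set \<Rightarrow> point set \<Rightarrow> point set \<Rightarrow> nat" where
  "sides V E F e =
     (if \<not> e \<subseteq> closure F then 0
      else if \<exists>F'\<in>faces V E. F' \<noteq> F \<and> e \<subseteq> closure F' then 1
      else 2)"

definition face_degree :: "point set \<Rightarrow> point set set \<Rightarrow> point set \<Rightarrow> nat" where
  "face_degree V E F = (\<Sum>e\<in>E. sides V E F e)"

end

theory Submission
  imports Defs
begin

text \<open>
  Let \<open>a\<close> and \<open>x\<close> generate a triangle group: \<open>a\<close> is an involution, \<open>x\<close> has order \<open>l\<close>, \<open>x a\<close> has order
  \<open>k\<close>, and the cyclic groups of \<open>x\<close> and \<open>a x\<close> meet trivially. Walk around a cycle bounding a disc and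
  multiply the factors \<open>x\<^sup>d a\<close>, where \<open>d + 1\<close> is the number of edges that the disc has at the vertex
  passed. If the disc is a single face, the product is a power of \<open>x a\<close>; if an ear divides the disc into
  two, the products of the two parts combine, the inner vertices of the ear cancelling since their
  degrees are divisible by \<open>l\<close>. So the product is trivial whenever all vertices and faces inside the
  disc are good. In a graph without cut vertices, apply this to the complement of a face \<open>A\<close>: if a
  vertex \<open>c\<close> of \<open>A\<close> and \<open>A\<close> itself are the only possible exceptions, the result is
  \<open>x\<^sup>m = (a x)\<^sup>n\<close> with \<open>m\<close> the degree of \<open>c\<close> and \<open>n\<close> that of \<open>A\<close>, so neither is exceptional. This
  statement about a vertex and an incident face is inherited by graphs glued at a cut vertex, because
  the part without the exceptions can be removed without affecting any divisibility.
\<close>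

section \<open>Jordan curves on the sphere\<close>

text \<open>Read a group element as the position of a directed edge in the regular tiling by
  \<open>k\<close>-gons meeting \<open>l\<close> at a vertex: \<open>x\<close> turns the edge about
  its start, \<open>a\<close> reverses it. The product around a disc is then the holonomy of
  unrolling the graph onto this tiling, and good vertices and faces contribute nothing to it. What
  survives is a rotation about a vertex and one about a face of the tiling; their centres differ, so
  they agree only when both are trivial. Depending on \<open>k\<close> and \<open>l\<close> the
  tiling is spherical, Euclidean or hyperbolic; complex 2 by 2 matrices treat these cases alike. The
  obstacle is cut vertices, where the boundary of a face need not be a cycle. A part cut off at a
  vertex has unknown degrees at that vertex and at the face that held the rest. This is why the
  inductive statement admits an exceptional face beside the exceptional vertex, although the theorem
  has none, and why it asks the two to be incident.\<close>

lemma sphere_chart: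
  assumes "p \<in> S2"
  obtains h k where "homeomorphism (S2 - {p}) (UNIV :: complex set) h k"
proof -
  have "rel_frontier (cball (0::point) 1) - {p} homeomorphic (UNIV :: complex set)"
    by (rule homeomorphic_punctured_sphere_affine_gen)
      (use assms in \<open>auto simp: rel_frontier_cball aff_dim_cball\<close>)
  then show ?thesis
    using that by (auto simp: rel_frontier_cball homeomorphic_def)
qed

lemma S2_islimpt:
  assumes "p \<in> S2"
  shows "p islimpt S2"
proof (rule connected_imp_perfect)
  show "connected S2"
    by (simp add: connected_sphere_eq)
  show "S2 \<noteq> {a}" for a
  proof
    assume "S2 = {a}"
    then have "p = a" "- p = a"
      using assms by (metis singletonD, metis mem_sphere_0 norm_minus_cancel singletonD)
    then have "p = - p"
      by simp
    then have "p = 0"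
      by (simp add: vec_eq_iff)
    then show False
      using assms by simp
  qed
qed (rule assms)

lemma openin_Diff_closed: "closed T \<Longrightarrow> openin (top_of_set S) (S - T)"
  by (simp add: Diff_eq open_Compl openin_open_Int)

lemma connected_subset_openin:
  assumes "connected T" "openin (top_of_set U) A" "openin (top_of_set U) B" "A \<inter> B = {}"
    "T \<subseteq> A \<union> B" "T \<subseteq> U" "T \<inter> A \<noteq> {}"
  shows "T \<subseteq> A"
proof -
  obtain A' B' where A': "open A'" "A = U \<inter> A'" and B': "open B'" "B = U \<inter> B'"
    using assms(2,3) by (auto simp: openin_open)
  have "B' \<inter> T = {} \<or> A' \<inter> T = {}"
    by (rule connectedD[OF assms(1) B'(1) A'(1), simplified]) (use assms A' B' in blast)+
  then show ?thesis
    using assms A' B' by blast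
qed

lemma connected_subset_closed:
  assumes "connected T" "closed A" "closed B" "A \<inter> B \<inter> T = {}" "T \<subseteq> A \<union> B" "T \<inter> A \<noteq> {}"
  shows "T \<subseteq> A"
  using connected_closedD[OF assms(1) assms(4,5) assms(2,3)] assms by blast

lemma two_components:
  assumes "connected A" "connected B" "openin (top_of_set U) A" "openin (top_of_set U) B"
    "A \<inter> B = {}" "A \<union> B = U" "A \<noteq> {}" "B \<noteq> {}"
  shows "components U = {A, B}"
proof -
  have *: "A \<in> components U" if "connected A" "openin (top_of_set U) A" "openin (top_of_set U) B"
    "A \<inter> B = {}" "A \<union> B = U" "A \<noteq> {}" for A B
    unfolding in_components_maximal
  proof (intro conjI allI impI)
    fix T assume "T \<noteq> {} \<and> A \<subseteq> T \<and> T \<subseteq> U \<and> connected T"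
    then show "T = A"
      using connected_subset_openin[of T U A B] that by blast
  qed (use that in auto)
  have AB: "A \<in> components U" "B \<in> components U"
    using *[of A B] *[of B A] assms by auto
  moreover have "X = A \<or> X = B" if "X \<in> components U" for X
  proof -
    have "X \<noteq> {}" "X \<subseteq> U"
      using in_components_nonempty[OF that] in_components_subset[OF that] by auto
    then have "X \<inter> A \<noteq> {} \<or> X \<inter> B \<noteq> {}"
      using assms(6) by auto
    then show ?thesis
      using components_eq[OF that] AB by auto
  qed
  ultimately show ?thesis by auto
qed

text \<open>A simple path traces a circle or an interval; the sphere is simply connected, unlike the
  circle, and not contractible, unlike the interval. The point left over serves as the centre of a
  projection.\<close>

lemma simple_path_image_ne_S2:
  assumes "simple_path g" "path_image g \<subseteq> S2"
  shows "path_image g \<noteq> S2"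
proof
  assume eq: "path_image g = S2"
  show False
  proof (cases "pathfinish g = pathstart g")
    case True
    have "path_image g homeomorphic sphere (0::complex) 1"
      using assms(1) True by (rule homeomorphic_simple_path_image_circle) auto
    then have "simply_connected (sphere (0::complex) 1) \<longleftrightarrow> simply_connected S2"
      unfolding eq using homeomorphic_simply_connected_eq by blast
    then show False
      by (simp add: simply_connected_sphere_eq)
  next
    case False
    then have "arc g"
      using assms by (simp add: arc_simple_path)
    then have "path_image g homeomorphic {0..1::real}"
      using homeomorphic_arc_image_interval[of g 0 1] by (simp add: )
    then have "contractible S2"
      unfolding eq using homeomorphic_contractible_eq convex_imp_contractible[of "{0..1::real}"] by fastforce
    then show False by (simp add: contractible_sphere)
  qed
qed

text \<open>The planar Jordan curve theorem is pulled back through the chart at a point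
  \<open>p\<close> off the curve. The inside carries over as it stands; the outside has to be
  completed by \<open>p\<close>, so its connectedness, openness and closure need a separate
  check.\<close>

lemma Jordan_chart:
  assumes g: "simple_path g" "pathfinish g = pathstart g" "path_image g \<subseteq> S2 - {p}"
    and p: "p \<in> S2" and hk: "homeomorphism (S2 - {p}) (UNIV :: complex set) h k"
  defines "C \<equiv> path_image g"
  defines "I \<equiv> k ` inside (h ` C)" and "X \<equiv> insert p (k ` outside (h ` C))"
  shows "components (S2 - C) = {I, X}" "I \<noteq> X" "p \<notin> I" "closure I = I \<union> C" "closure X = X \<union> C"
proof -
  have conth: "continuous_on (S2 - {p}) h" and contk: "continuous_on UNIV k"
    and kh: "\<And>x. x \<in> S2 - {p} \<Longrightarrow> k (h x) = x" and hk1: "\<And>y. h (k y) = y"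
    and kim: "range k = S2 - {p}"
    using hk by (auto simp: homeomorphism_def)
  have injh: "inj_on h (S2 - {p})"
    by (rule inj_on_inverseI[of _ k]) (rule kh)
  have injk: "inj k"
    by (rule inj_on_inverseI[of _ h]) (rule hk1)
  have Csub: "C \<subseteq> S2 - {p}"
    using g C_def by simp
  have sp: "simple_path (h \<circ> g)"
  proof (rule simple_path_continuous_image)
    show "continuous_on (path_image g) h" "inj_on h (path_image g)"
      using conth injh g(3) continuous_on_subset inj_on_subset by blast+
  qed (use g in auto)
  have pi: "path_image (h \<circ> g) = h ` C"
    by (simp add: C_def path_image_compose)
  have J: "inside (h ` C) \<noteq> {}" "open (inside (h ` C))" "connected (inside (h ` C))" "outside (h ` C) \<noteq> {}"
      "open (outside (h ` C))" "connected (outside (h ` C))" "bounded (inside (h ` C))"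
      "inside (h ` C) \<inter> outside (h ` C) = {}"
      "inside (h ` C) \<union> outside (h ` C) = - h ` C"
      "frontier (inside (h ` C)) = h ` C" "frontier (outside (h ` C)) = h ` C"
    using Jordan_inside_outside[OF sp] g(2) unfolding pi by (auto simp: pathfinish_compose pathstart_compose)
  have khC: "k ` h ` C = C"
    using Csub kh by (force simp: image_image)
  have kX: "k ` outside (h ` C) = S2 - {p} - (I \<union> C)"
  proof -
    have "outside (h ` C) = UNIV - (inside (h ` C) \<union> h ` C)"
      using J(8,9) by blast
    then show ?thesis
      by (simp add: image_set_diff[OF injk] kim I_def image_Un khC)
  qed
  have pI: "p \<notin> I"
    using kim by (auto simp: I_def)
  have Xeq: "X = S2 - (I \<union> C)"
    using kX p pI Csub by (auto simp: X_def)
  have IC: "I \<inter> C = {}"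
  proof -
    have "inside (h ` C) \<inter> h ` C = {}"
      using J(9) by blast
    then show ?thesis
      unfolding I_def using khC image_Int[OF injk, of "inside (h ` C)" "h ` C"] by simp
  qed
  have IS: "I \<subseteq> S2"
    using kim by (auto simp: I_def)
  have cI: "closure (inside (h ` C)) = inside (h ` C) \<union> h ` C"
    using closure_Un_frontier J(10) by metis
  have comp: "compact (I \<union> C)"
  proof -
    have "compact (closure (inside (h ` C)))"
      using J(7) by simp
    then have "compact (k ` closure (inside (h ` C)))"
      using compact_continuous_image continuous_on_subset[OF contk] by blast
    then show ?thesis
      by (simp add: cI image_Un I_def khC)
  qed
  have ksub: "k ` closure S \<subseteq> closure (k ` S)" for S
    by (rule image_closure_subset) (auto intro: continuous_on_subset[OF contk] closure_subset[THEN subsetD])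
  show clI: "closure I = I \<union> C"
  proof
    show "closure I \<subseteq> I \<union> C"
      using comp by (simp add: closure_minimal compact_imp_closed)
    show "I \<union> C \<subseteq> closure I"
      using ksub[of "inside (h ` C)"] by (simp add: cI image_Un I_def khC)
  qed
  have cX: "C \<subseteq> closure (k ` outside (h ` C))"
    using ksub[of "outside (h ` C)"] closure_Un_frontier[of "outside (h ` C)"] J(11) khC
    by (simp add: image_Un)
  \<comment> \<open>The sphere accumulates at \<open>p\<close>, but the compact set
    \<open>I \<union> C\<close> stays away from it, so the image of the outside must accumulate
    there.\<close>
  have "p islimpt (k ` outside (h ` C))"
  proof -
    have "p islimpt ((k ` outside (h ` C)) \<union> (I \<union> C))"
      by (rule islimpt_subset[OF islimpt_punctured[THEN iffD1, OF S2_islimpt[OF p]]])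
         (use kX in auto)
    moreover have "\<not> p islimpt (I \<union> C)"
      using comp compact_imp_closed closed_limpt pI Csub by blast
    ultimately show ?thesis
      by (simp add: islimpt_Un)
  qed
  then have pcl: "p \<in> closure (k ` outside (h ` C))"
    by (simp add: closure_def)
  have conX: "connected X"
  proof (rule connected_intermediate_closure)
    show "connected (k ` outside (h ` C))"
      using J(6) connected_continuous_image continuous_on_subset[OF contk] by blast
    show "X \<subseteq> closure (k ` outside (h ` C))" "k ` outside (h ` C) \<subseteq> X"
      using pcl by (simp_all add: X_def closure_subset subset_insertI)
  qed
  have conI: "connected I"
    unfolding I_def using J(3) connected_continuous_image continuous_on_subset[OF contk] by blast
  have opX: "openin (top_of_set S2) X"
    unfolding Xeq by (rule openin_Diff_closed) (rule compact_imp_closed[OF comp])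
  have opI: "openin (top_of_set S2) I"
  proof -
    have "openin (top_of_set (S2 - {p})) (k ` inside (h ` C))"
      using homeomorphism_imp_open_map[OF homeomorphism_sym[THEN iffD1, OF hk]] J(2) by simp
    moreover have "openin (top_of_set S2) (S2 - {p})"
      by (simp add: openin_delete)
    ultimately show ?thesis
      using openin_trans I_def by blast
  qed
  show comps: "components (S2 - C) = {I, X}"
  proof (rule two_components[OF conI conX])
    show "openin (top_of_set (S2 - C)) I" "openin (top_of_set (S2 - C)) X"
      using opI opX IC IS Xeq by (auto intro: openin_subset_trans)
  qed (use IC IS Xeq J in \<open>auto simp: X_def I_def\<close>)
  show "p \<notin> I" by (rule pI)
  then show "I \<noteq> X" by (auto simp: X_def)
  show "closure X = X \<union> C"
  proof
    have "closed (S2 - I)"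
      using opI closedin_closed_trans[of S2 "S2 - I"] by (simp add: closedin_diff)
    moreover have "X \<subseteq> S2 - I" using Xeq by auto
    ultimately show "closure X \<subseteq> X \<union> C"
      using closure_minimal[of X "S2 - I"] Xeq by auto
    show "X \<union> C \<subseteq> closure X"
      using cX closure_subset[of X] closure_mono[of "k ` outside (h ` C)" X] X_def
      by (metis Un_least order_trans subset_insertI)
  qed
qed

lemma Jordan_sphere:
  assumes g: "simple_path g" "pathfinish g = pathstart g" "path_image g \<subseteq> S2"
  obtains A B where "components (S2 - path_image g) = {A, B}" "A \<noteq> B"
    "closure A = A \<union> path_image g" "closure B = B \<union> path_image g"
proof -
  obtain p where p: "p \<in> S2" "p \<notin> path_image g"
    using simple_path_image_ne_S2[OF g(1,3)] g(3) by blast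
  obtain h k where "homeomorphism (S2 - {p}) (UNIV :: complex set) h k"
    using sphere_chart p by blast
  note J = Jordan_chart[OF g(1,2) _ p(1) this]
  show ?thesis
    by (rule that[OF J(1,2,4,5)]) (use g p in auto)
qed

text \<open>Projecting from a point \<open>p\<close> of the component opposite to \<open>D\<close>
  turns \<open>D\<close> into the inside of a planar curve. There the splitting of the inside of a
  theta curve by its middle arc is known.\<close>

lemma theta_sphere:
  assumes arcs: "arc a" "arc b" "arc c"
    and ends: "pathstart a = u" "pathfinish a = w" "pathstart b = u" "pathfinish b = w"
      "pathstart c = u" "pathfinish c = w"
    and ab: "path_image a \<inter> path_image b = {u, w}"
    and sub: "path_image a \<subseteq> S2" "path_image b \<subseteq> S2"
    and D: "D \<in> components (S2 - (path_image a \<union> path_image b))"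
    and cD: "path_image c - {u, w} \<subseteq> D"
  obtains D1 D2 where
    "D1 \<in> components (S2 - (path_image a \<union> path_image c))"
    "D2 \<in> components (S2 - (path_image b \<union> path_image c))"
    "D1 \<inter> D2 = {}" "D = D1 \<union> D2 \<union> (path_image c - {u, w})"
proof -
  have uw: "u \<noteq> w"
    using arcs(1) ends arc_distinct_ends by blast
  have DS: "D \<subseteq> S2 - (path_image a \<union> path_image b)"
    using D in_components_subset by blast
  have uwi: "u \<in> path_image a" "w \<in> path_image a" "u \<in> path_image b" "w \<in> path_image b"
    "u \<in> path_image c" "w \<in> path_image c"
    using ends pathstart_in_path_image pathfinish_in_path_image by metis+
  have int: "path_image a \<inter> path_image c = {u, w}" "path_image b \<inter> path_image c = {u, w}"
    using DS cD uwi by auto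
  have cS: "path_image c \<subseteq> S2"
    using DS cD sub uwi by auto
  have sp: "simple_path (a +++ reversepath b)" "simple_path (a +++ reversepath c)"
    "simple_path (b +++ reversepath c)"
    using arcs ends ab int by (auto intro!: simple_path_join_loop simp: arc_reversepath)
  have pis: "path_image (a +++ reversepath b) = path_image a \<union> path_image b"
    "path_image (a +++ reversepath c) = path_image a \<union> path_image c"
    "path_image (b +++ reversepath c) = path_image b \<union> path_image c"
    using ends by (auto simp: path_image_join)
  obtain A B where AB: "components (S2 - (path_image a \<union> path_image b)) = {A, B}" "A \<noteq> B"
  proof (rule Jordan_sphere[OF sp(1)])
    show "pathfinish (a +++ reversepath b) = pathstart (a +++ reversepath b)"
      "path_image (a +++ reversepath b) \<subseteq> S2"
      using ends sub by (simp_all add: pis)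
  qed (unfold pis, rule that)
  obtain D' where D': "components (S2 - (path_image a \<union> path_image b)) = {D, D'}" "D \<noteq> D'"
  proof (cases "D = A")
    case False
    then show ?thesis
      using that[of A] AB D by (simp add: insert_commute)
  qed (use that[of B] AB in simp)
  then have D'c: "D' \<in> components (S2 - (path_image a \<union> path_image b))"
    by simp
  have "D' \<noteq> {}" "D' \<subseteq> S2 - (path_image a \<union> path_image b)" "D \<inter> D' = {}"
    using in_components_nonempty[OF D'c] in_components_subset[OF D'c] components_eq[OF D D'c] D'(2)
    by simp_all
  then obtain p where p: "p \<in> S2" "p \<notin> path_image a" "p \<notin> path_image b" "p \<notin> D"
    by blast
  then have pc: "p \<notin> path_image c"
    using int cD by blast
  obtain h k where hk: "homeomorphism (S2 - {p}) (UNIV :: complex set) h k"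
    using sphere_chart p by blast
  have conth: "continuous_on (S2 - {p}) h" 
    and kh: "\<And>x. x \<in> S2 - {p} \<Longrightarrow> k (h x) = x" and hk1: "\<And>y. h (k y) = y"
    using hk by (auto simp: homeomorphism_def)
  have injh: "inj_on h (S2 - {p})"
    by (rule inj_on_inverseI[of _ k]) (rule kh)
  have injk: "inj k"
    by (rule inj_on_inverseI[of _ h]) (rule hk1)
  let ?a = "h ` path_image a" and ?b = "h ` path_image b" and ?c = "h ` path_image c"
  note J1 = Jordan_chart[OF sp(1) _ _ p(1) hk, unfolded pis image_Un]
  note J2 = Jordan_chart[OF sp(2) _ _ p(1) hk, unfolded pis image_Un]
  note J3 = Jordan_chart[OF sp(3) _ _ p(1) hk, unfolded pis image_Un]
  have Deq: "D = k ` inside (?a \<union> ?b)"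
  proof -
    have "D \<in> {k ` inside (?a \<union> ?b), insert p (k ` outside (?a \<union> ?b))}"
      by (rule subst[OF J1(1), of "\<lambda>X. D \<in> X"]) (use D ends sub p in auto)
    then show ?thesis using p by auto
  qed
  have C1: "k ` inside (?a \<union> ?c) \<in> components (S2 - (path_image a \<union> path_image c))"
    by (subst J2(1)) (use ends sub cS p pc in auto)
  have C2: "k ` inside (?b \<union> ?c) \<in> components (S2 - (path_image b \<union> path_image c))"
    by (subst J3(1)) (use ends sub cS p pc in auto)
  have sph: "simple_path (h \<circ> q)" if "arc q" "path_image q \<subseteq> S2" "p \<notin> path_image q" for q
  proof (rule simple_path_continuous_image)
    have "path_image q \<subseteq> S2 - {p}" using that by blast
    then show "continuous_on (path_image q) h" "inj_on h (path_image q)"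
      using continuous_on_subset[OF conth] inj_on_subset[OF injh] by auto
  qed (use that arc_imp_simple_path in auto)
  have himg: "h ` S \<inter> h ` T = h ` (S \<inter> T)" if "S \<subseteq> S2 - {p}" "T \<subseteq> S2 - {p}" for S T
    using that injh by (simp add: inj_on_image_Int)
  have in_S: "path_image a \<subseteq> S2 - {p}" "path_image b \<subseteq> S2 - {p}" "path_image c \<subseteq> S2 - {p}"
    using sub cS p pc by auto
  have uwin: "u \<in> S2 - {p}" "w \<in> S2 - {p}"
    using in_S(1) ends by auto
  have hsub: "S \<subseteq> S2 - {p} \<Longrightarrow> k ` h ` S = S" for S
    using kh by (force simp: image_image)
  have ne: "?c \<inter> inside (?a \<union> ?b) \<noteq> {}"
  proof -
    have "path_image c - {u, w} \<noteq> {}"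
      using nonempty_simple_path_endless[OF arc_imp_simple_path[OF arcs(3)]] ends by simp
    then obtain z where "z \<in> path_image c" "z \<in> D" using cD by auto
    then have "h z \<in> inside (?a \<union> ?b)" unfolding Deq using hk1 by auto
    then show ?thesis using \<open>z \<in> path_image c\<close> by blast
  qed
  have sp': "simple_path (h \<circ> a)" "simple_path (h \<circ> b)" "simple_path (h \<circ> c)"
    using arcs sub cS p pc sph by auto
  have spl: "inside (?a \<union> ?c) \<inter> inside (?b \<union> ?c) = {} \<and>
    inside (?a \<union> ?c) \<union> inside (?b \<union> ?c) \<union> (?c - {h u, h w}) = inside (?a \<union> ?b)"
  proof -
    have i1: "path_image (h \<circ> a) \<inter> path_image (h \<circ> b) = {h u, h w}"
      "path_image (h \<circ> a) \<inter> path_image (h \<circ> c) = {h u, h w}"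
      "path_image (h \<circ> b) \<inter> path_image (h \<circ> c) = {h u, h w}"
      using himg in_S ab int by (simp_all add: path_image_compose)
    have i2: "path_image (h \<circ> c) \<inter> inside (path_image (h \<circ> a) \<union> path_image (h \<circ> b)) \<noteq> {}"
      using ne by (simp add: path_image_compose)
    have i3: "h u \<noteq> h w"
      using uw uwin injh by (auto simp: inj_on_def)
    show ?thesis
      by (rule split_inside_simple_closed_curve[OF sp'(1) _ _ sp'(2) _ _ sp'(3) _ _ i3 i1 i2])
        (simp_all add: pathstart_compose pathfinish_compose ends path_image_compose)
  qed
  have "k ` inside (?a \<union> ?c) \<inter> k ` inside (?b \<union> ?c) = {}"
    using spl image_Int[OF injk, of "inside (?a \<union> ?c)" "inside (?b \<union> ?c)"] by simp
  moreover have "D = k ` inside (?a \<union> ?c) \<union> k ` inside (?b \<union> ?c) \<union> (path_image c - {u, w})"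
  proof -
    have "D = k ` (inside (?a \<union> ?c) \<union> inside (?b \<union> ?c) \<union> (?c - {h u, h w}))"
      using Deq spl by simp
    also have "\<dots> = k ` inside (?a \<union> ?c) \<union> k ` inside (?b \<union> ?c) \<union> (k ` ?c - {k (h u), k (h w)})"
      by (simp add: image_Un image_set_diff[OF injk])
    finally show ?thesis
      using kh uwin hsub in_S by simp
  qed
  ultimately show ?thesis
    using C1 C2 that by blast
qed

section \<open>Components of complements of closed sets on the sphere\<close>

lemma openin_component_sphere:
  assumes "closed X" "F \<in> components (S2 - X)"
  shows "openin (top_of_set S2) F"
proof -
  have op: "openin (top_of_set S2) (S2 - X)"
    using assms(1) by (rule openin_Diff_closed)
  have "locally connected S2"
    by (simp add: locally_path_connected_imp_locally_connected locally_path_connected_sphere)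
  then have "locally connected (S2 - X)"
    using op locally_open_subset by blast
  then have "openin (top_of_set (S2 - X)) F"
    using assms(2) openin_components_locally_connected by blast
  then show ?thesis
    using op openin_trans by blast
qed

text \<open>Since \<open>F\<close> omits a point \<open>q\<close>, projection from \<open>q\<close>
  makes it an open connected subset of the plane, which a single point cannot disconnect.\<close>

lemma connected_delete_point_sphere:
  assumes F: "connected F" "openin (top_of_set S2) F" and q: "q \<in> S2 - F"
  shows "connected (F - {p})"
proof -
  obtain h k where hk: "homeomorphism (S2 - {q}) (UNIV :: complex set) h k"
    using sphere_chart[of q] q by auto
  have FS: "F \<subseteq> S2 - {q}"
    using openin_imp_subset[OF F(2)] q by auto
  have "openin (top_of_set (S2 - {q})) F"
    using F(2) FS by (rule openin_subset_trans) auto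
  then have op: "open (h ` F)"
    using homeomorphism_imp_open_map[OF hk] by simp
  have con: "connected (h ` F)"
    using F(1) hk FS by (meson connected_continuous_image continuous_on_subset homeomorphism_def)
  have "connected (h ` F - {h p})"
    by (rule connected_open_delete[OF op con]) simp
  then have "connected (k ` (h ` F - {h p}))"
    using hk by (meson connected_continuous_image continuous_on_subset homeomorphism_def subset_UNIV)
  moreover have "k ` (h ` F - {h p}) = F - {p}" if "p \<in> F"
  proof -
    have "inj_on k UNIV" "k ` h ` F = F" "k (h p) = p"
      using hk FS that by (auto simp: homeomorphism_def inj_on_def image_image subset_iff) metis
    then show ?thesis
      by (simp add: image_set_diff)
  qed
  ultimately show ?thesis
    using F(1) by (cases "p \<in> F") auto
qed

lemma infinite_openin_sphere:
  assumes "openin (top_of_set S2) W" "W \<noteq> {}"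
  shows "infinite W"
proof -
  obtain U where U: "open U" "W = S2 \<inter> U"
    using assms(1) by (auto simp: openin_open)
  obtain a where a: "a \<in> W"
    using assms(2) by blast
  have "a islimpt S2 \<inter> U"
    by (rule islimpt_Int_eventually)
      (use S2_islimpt eventually_at_in_open' U a in auto)
  then show ?thesis
    using U(2) islimpt_finite by metis
qed

lemma connected_punctured_sphere:
  assumes "c \<in> S2"
  shows "connected (S2 - {c})"
proof -
  obtain h k where "homeomorphism (S2 - {c}) (UNIV :: complex set) h k"
    using sphere_chart[OF assms] by blast
  then show ?thesis
    using connected_continuous_image[of UNIV k] by (auto simp: homeomorphism_def)
qed

text \<open>Janiszewski's theorem: points separated neither by \<open>S\<close> nor by
  \<open>T\<close> are not separated by the union when \<open>S \<inter> T\<close> is connected. To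
  use the planar version the sphere is punctured at a third point \<open>p\<close> of
  \<open>F \<inter> G\<close>, which is off both sets and whose removal leaves \<open>F\<close> and
  \<open>G\<close> connected. In the application \<open>S\<close> and \<open>T\<close> are two
  graphs sharing one vertex.\<close>

lemma component_Int_sphere:
  assumes S: "compact S" "S \<subseteq> S2" and T: "compact T" "T \<subseteq> S2"
    and ST: "connected (S \<inter> T)" "S \<inter> T \<noteq> {}"
    and F: "F \<in> components (S2 - S)" and G: "G \<in> components (S2 - T)" and ne: "F \<inter> G \<noteq> {}"
  shows "F \<inter> G \<in> components (S2 - (S \<union> T))"
proof -
  have opF: "openin (top_of_set S2) F" and opG: "openin (top_of_set S2) G"
    using openin_component_sphere[OF compact_imp_closed] S T F G by auto
  then have opFG: "openin (top_of_set S2) (F \<inter> G)"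
    by blast
  have sub: "F \<subseteq> S2 - S" "G \<subseteq> S2 - T" and con: "connected F" "connected G"
    using F G in_components_subset in_components_connected by auto
  have cc: "connected_component (S2 - (S \<union> T)) a b" if a: "a \<in> F \<inter> G" and b: "b \<in> F \<inter> G" for a b
  proof -
    obtain q where q: "q \<in> S" "q \<in> T"
      using ST(2) by blast
    have "infinite (F \<inter> G)"
      using infinite_openin_sphere opFG ne by blast
    then obtain p where p: "p \<in> F" "p \<in> G" "p \<noteq> a" "p \<noteq> b"
      by (metis finite.emptyI finite_insert infinite_super subsetI IntE insertCI)
    have "p \<in> S2"
      using p sub by blast
    obtain h k where hk: "homeomorphism (S2 - {p}) (UNIV :: complex set) h k"
      using sphere_chart[OF \<open>p \<in> S2\<close>] by blast
    have contk: "continuous_on UNIV k" and conth: "continuous_on (S2 - {p}) h"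
      and kh: "\<And>x. x \<in> S2 - {p} \<Longrightarrow> k (h x) = x" and hk1: "\<And>y. h (k y) = y"
      and kim: "range k = S2 - {p}"
      using hk by (auto simp: homeomorphism_def)
    have injh: "inj_on h (S2 - {p})"
      by (rule inj_on_inverseI[of _ k]) (rule kh)
    have in_S: "S \<subseteq> S2 - {p}" "T \<subseteq> S2 - {p}"
      using S T sub p by auto
    have conn: "connected_component (- h ` X) (h a) (h b)"
      if X: "X \<subseteq> S2 - {p}" "H \<subseteq> S2 - X" "connected H" "openin (top_of_set S2) H"
        and abX: "a \<in> H" "b \<in> H" "q \<in> X" for X H
    proof -
      have "connected (H - {p})"
        using connected_delete_point_sphere[OF X(3,4)] X abX by blast
      moreover have "H - {p} \<subseteq> S2 - {p}"
        using X by auto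
      ultimately have "connected (h ` (H - {p}))"
        using connected_continuous_image continuous_on_subset[OF conth] by blast
      moreover have "h ` (H - {p}) \<inter> h ` X = h ` ((H - {p}) \<inter> X)"
        by (rule inj_on_image_Int[OF injh, symmetric]) (use X in auto)
      then have "h ` (H - {p}) \<subseteq> - h ` X"
        using X(2) by auto
      ultimately show ?thesis
        unfolding connected_component_def using abX p by blast
    qed
    have "connected_component (- h ` S) (h a) (h b)" "connected_component (- h ` T) (h a) (h b)"
      using conn[of S F] conn[of T G] in_S sub con opF opG a b q by auto
    moreover have "compact (h ` S)" "closed (h ` T)"
      using S T in_S by (auto intro!: compact_imp_closed compact_continuous_image continuous_on_subset[OF conth])
    moreover have "connected (h ` S \<inter> h ` T)"
    proof -
      have "h ` S \<inter> h ` T = h ` (S \<inter> T)"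
        using inj_on_image_Int[OF injh] in_S by blast
      moreover have "connected (h ` (S \<inter> T))"
        using ST(1) in_S by (intro connected_continuous_image continuous_on_subset[OF conth]) auto
      ultimately show ?thesis by simp
    qed
    ultimately have "connected_component (- (h ` S \<union> h ` T)) (h a) (h b)"
      using Janiszewski by blast
    then obtain Y where Y: "connected Y" "Y \<subseteq> - (h ` S \<union> h ` T)" "h a \<in> Y" "h b \<in> Y"
      by (auto simp: connected_component_def)
    have "connected (k ` Y)"
      using Y by (intro connected_continuous_image continuous_on_subset[OF contk]) auto
    moreover have "k ` Y \<subseteq> S2 - (S \<union> T)"
    proof
      fix y assume "y \<in> k ` Y"
      then have "h y \<in> Y" "y \<in> S2 - {p}"
        using hk1 rangeI[of k] unfolding kim by auto
      then show "y \<in> S2 - (S \<union> T)"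
        using Y(2) by auto
    qed
    moreover have "a \<in> k ` Y" "b \<in> k ` Y"
    proof -
      have "a \<in> S2 - {p}" "b \<in> S2 - {p}"
        using a b p sub by auto
      then show "a \<in> k ` Y" "b \<in> k ` Y"
        using kh Y(3,4) by (metis image_eqI)+
    qed
    ultimately show ?thesis
      unfolding connected_component_def by blast
  qed
  obtain a where a: "a \<in> F" "a \<in> G"
    using ne by blast
  have aC: "a \<in> connected_component_set (S2 - (S \<union> T)) a"
    using cc[of a a] a by simp
  have "connected_component_set (S2 - (S \<union> T)) a = F \<inter> G"
  proof
    show "F \<inter> G \<subseteq> connected_component_set (S2 - (S \<union> T)) a"
      using cc a by blast
    have "connected_component_set (S2 - (S \<union> T)) a \<subseteq> F"
      by (rule components_maximal[OF F]) (use connected_component_subset[of "S2 - (S \<union> T)" a] a aC in auto)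
    moreover have "connected_component_set (S2 - (S \<union> T)) a \<subseteq> G"
      by (rule components_maximal[OF G]) (use connected_component_subset[of "S2 - (S \<union> T)" a] a aC in auto)
    ultimately show "connected_component_set (S2 - (S \<union> T)) a \<subseteq> F \<inter> G"
      by blast
  qed
  moreover have "a \<in> S2 - (S \<union> T)"
    using a sub by auto
  ultimately show ?thesis
    by (auto simp: components_def)
qed

text \<open>Limit points of \<open>F\<close> off \<open>X\<close> can be added to \<open>F\<close>
  without losing connectedness, and a component is maximal.\<close>

lemma closure_component_Diff:
  assumes "F \<in> components (S - X)" "closed S"
  shows "closure F - X \<subseteq> F"
proof -
  have "F \<union> (closure F - X) \<subseteq> F"
  proof (rule components_maximal[OF assms(1)])
    show "connected (F \<union> (closure F - X))"
      by (rule connected_intermediate_closure[of F])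
        (use in_components_connected[OF assms(1)] closure_subset in auto)
    show "F \<union> (closure F - X) \<subseteq> S - X"
      using in_components_subset[OF assms(1)] closure_minimal[of F S] assms(2) by auto
    show "F \<inter> (F \<union> (closure F - X)) \<noteq> {}"
      using in_components_nonempty[OF assms(1)] by auto
  qed
  then show ?thesis by blast
qed

text \<open>A component bordered by at most the point \<open>c\<close> would be open and closed in
  the sphere without \<open>c\<close>, which is connected.\<close>

lemma closure_component_meets:
  assumes X: "closed X" "X \<subseteq> S2" "\<not> X \<subseteq> {c}" and F: "F \<in> components (S2 - X)"
  shows "closure F \<inter> X - {c} \<noteq> {}"
proof
  assume *: "closure F \<inter> X - {c} = {}"
  have FS: "F \<subseteq> S2 - X"
    using F in_components_subset by blast
  have clF: "closure F \<subseteq> insert c F"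
    using closure_component_Diff[OF F] * by auto
  have con: "connected (S2 - {c})"
    using connected_punctured_sphere[of c] by (cases "c \<in> S2") (auto simp: connected_sphere_eq)
  have op: "openin (top_of_set S2) F"
    using openin_component_sphere X F by blast
  then have cl: "closed (S2 - F)"
    using closedin_closed_trans[of S2 "S2 - F"] by (simp add: closedin_diff)
  have "S2 - {c} \<subseteq> closure F"
  proof (rule connected_subset_closed[OF con _ cl])
    show "S2 - {c} \<subseteq> closure F \<union> (S2 - F)"
      using closure_subset by auto
    show "closure F \<inter> (S2 - F) \<inter> (S2 - {c}) = {}"
      using clF by auto
    obtain x where x: "x \<in> F"
      using in_components_nonempty[OF F] by auto
    have "F \<noteq> {c}"
      using infinite_openin_sphere[OF op] by auto
    then show "(S2 - {c}) \<inter> closure F \<noteq> {}"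
      using x FS closure_subset by blast
  qed simp
  then show False
    using X * by auto
qed

section \<open>Plane graphs\<close>

definition supp :: "point set \<Rightarrow> point set set \<Rightarrow> point set" where
  "supp V E = V \<union> \<Union>E"

lemma faces_supp: "faces V E = components (S2 - supp V E)"
  by (simp add: faces_def supp_def)

lemma planar_graph_finite: "planar_graph V E \<Longrightarrow> finite V" "planar_graph V E \<Longrightarrow> finite E"
  by (auto simp: planar_graph_def)

lemma planar_graph_vertices: "planar_graph V E \<Longrightarrow> V \<subseteq> S2"
  by (simp add: planar_graph_def)

lemma edge_Int: "planar_graph V E \<Longrightarrow> e \<in> E \<Longrightarrow> f \<in> E \<Longrightarrow> e \<noteq> f \<Longrightarrow> e \<inter> f \<subseteq> V"
  by (simp add: planar_graph_def)

lemma edge_path: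
  assumes "planar_graph V E" "e \<in> E"
  obtains g where "simple_path g" "path_image g = e" "e \<inter> V = {pathstart g, pathfinish g}" "e \<subseteq> S2"
proof -
  have e: "e \<subseteq> S2" "\<exists>u w. joins e u w \<and> e \<inter> V = {u, w}"
    using assms by (simp_all add: planar_graph_def)
  then obtain u w where uw: "joins e u w" "e \<inter> V = {u, w}"
    by blast
  from uw(1) obtain g where "simple_path g" "path_image g = e" "pathstart g = u" "pathfinish g = w"
    unfolding joins_def by blast
  with uw(2) e(1) show ?thesis
    using that[of g] by simp
qed

lemma edge_facts:
  assumes "planar_graph V E" "e \<in> E"
  shows edge_compact: "compact e" and edge_sphere: "e \<subseteq> S2"
    and edge_connected: "connected (e - V)" and edge_nonempty: "e - V \<noteq> {}"
    and edge_closure: "closure (e - V) = e"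
proof -
  obtain g where g: "simple_path g" "path_image g = e" "e \<inter> V = {pathstart g, pathfinish g}" "e \<subseteq> S2"
    using edge_path[OF assms] .
  show com: "compact e"
    using g compact_simple_path_image by blast
  show "e \<subseteq> S2" by fact
  have eV: "e - V = path_image g - {pathstart g, pathfinish g}"
    using g(2,3) by blast
  show "connected (e - V)" "e - V \<noteq> {}"
    unfolding eV using g(1) by (rule connected_simple_path_endless nonempty_simple_path_endless)+
  show "closure (e - V) = e"
  proof
    show "closure (e - V) \<subseteq> e"
      using com by (simp add: closure_minimal compact_imp_closed)
    have img: "e - V = g ` {0<..<1}"
      unfolding eV by (rule simple_path_endless[OF g(1)])
    have cont: "continuous_on {0..1} g"
      using g(1) simple_path_imp_path path_def by blast
    have "g ` closure {0<..<1} \<subseteq> closure (g ` {0<..<1})"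
      by (rule image_closure_subset) (use cont closure_subset[of "g ` {0<..<1}"] in simp_all)
    then show "e \<subseteq> closure (e - V)"
      using g(2) by (simp add: img path_image_def)
  qed
qed

lemma edge_ends:
  assumes "planar_graph V E" "e \<in> E"
  obtains u w where "e \<inter> V = {u, w}"
  using edge_path[OF assms] by metis

lemma edge_ends_Diff:
  assumes G: "planar_graph V E" "e \<in> E" and X: "X \<subseteq> V"
  shows "connected (e - X)" "e - X \<noteq> {}" "closure (e - X) = e"
proof -
  have sub: "e - V \<subseteq> e - X"
    using X by blast
  show "connected (e - X)"
    by (rule connected_intermediate_closure[OF edge_connected[OF G] sub])
      (use edge_closure[OF G] in blast)
  show "e - X \<noteq> {}"
    using edge_nonempty[OF G] sub by blast
  show "closure (e - X) = e"
    using closure_mono[OF sub] edge_closure[OF G] closure_minimal[of "e - X" e]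
      compact_imp_closed[OF edge_compact[OF G]] by blast
qed

lemma supp_compact: "planar_graph V E \<Longrightarrow> compact (supp V E)"
  unfolding supp_def
  by (rule compact_Un[OF finite_imp_compact compact_Union])
    (auto intro: planar_graph_finite edge_compact)

lemma supp_sphere: "planar_graph V E \<Longrightarrow> supp V E \<subseteq> S2"
  unfolding supp_def using planar_graph_vertices edge_sphere by blast

lemma openin_face: "planar_graph V E \<Longrightarrow> F \<in> faces V E \<Longrightarrow> openin (top_of_set S2) F"
  unfolding faces_supp using openin_component_sphere supp_compact compact_imp_closed by blast

lemma face_subset: "F \<in> faces V E \<Longrightarrow> F \<subseteq> S2 - supp V E"
  unfolding faces_supp by (rule in_components_subset)

lemma faces_disjoint: "F \<in> faces V E \<Longrightarrow> F' \<in> faces V E \<Longrightarrow> F \<noteq> F' \<Longrightarrow> F \<inter> F' = {}"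
  unfolding faces_supp using components_nonoverlap by blast

lemma closure_face_disjoint:
  assumes "planar_graph V E" "F \<in> faces V E" "F' \<in> faces V E" "F \<noteq> F'"
  shows "closure F \<inter> F' = {}"
proof -
  obtain U where U: "open U" "F' = S2 \<inter> U"
    using openin_face[OF assms(1,3)] by (auto simp: openin_open)
  have "F \<inter> U = {}"
    using faces_disjoint[OF assms(2-4)] face_subset[OF assms(2)] U(2) by blast
  then have "closure F \<inter> U = {}"
    using U(1) by (simp add: Int_commute open_Int_closure_eq_empty)
  then show ?thesis
    using U(2) by blast
qed

section \<open>Subgraphs, and two graphs glued at a vertex\<close>

lemma subgraph_planar:
  assumes "planar_graph V E" "V' \<subseteq> V" "E' \<subseteq> E" "\<And>e. e \<in> E' \<Longrightarrow> e \<inter> V \<subseteq> V'"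
  shows "planar_graph V' E'"
  unfolding planar_graph_def
proof (intro conjI ballI impI)
  show "finite V'" "finite E'"
    using assms planar_graph_finite finite_subset by blast+
  show "V' \<subseteq> S2"
    using assms planar_graph_vertices by blast
next
  fix e assume e: "e \<in> E'"
  then have eE: "e \<in> E" using assms by blast
  show "e \<subseteq> S2"
    using edge_sphere[OF assms(1) eE] .
  have "e \<inter> V' = e \<inter> V"
    using assms(2) assms(4)[OF e] by blast
  then show "\<exists>u w. joins e u w \<and> e \<inter> V' = {u, w}"
    using assms(1) eE unfolding planar_graph_def by simp
next
  fix e f assume "e \<in> E'" "f \<in> E'" "e \<noteq> f"
  then show "e \<inter> f \<subseteq> V'"
    using edge_Int[OF assms(1), of e f] assms(3) assms(4)[of e] by blast
qed

text \<open>Each of the two graphs lies, apart from \<open>c\<close>, in a single face of the other: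
  the second in \<open>A1\<close>, the first in \<open>A2\<close>. These two faces merge into
  \<open>A1 \<inter> A2\<close>, while all other faces survive unchanged.\<close>

definition wedge ::
  "point set \<Rightarrow> point set set \<Rightarrow> point \<Rightarrow> point set \<Rightarrow> point set set \<Rightarrow> point set \<Rightarrow>
    point set \<Rightarrow> point set set \<Rightarrow> point set \<Rightarrow> bool" where
  "wedge V E c V1 E1 A1 V2 E2 A2 \<longleftrightarrow>
     planar_graph V E \<and> planar_graph V1 E1 \<and> planar_graph V2 E2 \<and>
     V = V1 \<union> V2 \<and> V1 \<inter> V2 = {c} \<and> E = E1 \<union> E2 \<and> E1 \<inter> E2 = {} \<and> E1 \<noteq> {} \<and> E2 \<noteq> {} \<and>
     connected (supp V1 E1) \<and> connected (supp V2 E2) \<and> supp V1 E1 \<inter> supp V2 E2 = {c} \<and>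
     A1 \<in> faces V1 E1 \<and> A2 \<in> faces V2 E2 \<and> supp V1 E1 - {c} \<subseteq> A2 \<and> supp V2 E2 - {c} \<subseteq> A1"

lemma wedge_sym: "wedge V E c V1 E1 A1 V2 E2 A2 \<Longrightarrow> wedge V E c V2 E2 A2 V1 E1 A1"
  unfolding wedge_def
  by (elim conjE, intro conjI) (simp_all only: Un_commute Int_commute not_False_eq_True)

lemma edge_not_subset_singleton:
  assumes "planar_graph V E" "e \<in> E"
  shows "\<not> e \<subseteq> {x}"
proof
  assume e: "e \<subseteq> {x}"
  obtain u w where "e \<inter> V = {u, w}"
    using edge_ends[OF assms] .
  then show False
    using e edge_nonempty[OF assms] by blast
qed

context
  fixes V E c V1 E1 A1 V2 E2 A2
  assumes w: "wedge V E c V1 E1 A1 V2 E2 A2"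
begin

lemma wedge_graphs: "planar_graph V E" "planar_graph V1 E1" "planar_graph V2 E2"
  and wedge_sets: "V = V1 \<union> V2" "V1 \<inter> V2 = {c}" "E = E1 \<union> E2" "E1 \<inter> E2 = {}"
    "supp V1 E1 \<inter> supp V2 E2 = {c}"
  and wedge_faces: "A1 \<in> faces V1 E1" "A2 \<in> faces V2 E2" "supp V1 E1 - {c} \<subseteq> A2" "supp V2 E2 - {c} \<subseteq> A1"
  and wedge_con: "connected (supp V1 E1)" "E1 \<noteq> {}"
  using w unfolding wedge_def by blast+

lemma wedge_supp: "supp V E = supp V1 E1 \<union> supp V2 E2"
  unfolding supp_def using wedge_sets by auto

lemma wedge_proper_face:
  assumes "F \<in> faces V1 E1" "F \<noteq> A1"
  shows "F \<in> faces V E"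
proof -
  have "F \<inter> supp V2 E2 = {}"
    using faces_disjoint[OF assms(1) wedge_faces(1) assms(2)] wedge_faces(4) wedge_sets(5)
      face_subset[OF assms(1)] by blast
  then have "F \<subseteq> S2 - supp V E"
    using face_subset[OF assms(1)] wedge_supp by blast
  then show ?thesis
    using components_intermediate_subset assms(1) wedge_supp unfolding faces_supp by blast
qed

lemma wedge_not_singleton: "\<not> supp V1 E1 \<subseteq> {x}"
  using wedge_con(2) edge_not_subset_singleton[OF wedge_graphs(2), of _ x]
  unfolding supp_def by blast

text \<open>The first graph is connected and not a single point, so it accumulates at
  \<open>c\<close>, and without \<open>c\<close> it lies in \<open>A2\<close>. This supplies the
  incidence needed to apply the divisibility statement to the second part with \<open>c\<close> and
  \<open>A2\<close> as the exceptions.\<close>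

lemma wedge_apex_closure: "c \<in> closure A2"
proof -
  have "c islimpt supp V1 E1"
  proof (rule connected_imp_perfect[OF wedge_con(1)])
    show "c \<in> supp V1 E1"
      using wedge_sets(5) by blast
    show "supp V1 E1 \<noteq> {x}" for x
      using wedge_not_singleton by blast
  qed
  then have "c islimpt A2"
    using wedge_faces(3) islimpt_punctured islimpt_subset by blast
  then show ?thesis
    by (simp add: closure_def)
qed

text \<open>Away from \<open>c\<close> the edge lies in \<open>A2\<close>, which is open, so points
  of \<open>A1\<close> close to the edge can be taken in \<open>A2\<close> as well; taking closures
  recovers \<open>c\<close>.\<close>

lemma wedge_edge_merged:
  assumes "e \<in> E1"
  shows "e \<subseteq> closure (A1 \<inter> A2) \<longleftrightarrow> e \<subseteq> closure A1"
proof
  show "e \<subseteq> closure (A1 \<inter> A2) \<Longrightarrow> e \<subseteq> closure A1"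
    using closure_mono[of "A1 \<inter> A2" A1] by blast
  assume e: "e \<subseteq> closure A1"
  obtain U where U: "open U" "A2 = S2 \<inter> U"
    using openin_face[OF wedge_graphs(3) wedge_faces(2)] by (auto simp: openin_open)
  have "c \<in> V1"
    using wedge_sets by blast
  have "e - {c} \<subseteq> U \<inter> closure A1"
    using e U(2) wedge_faces(3) assms by (auto simp: supp_def)
  also have "\<dots> \<subseteq> closure (U \<inter> A1)"
    by (rule open_Int_closure_subset[OF U(1)])
  also have "U \<inter> A1 = A1 \<inter> A2"
    using U(2) face_subset[OF wedge_faces(1)] by blast
  finally have "closure (e - {c}) \<subseteq> closure (A1 \<inter> A2)"
    by (simp add: closure_minimal)
  then show "e \<subseteq> closure (A1 \<inter> A2)"
    using edge_ends_Diff(3)[OF wedge_graphs(2) assms, of "{c}"] \<open>c \<in> V1\<close> by simp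
qed

lemma wedge_edge_other:
  assumes "e \<in> E1" "F \<in> faces V2 E2" "F \<noteq> A2"
  shows "\<not> e \<subseteq> closure F"
proof -
  have "e - {c} \<subseteq> A2"
    using wedge_faces(3) assms(1) by (auto simp: supp_def)
  moreover have "e - {c} \<noteq> {}"
    using edge_not_subset_singleton[OF wedge_graphs(2) assms(1)] by blast
  ultimately show ?thesis
    using closure_face_disjoint[OF wedge_graphs(3) assms(2) wedge_faces(2) assms(3)] by blast
qed

lemma wedge_degree:
  assumes "v \<in> V1" "v \<noteq> c"
  shows "vertex_degree V E v = vertex_degree V1 E1 v"
proof -
  have "v \<notin> e" if "e \<in> E2" for e
    using assms wedge_sets(5) that unfolding supp_def by blast
  moreover have "e \<inter> V = e \<inter> V1" if "e \<in> E1" for e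
  proof -
    have "e \<inter> V2 \<subseteq> {c}"
      using wedge_sets(5) that unfolding supp_def by blast
    then show ?thesis
      using wedge_sets(1,2) by blast
  qed
  ultimately have "{e \<in> E. v \<in> e} = {e \<in> E1. v \<in> e}" "{e \<in> E. e \<inter> V = {v}} = {e \<in> E1. e \<inter> V1 = {v}}"
    using wedge_sets(3) by blast+
  then show ?thesis
    by (simp add: vertex_degree_def)
qed

end

context
  fixes V E c V1 E1 A1 V2 E2 A2
  assumes w: "wedge V E c V1 E1 A1 V2 E2 A2"
begin

lemma wedge_degree_apex:
  "vertex_degree V E c = vertex_degree V1 E1 c + vertex_degree V2 E2 c"
proof -
  note s = wedge_sets[OF w]
  have fin: "finite E1" "finite E2"
    using planar_graph_finite wedge_graphs[OF w] by blast+
  have "{e \<in> E. c \<in> e} = {e \<in> E1. c \<in> e} \<union> {e \<in> E2. c \<in> e}"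
    using s by blast
  then have 1: "card {e \<in> E. c \<in> e} = card {e \<in> E1. c \<in> e} + card {e \<in> E2. c \<in> e}"
    using s(4) fin by (simp add: card_Un_disjoint disjoint_iff)
  have e1: "e \<inter> V = e \<inter> V1" if "e \<in> E1" for e
    using s(1,2,5) that unfolding supp_def by blast
  have e2: "e \<inter> V = e \<inter> V2" if "e \<in> E2" for e
    using s(1,2,5) that unfolding supp_def by blast
  have "{e \<in> E. e \<inter> V = {c}} = {e \<in> E1. e \<inter> V1 = {c}} \<union> {e \<in> E2. e \<inter> V2 = {c}}"
    using s(3) e1 e2 by blast
  then have 2: "card {e \<in> E. e \<inter> V = {c}} = card {e \<in> E1. e \<inter> V1 = {c}} + card {e \<in> E2. e \<inter> V2 = {c}}"
    using s(4) fin by (simp add: card_Un_disjoint disjoint_iff)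
  show ?thesis
    by (simp add: vertex_degree_def 1 2)
qed

text \<open>The face \<open>A1\<close> comes close to a point of the first graph other than
  \<open>c\<close>. That point lies in the open set \<open>A2\<close>, so the two faces meet. Their
  intersection is a single component because the two supports meet in the point \<open>c\<close>
  only.\<close>

lemma wedge_merged_face: "A1 \<inter> A2 \<in> faces V E" and wedge_merged_nonempty: "A1 \<inter> A2 \<noteq> {}"
proof -
  note g = wedge_graphs[OF w] and s = wedge_sets[OF w] and f = wedge_faces[OF w]
  have "closure A1 \<inter> supp V1 E1 - {c} \<noteq> {}"
    using closure_component_meets[OF compact_imp_closed[OF supp_compact[OF g(2)]] supp_sphere[OF g(2)]
        wedge_not_singleton[OF w]] f(1) unfolding faces_supp by blast
  then have ne: "closure A1 \<inter> A2 \<noteq> {}"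
    using f(3) by blast
  obtain U where U: "open U" "A2 = S2 \<inter> U"
    using openin_face[OF g(3) f(2)] by (auto simp: openin_open)
  have "U \<inter> A1 \<noteq> {}"
    using ne U open_Int_closure_eq_empty[OF U(1), of A1] by blast
  then show *: "A1 \<inter> A2 \<noteq> {}"
    using U(2) face_subset[OF f(1)] by blast
  show "A1 \<inter> A2 \<in> faces V E"
    using component_Int_sphere[of "supp V1 E1" "supp V2 E2" A1 A2] * f(1,2) g s(5)
      supp_compact supp_sphere
    unfolding faces_supp wedge_supp[OF w] by simp
qed

text \<open>A face of the union lies in a face of each part. If one of these is not the special face
  of its part, it is itself a face of the union and therefore the given one.\<close>

lemma wedge_faces_eq: "faces V E = faces V1 E1 - {A1} \<union> (faces V2 E2 - {A2}) \<union> {A1 \<inter> A2}"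
proof
  show "faces V1 E1 - {A1} \<union> (faces V2 E2 - {A2}) \<union> {A1 \<inter> A2} \<subseteq> faces V E"
    using wedge_proper_face[OF w] wedge_proper_face[OF wedge_sym[OF w]] wedge_merged_face by blast
  show "faces V E \<subseteq> faces V1 E1 - {A1} \<union> (faces V2 E2 - {A2}) \<union> {A1 \<inter> A2}"
  proof
    fix F assume F: "F \<in> faces V E"
    then have con: "connected F" "F \<noteq> {}" "F \<subseteq> S2 - supp V1 E1" "F \<subseteq> S2 - supp V2 E2"
      using in_components_connected in_components_nonempty in_components_subset wedge_supp[OF w]
      unfolding faces_supp by blast+
    obtain F1 where F1: "F1 \<in> faces V1 E1" "F \<subseteq> F1"
      unfolding faces_supp using exists_component_superset[OF con(3) _ con(1)] con(2,3) by blast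
    obtain F2 where F2: "F2 \<in> faces V2 E2" "F \<subseteq> F2"
      unfolding faces_supp using exists_component_superset[OF con(4) _ con(1)] con(2,4) by blast
    show "F \<in> faces V1 E1 - {A1} \<union> (faces V2 E2 - {A2}) \<union> {A1 \<inter> A2}"
    proof (cases "F1 = A1 \<and> F2 = A2")
      case True
      then have "F \<inter> (A1 \<inter> A2) \<noteq> {}"
        using F1 F2 con by blast
      then show ?thesis
        using faces_disjoint[OF F wedge_merged_face] by blast
    next
      case False
      then show ?thesis
      proof (cases "F1 = A1")
        case True
        then have "F2 \<in> faces V E" "F2 \<noteq> A2"
          using False wedge_proper_face[OF wedge_sym[OF w] F2(1)] by blast+
        then show ?thesis
          using faces_disjoint[OF F, of F2] F2 con(2) by blast
      next
        case False
        then have "F1 \<in> faces V E"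
          using wedge_proper_face[OF w F1(1)] by blast
        then show ?thesis
          using faces_disjoint[OF F, of F1] F1 con(2) False by blast
      qed
    qed
  qed
qed

text \<open>Whether an edge counts once or twice depends on all faces, hence the comparison for each
  kind of face. As a result degrees of proper faces are kept and those of \<open>A1\<close> and
  \<open>A2\<close> add up in the merged face.\<close>

lemma wedge_sides:
  assumes "e \<in> E1"
  shows "F \<in> faces V1 E1 \<Longrightarrow> F \<noteq> A1 \<Longrightarrow> sides V E F e = sides V1 E1 F e"
    and "sides V E (A1 \<inter> A2) e = sides V1 E1 A1 e"
    and "F \<in> faces V2 E2 \<Longrightarrow> F \<noteq> A2 \<Longrightarrow> sides V E F e = 0"
proof -
  note m = wedge_edge_merged[OF w assms] and o = wedge_edge_other[OF w assms]
  have ne: "F \<noteq> A1 \<inter> A2" if "F \<in> faces V1 E1" "F \<noteq> A1" for F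
    using faces_disjoint[OF that(1) wedge_faces(1)[OF w] that(2)] wedge_merged_nonempty by blast
  have A1: "A1 \<in> faces V1 E1"
    using wedge_faces[OF w] by blast
  have ex: "(\<exists>F'\<in>faces V E. F' \<noteq> F \<and> e \<subseteq> closure F') \<longleftrightarrow>
      (\<exists>F'\<in>faces V1 E1 - {A1}. F' \<noteq> F \<and> e \<subseteq> closure F') \<or> (A1 \<inter> A2 \<noteq> F \<and> e \<subseteq> closure A1)" for F
    unfolding wedge_faces_eq bex_Un using m o by auto
  show "sides V E F e = sides V1 E1 F e" if F: "F \<in> faces V1 E1" "F \<noteq> A1"
  proof -
    have "(\<exists>F'\<in>faces V E. F' \<noteq> F \<and> e \<subseteq> closure F') \<longleftrightarrow> (\<exists>F'\<in>faces V1 E1. F' \<noteq> F \<and> e \<subseteq> closure F')"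
      unfolding ex using ne[OF F] A1 F(2) by auto
    then show ?thesis
      unfolding sides_def by simp
  qed
  have "(\<exists>F'\<in>faces V E. F' \<noteq> A1 \<inter> A2 \<and> e \<subseteq> closure F') \<longleftrightarrow>
      (\<exists>F'\<in>faces V1 E1. F' \<noteq> A1 \<and> e \<subseteq> closure F')"
    unfolding ex using ne by auto
  then show "sides V E (A1 \<inter> A2) e = sides V1 E1 A1 e"
    unfolding sides_def using m by simp
  show "sides V E F e = 0" if F: "F \<in> faces V2 E2" "F \<noteq> A2"
    using o[OF F] by (simp add: sides_def)
qed

end

context
  fixes V E c V1 E1 A1 V2 E2 A2
  assumes w: "wedge V E c V1 E1 A1 V2 E2 A2"
begin

lemma wedge_face_degree_split:
  "face_degree V E F = (\<Sum>e\<in>E1. sides V E F e) + (\<Sum>e\<in>E2. sides V E F e)"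
  using wedge_sets[OF w] planar_graph_finite wedge_graphs[OF w]
  by (simp add: face_degree_def sum.union_disjoint)

lemma wedge_face_degree:
  assumes "F \<in> faces V1 E1" "F \<noteq> A1"
  shows "face_degree V E F = face_degree V1 E1 F"
  unfolding wedge_face_degree_split
  using wedge_sides(1)[OF w _ assms] wedge_sides(3)[OF wedge_sym[OF w] _ assms]
  by (simp add: face_degree_def)

lemma wedge_face_degree_merged:
  "face_degree V E (A1 \<inter> A2) = face_degree V1 E1 A1 + face_degree V2 E2 A2"
proof -
  have "sides V E (A1 \<inter> A2) e = sides V2 E2 A2 e" if "e \<in> E2" for e
    using wedge_sides(2)[OF wedge_sym[OF w] that] by (simp add: Int_commute)
  then show ?thesis
    unfolding wedge_face_degree_split using wedge_sides(2)[OF w]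
    by (simp add: face_degree_def)
qed

end

section \<open>Splitting at a cut vertex\<close>

lemma insert_connected_closure:
  assumes "connected S" "c \<in> closure S"
  shows "connected (insert c S)"
  by (rule connected_intermediate_closure[OF assms(1)]) (use assms(2) closure_subset in blast)+

context
  fixes V :: "point set" and E :: "point set set" and c :: point
  assumes G: "planar_graph V E" and con: "connected (supp V E)" and c: "c \<in> V"
begin

text \<open>Here \<open>U\<close> is a union of branches, the components of the support without
  \<open>c\<close>. Testing \<open>e - {c}\<close> lets edges ending at \<open>c\<close>, and loops
  at \<open>c\<close>, belong to their branch.\<close>

definition branch_vertices where "branch_vertices U = insert c (V \<inter> U)"
definition branch_edges where "branch_edges U = {e \<in> E. e - {c} \<subseteq> U}"

lemma branch_edge_cases:
  assumes "Q \<in> components (supp V E - {c})" "e \<in> E" "e \<inter> Q \<noteq> {}"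
  shows "e - {c} \<subseteq> Q"
proof (rule components_maximal[OF assms(1)])
  show "connected (e - {c})"
    using edge_ends_Diff(1)[OF G assms(2), of "{c}"] c by simp
  show "e - {c} \<subseteq> supp V E - {c}"
    using assms(2) by (auto simp: supp_def)
  show "Q \<inter> (e - {c}) \<noteq> {}"
    using assms(3) in_components_subset[OF assms(1)] by blast
qed

lemma branch_supp:
  assumes "\<Q> \<subseteq> components (supp V E - {c})"
  shows "supp (branch_vertices (\<Union>\<Q>)) (branch_edges (\<Union>\<Q>)) = insert c (\<Union>\<Q>)"
proof
  show "supp (branch_vertices (\<Union>\<Q>)) (branch_edges (\<Union>\<Q>)) \<subseteq> insert c (\<Union>\<Q>)"
    by (auto simp: supp_def branch_vertices_def branch_edges_def)
  show "insert c (\<Union>\<Q>) \<subseteq> supp (branch_vertices (\<Union>\<Q>)) (branch_edges (\<Union>\<Q>))"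
  proof
    fix x assume x: "x \<in> insert c (\<Union>\<Q>)"
    show "x \<in> supp (branch_vertices (\<Union>\<Q>)) (branch_edges (\<Union>\<Q>))"
    proof (cases "x = c")
      case True
      then show ?thesis by (simp add: supp_def branch_vertices_def)
    next
      case False
      then obtain Q where Q: "Q \<in> \<Q>" "x \<in> Q"
        using x by blast
      then have Qc: "Q \<in> components (supp V E - {c})"
        using assms by blast
      then have "x \<in> supp V E"
        using Q in_components_subset by blast
      then consider "x \<in> V" | e where "e \<in> E" "x \<in> e"
        by (auto simp: supp_def)
      then show ?thesis
      proof cases
        case 1
        then show ?thesis
          using Q by (auto simp: supp_def branch_vertices_def)
      next
        case (2 e)
        then have "e - {c} \<subseteq> Q"
          using branch_edge_cases[OF Qc] Q by blast
        then have "e \<in> branch_edges (\<Union>\<Q>)"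
          using 2 Q by (auto simp: branch_edges_def)
        then show ?thesis
          using 2 by (auto simp: supp_def)
      qed
    qed
  qed
qed

lemma branch_planar: "planar_graph (branch_vertices U) (branch_edges U)"
  by (rule subgraph_planar[OF G]) (use c in \<open>auto simp: branch_vertices_def branch_edges_def\<close>)

lemma branch_closed:
  assumes "\<Q> \<subseteq> components (supp V E - {c})"
  shows "compact (insert c (\<Union>\<Q>))"
  using supp_compact[OF branch_planar] branch_supp[OF assms] by metis

lemma branch_closed_single: "Q \<in> components (supp V E - {c}) \<Longrightarrow> compact (insert c Q)"
  using branch_closed[of "{Q}"] by simp

lemma branch_complement:
  assumes "Q \<in> components (supp V E - {c})"
  shows "insert c (\<Union>(components (supp V E - {c}) - {Q})) = supp V E - Q"
proof -
  have "\<Union>(components (supp V E - {c}) - {Q}) = supp V E - {c} - Q"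
  proof
    show "\<Union>(components (supp V E - {c}) - {Q}) \<subseteq> supp V E - {c} - Q"
      using components_nonoverlap[OF assms] in_components_subset by blast
    show "supp V E - {c} - Q \<subseteq> \<Union>(components (supp V E - {c}) - {Q})"
      using Union_components[of "supp V E - {c}"] by blast
  qed
  moreover have "c \<in> supp V E" "c \<notin> Q"
    using c in_components_subset[OF assms] by (auto simp: supp_def)
  ultimately show ?thesis by blast
qed

text \<open>Otherwise the branch and the rest of the support would be disjoint closed sets covering
  a connected set.\<close>

lemma branch_apex_closure:
  assumes Q: "Q \<in> components (supp V E - {c})"
  shows "c \<in> closure Q"
proof (rule ccontr)
  assume "c \<notin> closure Q"
  moreover have "closure Q \<subseteq> insert c Q"
    using branch_closed_single[OF Q] by (meson closure_minimal compact_imp_closed subset_insertI)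
  ultimately have "closure Q = Q"
    using closure_subset by blast
  then have "closed Q"
    by (metis closed_closure)
  moreover have "closed (supp V E - Q)"
    using branch_closed[of "components (supp V E - {c}) - {Q}"] branch_complement[OF Q]
    by (metis Diff_subset compact_imp_closed)
  ultimately have "supp V E \<subseteq> Q"
    by (rule connected_subset_closed[OF con])
      (use in_components_nonempty[OF Q] in_components_subset[OF Q] in auto)
  moreover have "c \<in> supp V E" "c \<notin> Q"
    using c in_components_subset[OF Q] by (auto simp: supp_def)
  ultimately show False by blast
qed

lemma branch_connected:
  assumes "\<Q> \<subseteq> components (supp V E - {c})"
  shows "connected (insert c (\<Union>\<Q>))"
proof -
  have "connected (\<Union>(insert {c} (insert c ` \<Q>)))"
  proof (rule connected_Union)
    show "connected s" if "s \<in> insert {c} (insert c ` \<Q>)" for s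
    proof -
      have "connected (insert c Q)" if "Q \<in> \<Q>" for Q
        using insert_connected_closure[OF in_components_connected branch_apex_closure] that assms by blast
      then show ?thesis using that by auto
    qed
  qed auto
  moreover have "\<Union>(insert {c} (insert c ` \<Q>)) = insert c (\<Union>\<Q>)"
    by auto
  ultimately show ?thesis by simp
qed

text \<open>A branch is determined by its vertices and edges, for which there are finitely many
  choices.\<close>

lemma finite_branches: "finite (components (supp V E - {c}))"
proof (rule inj_on_finite)
  show "inj_on (\<lambda>Q. (V \<inter> Q, branch_edges Q)) (components (supp V E - {c}))"
  proof (rule inj_onI)
    fix Q Q' assume *: "Q \<in> components (supp V E - {c})" "Q' \<in> components (supp V E - {c})"
      "(V \<inter> Q, branch_edges Q) = (V \<inter> Q', branch_edges Q')"
    then have "insert c Q = insert c Q'"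
      using branch_supp[of "{Q}"] branch_supp[of "{Q'}"] by (simp add: branch_vertices_def)
    then show "Q = Q'"
      using in_components_subset[OF *(1)] in_components_subset[OF *(2)] by blast
  qed
  show "(\<lambda>Q. (V \<inter> Q, branch_edges Q)) ` components (supp V E - {c}) \<subseteq> Pow V \<times> Pow E"
    by (auto simp: branch_edges_def)
  show "finite (Pow V \<times> Pow E)"
    using planar_graph_finite[OF G] by simp
qed

text \<open>Choose a branch \<open>Q\<close> and a face \<open>F\<close> of it containing as many other branches as possible. A branch
  outside \<open>F\<close> would have a face containing \<open>Q\<close> and all the branches in \<open>F\<close>.\<close>

lemma extremal_branch:
  assumes "\<not> connected (supp V E - {c})"
  obtains Q F where "Q \<in> components (supp V E - {c})" "F \<in> components (S2 - insert c Q)"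
    "supp V E - insert c Q \<subseteq> F"
proof -
  let ?B = "components (supp V E - {c})"
  define P where "P = (\<lambda>(Q, F). Q \<in> ?B \<and> F \<in> components (S2 - insert c Q))"
  define m where "m = (\<lambda>(Q :: point set, F). card {Q' \<in> ?B. Q' \<subseteq> F})"
  have cV: "c \<in> supp V E"
    using c by (simp add: supp_def)
  have face: "\<exists>F. F \<in> components (S2 - insert c Q) \<and> Q' \<subseteq> F" if "Q \<in> ?B" "Q' \<in> ?B" "Q \<noteq> Q'" for Q Q'
  proof (rule exists_component_superset)
    show "Q' \<subseteq> S2 - insert c Q"
      using components_nonoverlap[OF that(1,2)] in_components_subset[OF that(2)] supp_sphere[OF G] that(3)
      by blast
    show "S2 - insert c Q \<noteq> {}"
      using \<open>Q' \<subseteq> S2 - insert c Q\<close> in_components_nonempty[OF that(2)] by blast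
    show "connected Q'"
      using in_components_connected[OF that(2)] .
  qed
  obtain Q0 Q1 where Q01: "Q0 \<in> ?B" "Q1 \<in> ?B" "Q0 \<noteq> Q1"
    using assms connected_eq_connected_components_eq by metis
  then obtain F0 where "P (Q0, F0)"
    using face[OF Q01] by (auto simp: P_def)
  moreover have "\<forall>y. P y \<longrightarrow> m y < Suc (card ?B)"
    using finite_branches by (auto simp: m_def less_Suc_eq_le intro!: card_mono)
  ultimately have "\<exists>x. P x \<and> (\<forall>y. P y \<longrightarrow> m y \<le> m x)"
    by (rule ex_has_greatest_nat)
  then obtain x where x: "P x" "\<And>y. P y \<Longrightarrow> m y \<le> m x"
    by blast
  obtain Q F where QF: "x = (Q, F)" by force
  then have Q: "Q \<in> ?B" and F: "F \<in> components (S2 - insert c Q)"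
    using x by (auto simp: P_def)
  have "R \<subseteq> F" if R: "R \<in> ?B" "R \<noteq> Q" for R
  proof (rule ccontr)
    assume nR: "\<not> R \<subseteq> F"
    obtain F' where F': "F' \<in> components (S2 - insert c Q)" "R \<subseteq> F'"
      using face[OF Q R(1)] R(2) by blast
    then have FF': "F \<inter> F' = {}"
      using components_nonoverlap[OF F F'(1)] nR by blast
    obtain F'' where F'': "F'' \<in> components (S2 - insert c R)" "Q \<subseteq> F''"
      using face[OF R(1) Q] R(2) by blast
    have "\<not> insert c Q \<subseteq> {c}" "insert c Q \<subseteq> S2"
      using in_components_nonempty[OF Q] in_components_subset[OF Q] supp_sphere[OF G] cV by blast+
    \<comment> \<open>The face \<open>F\<close> is bordered by more than \<open>c\<close>, so it
      touches \<open>Q\<close> itself; hence \<open>F\<close> and \<open>Q\<close> together form a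
      connected set avoiding \<open>R\<close>.\<close>
    then have "closure F \<inter> insert c Q - {c} \<noteq> {}"
      using closure_component_meets[OF compact_imp_closed[OF branch_closed_single[OF Q]] _ _ F, of c]
      by blast
    then obtain z where z: "z \<in> closure F" "z \<in> Q"
      by blast
    have "connected (insert z F \<union> Q)"
      by (rule connected_Un[OF insert_connected_closure[OF in_components_connected[OF F] z(1)]
            in_components_connected[OF Q]]) (use z in blast)
    moreover have "insert z F \<union> Q \<subseteq> S2 - insert c R"
      using z in_components_subset[OF F] FF' F'(2) F'' in_components_subset[OF F''(1)] by blast
    moreover have "F'' \<inter> (insert z F \<union> Q) \<noteq> {}"
      using z F''(2) by blast
    ultimately have "F \<union> Q \<subseteq> F''"
      using components_maximal[OF F''(1)] by blast
    \<comment> \<open>The branch \<open>Q\<close> is counted for \<open>F''\<close> but not for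
      \<open>F\<close>, so the count grows strictly.\<close>
    then have "insert Q {Q' \<in> ?B. Q' \<subseteq> F} \<subseteq> {Q' \<in> ?B. Q' \<subseteq> F''}"
      using Q by blast
    moreover have "\<not> Q \<subseteq> F"
      using in_components_nonempty[OF Q] in_components_subset[OF F] by blast
    ultimately have "m (Q, F) < m (R, F'')"
      unfolding m_def using finite_branches
      by (auto intro!: psubset_card_mono)
    moreover have "P (R, F'')"
      using R F'' by (simp add: P_def)
    ultimately show False
      using x(2) QF by fastforce
  qed
  then have "\<Union>(?B - {Q}) \<subseteq> F"
    by blast
  then have "supp V E - insert c Q \<subseteq> F"
    using branch_complement[OF Q] by blast
  then show ?thesis
    using that Q F by blast
qed

text \<open>Only one of the two inclusions needs the extremal choice of \<open>Q\<close>: being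
  connected, \<open>Q\<close> lies in one face of the rest anyway, whereas the rest may consist of
  several branches.\<close>

lemma wedge_exists:
  assumes "\<not> connected (supp V E - {c})"
  obtains V1 E1 A1 V2 E2 A2 where "wedge V E c V1 E1 A1 V2 E2 A2"
proof -
  let ?B = "components (supp V E - {c})"
  obtain Q F where Q: "Q \<in> ?B" and F: "F \<in> components (S2 - insert c Q)" "supp V E - insert c Q \<subseteq> F"
    using extremal_branch[OF assms] .
  let ?U = "\<Union>(?B - {Q})"
  let ?V1 = "branch_vertices ?U" and ?E1 = "branch_edges ?U"
  let ?V2 = "branch_vertices Q" and ?E2 = "branch_edges Q"
  have s1: "supp ?V1 ?E1 = supp V E - Q"
    using branch_supp[of "?B - {Q}"] branch_complement[OF Q] by auto
  have s1': "supp ?V1 ?E1 = insert c ?U"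
    using branch_supp[of "?B - {Q}"] by auto
  have s2: "supp ?V2 ?E2 = insert c Q"
    using branch_supp[of "{Q}"] Q by simp
  have cQ: "c \<in> supp V E" "c \<notin> Q" "Q \<subseteq> supp V E" "Q \<noteq> {}"
    using c in_components_subset[OF Q] in_components_nonempty[OF Q] by (auto simp: supp_def)
  obtain Q' where Q': "Q' \<in> ?B" "Q' \<noteq> Q"
    using assms Q connected_eq_connected_components_eq by metis
  have Uc: "?U = supp V E - insert c Q"
    using branch_complement[OF Q] in_components_subset by blast
  have QU: "Q \<subseteq> S2 - supp ?V1 ?E1"
    using s1 cQ supp_sphere[OF G] by blast
  obtain A1 where A1: "A1 \<in> components (S2 - supp ?V1 ?E1)" "Q \<subseteq> A1"
    using exists_component_superset[OF QU _ in_components_connected[OF Q]] cQ(4) QU by blast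
  have Ecover: "e - {c} \<subseteq> Q \<or> e - {c} \<subseteq> ?U" if e: "e \<in> E" for e
  proof (cases "e \<inter> Q = {}")
    case True
    then show ?thesis
      using e Uc by (auto simp: supp_def)
  next
    case False
    then show ?thesis
      using branch_edge_cases[OF Q e] by blast
  qed
  \<comment> \<open>Without edges the support would be a finite connected set with at least two
    points.\<close>
  have ne: "branch_edges U \<noteq> {}" if sub: "\<Q> \<subseteq> ?B" "U = \<Union>\<Q>" "\<Q> \<noteq> {}" for \<Q> U
  proof
    assume "branch_edges U = {}"
    then have fin: "finite (insert c U)"
      using branch_supp[OF sub(1)] sub(2) planar_graph_finite(1)[OF branch_planar, of U]
      by (simp add: supp_def)
    obtain R where "R \<in> ?B" "R \<subseteq> U"
      using sub by blast
    then obtain x where x: "x \<in> U" "x \<noteq> c"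
      using in_components_nonempty in_components_subset by blast
    have "connected (insert c U)"
      using branch_connected[OF sub(1)] sub(2) by simp
    then show False
      using connected_finite_iff_sing fin x by blast
  qed
  have "wedge V E c ?V1 ?E1 A1 ?V2 ?E2 F"
    unfolding wedge_def
  proof (intro conjI)
    show "V = ?V1 \<union> ?V2"
      using c Uc unfolding branch_vertices_def supp_def by blast
    show "?V1 \<inter> ?V2 = {c}"
      using Uc unfolding branch_vertices_def by blast
    show "E = ?E1 \<union> ?E2"
      using Ecover unfolding branch_edges_def by blast
    show "?E1 \<inter> ?E2 = {}"
    proof -
      have "e - {c} \<noteq> {}" if "e \<in> E" for e
        using edge_not_subset_singleton[OF G that] by blast
      then show ?thesis
        using Uc unfolding branch_edges_def by blast
    qed
    show "?E1 \<noteq> {}"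
      using ne[of "?B - {Q}" ?U] Q' by blast
    show "?E2 \<noteq> {}"
      using ne[of "{Q}" Q] Q by blast
    show "connected (supp ?V1 ?E1)"
      using branch_connected[of "?B - {Q}"] s1' by auto
    show "connected (supp ?V2 ?E2)"
      using branch_connected[of "{Q}"] s2 Q by simp
    show "supp ?V1 ?E1 \<inter> supp ?V2 ?E2 = {c}"
      unfolding s1 s2 using cQ by blast
    show "A1 \<in> faces ?V1 ?E1" "F \<in> faces ?V2 ?E2"
      unfolding faces_supp using A1 F s2 by simp_all
    show "supp ?V1 ?E1 - {c} \<subseteq> F"
      using F(2) s1 by blast
    show "supp ?V2 ?E2 - {c} \<subseteq> A1"
      using A1(2) s2 by blast
  qed (rule G branch_planar)+
  then show ?thesis
    using that by blast
qed

end

section \<open>Walks, paths and cycles\<close>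

text \<open>A step is an edge with the vertex it leads to; the edge is recorded because parallel
  edges share their ends. The start is kept apart, so on a cycle \<open>map snd p\<close> lists
  every vertex once, the base vertex last.\<close>

type_synonym steps = "(point set \<times> point) list"

fun walk :: "point set \<Rightarrow> point set set \<Rightarrow> point \<Rightarrow> steps \<Rightarrow> point \<Rightarrow> bool" where
  "walk V E u [] w \<longleftrightarrow> u = w"
| "walk V E u ((e, v) # p) w \<longleftrightarrow> e \<in> E \<and> e \<inter> V = {u, v} \<and> walk V E v p w"

definition gpath :: "point set \<Rightarrow> point set set \<Rightarrow> point \<Rightarrow> steps \<Rightarrow> point \<Rightarrow> bool" where
  "gpath V E u p w \<longleftrightarrow> walk V E u p w \<and> distinct (u # map snd p)"

text \<open>Excluding length one rules out loops.\<close>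

definition gcycle :: "point set \<Rightarrow> point set set \<Rightarrow> point \<Rightarrow> steps \<Rightarrow> bool" where
  "gcycle V E u p \<longleftrightarrow>
     walk V E u p u \<and> 2 \<le> length p \<and> distinct (map snd p) \<and> distinct (map fst p)"

definition track :: "steps \<Rightarrow> point set" where
  "track p = \<Union>(fst ` set p)"

fun rev_walk :: "point \<Rightarrow> steps \<Rightarrow> steps" where
  "rev_walk u [] = []"
| "rev_walk u ((e, v) # p) = rev_walk v p @ [(e, u)]"

lemma track_simps [simp]: "track [] = {}" "track (x # p) = fst x \<union> track p"
  "track (p @ q) = track p \<union> track q"
  by (auto simp: track_def)

lemma walk_append: "walk V E u (p @ q) w \<longleftrightarrow> (\<exists>v. walk V E u p v \<and> walk V E v q w)"
  by (induction p arbitrary: u) auto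

lemma walk_mem: "walk V E u p w \<Longrightarrow> x \<in> set p \<Longrightarrow> fst x \<in> E \<and> snd x \<in> V"
proof (induction p arbitrary: u)
  case (Cons y p)
  obtain e v where y: "y = (e, v)" by force
  then have *: "e \<in> E" "e \<inter> V = {u, v}" "walk V E v p w"
    using Cons.prems by auto
  show ?case
  proof (cases "x = y")
    case True
    then show ?thesis using y * by auto
  next
    case False
    then show ?thesis
      using Cons.IH[OF *(3)] Cons.prems by simp
  qed
qed simp

lemma walk_edges: "walk V E u p w \<Longrightarrow> fst ` set p \<subseteq> E"
  and walk_vertices: "walk V E u p w \<Longrightarrow> snd ` set p \<subseteq> V"
  using walk_mem by blast+

lemma walk_start: "walk V E u p w \<Longrightarrow> p \<noteq> [] \<Longrightarrow> u \<in> V"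
  by (cases p) auto

lemma walk_last: "walk V E u p w \<Longrightarrow> p \<noteq> [] \<Longrightarrow> snd (last p) = w"
  by (induction p arbitrary: u) auto

lemma walk_end_mem: "walk V E u p w \<Longrightarrow> p \<noteq> [] \<Longrightarrow> w \<in> snd ` set p"
  using walk_last last_in_set by (metis imageI)

lemma walk_track_vertices: "walk V E u p w \<Longrightarrow> p \<noteq> [] \<Longrightarrow> track p \<inter> V = insert u (snd ` set p)"
proof (induction p arbitrary: u)
  case (Cons x p)
  obtain e v where x: "x = (e, v)" by force
  show ?case
  proof (cases "p = []")
    case False
    then have "track p \<inter> V = insert v (snd ` set p)"
      using Cons.IH[of v] Cons.prems x by simp
    then show ?thesis
      using Cons.prems x by (simp add: Int_Un_distrib2 insert_commute)
  qed (use Cons.prems x in auto)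
qed simp

lemma rev_walk_walk: "walk V E u p w \<Longrightarrow> walk V E w (rev_walk u p) u"
proof (induction p arbitrary: u)
  case (Cons y p)
  obtain e v where y: "y = (e, v)" by force
  then have *: "e \<in> E" "e \<inter> V = {v, u}" "walk V E w (rev_walk v p) v"
    using Cons by auto
  show ?case
    unfolding y rev_walk.simps walk_append using * by auto
qed simp

lemma rev_walk_edges: "map fst (rev_walk u p) = rev (map fst p)"
  by (induction p arbitrary: u) auto

lemma rev_walk_track [simp]: "track (rev_walk u p) = track p"
  using arg_cong[OF rev_walk_edges[of u p], of set] by (simp add: track_def)

text \<open>Reversal shifts the list by one: the old end \<open>w\<close> is now the start and drops
  out, and the old start \<open>u\<close> comes last.\<close>

lemma rev_walk_vertices: "map snd (rev_walk u (p @ [(e, w)])) = rev (map snd p) @ [u]"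
  by (induction p arbitrary: u) auto

text \<open>A path never returns to its start, so the first edge, which ends there, cannot occur
  again.\<close>

lemma gpath_edge_distinct: "gpath V E u p w \<Longrightarrow> distinct (map fst p)"
proof (induction p arbitrary: u)
  case (Cons x p)
  obtain e v where x: "x = (e, v)" by force
  have w: "walk V E v p w" "e \<inter> V = {u, v}" and d: "u \<notin> insert v (snd ` set p)" "gpath V E v p w"
    using Cons.prems x by (auto simp: gpath_def)
  have "e \<notin> fst ` set p"
  proof
    assume e: "e \<in> fst ` set p"
    then have "e \<inter> V \<subseteq> insert v (snd ` set p)"
      using walk_track_vertices[OF w(1)] by (cases "p = []") (auto simp: track_def)
    then show False
      using w(2) d(1) by auto
  qed
  then show ?case
    using Cons.IH[OF d(2)] x by simp
qed simp

context
  fixes V :: "point set" and E :: "point set set"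
  assumes G: "planar_graph V E"
begin

lemma track_disjoint_edge:
  assumes "e \<in> E" "fst ` set p \<subseteq> E" "e \<notin> fst ` set p"
  shows "e \<inter> track p \<subseteq> V"
  using edge_Int[OF G assms(1)] assms(2,3) unfolding track_def by blast

lemma edge_arc:
  assumes "e \<in> E" "e \<inter> V = {u, v}" "u \<noteq> v"
  obtains g where "arc g" "path_image g = e" "pathstart g = u" "pathfinish g = v"
proof -
  obtain g where g: "simple_path g" "path_image g = e" "e \<inter> V = {pathstart g, pathfinish g}"
    using edge_path[OF G assms(1)] .
  have arc: "arc g"
    using g assms arc_simple_path by (metis doubleton_eq_iff)
  have "pathstart g = u \<and> pathfinish g = v \<or> pathstart g = v \<and> pathfinish g = u"
    using g(3) assms(2) by (auto simp: doubleton_eq_iff)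
  then show ?thesis
    using that[of g] that[of "reversepath g"] arc g(2) by (auto simp: arc_reversepath)
qed

lemma gpath_arc:
  assumes "gpath V E u p w" "p \<noteq> []"
  obtains g where "arc g" "path_image g = track p" "pathstart g = u" "pathfinish g = w"
  using assms
proof (induction p arbitrary: u thesis)
  case (Cons x p)
  obtain e v where x: "x = (e, v)" by force
  have e: "e \<in> E" "e \<inter> V = {u, v}" "u \<noteq> v" "walk V E v p w" "u \<notin> insert v (snd ` set p)"
    "gpath V E v p w"
    using Cons.prems(2) unfolding x gpath_def by simp_all
  obtain g1 where g1: "arc g1" "path_image g1 = e" "pathstart g1 = u" "pathfinish g1 = v"
    using edge_arc[OF e(1-3)] .
  show ?case
  proof (cases "p = []")
    case True
    then show ?thesis
      using Cons.prems(1)[of g1] g1 x e by simp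
  next
    case False
    obtain g2 where g2: "arc g2" "path_image g2 = track p" "pathstart g2 = v" "pathfinish g2 = w"
      using Cons.IH[OF _ e(6) False] .
    have "e \<notin> fst ` set p"
      using gpath_edge_distinct[OF Cons.prems(2)] x by simp
    then have "e \<inter> track p \<subseteq> V"
      using track_disjoint_edge[OF e(1)] walk_edges[OF e(4)] by simp
    have "e \<inter> track p \<subseteq> {v}"
    proof
      fix y assume "y \<in> e \<inter> track p"
      then have "y \<in> e \<inter> V" "y \<in> track p \<inter> V"
        using \<open>e \<inter> track p \<subseteq> V\<close> by blast+
      then show "y \<in> {v}"
        unfolding e(2) walk_track_vertices[OF e(4) False] using e(5) by auto
    qed
    then have "arc (g1 +++ g2)"
      using g1 g2 by (intro arc_join) auto
    then show ?thesis
      using Cons.prems(1)[of "g1 +++ g2"] g1 g2 x by (simp add: path_image_join)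
  qed
qed simp

text \<open>These counts 1, 1 and 2 are the corrections that appear when the edges at a vertex are
  counted on both sides of an ear.\<close>

lemma gpath_count:
  assumes "gpath V E u p w" "p \<noteq> []"
  shows "card {e \<in> fst ` set p. u \<in> e} = 1" "card {e \<in> fst ` set p. w \<in> e} = 1"
    "v \<in> snd ` set p \<Longrightarrow> v \<noteq> w \<Longrightarrow> card {e \<in> fst ` set p. v \<in> e} = 2"
proof -
  have "card {e \<in> fst ` set p. u \<in> e} = 1 \<and> card {e \<in> fst ` set p. w \<in> e} = 1 \<and>
    (\<forall>v \<in> snd ` set p. v \<noteq> w \<longrightarrow> card {e \<in> fst ` set p. v \<in> e} = 2)"
    using assms
  proof (induction p arbitrary: u)
    case (Cons x p)
    obtain e y where x: "x = (e, y)" by force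
    have e: "e \<in> E" "e \<inter> V = {u, y}" "u \<noteq> y" "walk V E y p w" "u \<notin> insert y (snd ` set p)"
      "gpath V E y p w" "y \<notin> snd ` set p"
      using Cons.prems(1) x by (auto simp: gpath_def)
    show ?case
    proof (cases "p = []")
      case True
      have "{e' \<in> fst ` set [x]. u \<in> e'} = {e}" "{e' \<in> fst ` set [x]. y \<in> e'} = {e}" "w = y"
        using e True x by auto
      then show ?thesis
        using True x by simp
    next
      case False
      note IH = Cons.IH[OF e(6) False]
      have en: "e \<notin> fst ` set p"
        using gpath_edge_distinct[OF Cons.prems(1)] x by simp
      have tr: "track p \<inter> V = insert y (snd ` set p)"
        by (rule walk_track_vertices[OF e(4) False])
      have u: "{e' \<in> fst ` set (x # p). u \<in> e'} = {e}"
      proof -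
        have "u \<in> V" "u \<in> e" using e(2) by auto
        moreover have "u \<notin> e'" if "e' \<in> fst ` set p" for e'
          using tr e(5) \<open>u \<in> V\<close> that by (auto simp: track_def)
        ultimately show ?thesis using x by auto
      qed
      have y: "{e' \<in> fst ` set (x # p). y \<in> e'} = insert e {e' \<in> fst ` set p. y \<in> e'}"
        using e(2) x by auto
      have o: "{e' \<in> fst ` set (x # p). v \<in> e'} = {e' \<in> fst ` set p. v \<in> e'}"
        if "v \<in> snd ` set p" for v
      proof -
        have "v \<in> V" "v \<noteq> u" "v \<noteq> y"
          using walk_vertices[OF e(4)] e(5,7) that by auto
        then have "v \<notin> e" using e(2) by auto
        then show ?thesis using x by auto
      qed
      have wp: "w \<in> snd ` set p"
        using walk_end_mem[OF e(4) False] .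
      have "card {e' \<in> fst ` set (x # p). y \<in> e'} = 2"
        unfolding y using en IH by simp
      then show ?thesis
        using IH u o wp x e(7) by auto
    qed
  qed simp
  then show "card {e \<in> fst ` set p. u \<in> e} = 1" "card {e \<in> fst ` set p. w \<in> e} = 1"
    "v \<in> snd ` set p \<Longrightarrow> v \<noteq> w \<Longrightarrow> card {e \<in> fst ` set p. v \<in> e} = 2"
    by blast+
qed

lemma gcycle_rotate:
  assumes "gcycle V E u (p @ q)" "walk V E u p w" "walk V E w q u"
  shows "gcycle V E w (q @ p)"
  using assms unfolding gcycle_def walk_append by auto

lemma gcycle_split:
  assumes "gcycle V E u (p @ q)" "walk V E u p w" "walk V E w q u" "p \<noteq> []" "q \<noteq> []"
  shows "gpath V E u p w" "gpath V E w q u" "u \<noteq> w" "track p \<inter> track q = {u, w}"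
proof -
  have d: "distinct (map snd p @ map snd q)" "distinct (map fst p @ map fst q)"
    using assms(1) by (auto simp: gcycle_def)
  have m: "w \<in> snd ` set p" "u \<in> snd ` set q"
    using walk_end_mem[OF assms(2,4)] walk_end_mem[OF assms(3,5)] .
  show "u \<noteq> w" "gpath V E u p w" "gpath V E w q u"
    using d m assms(2,3) by (auto simp: gpath_def)
  have t: "track p \<inter> V = insert u (snd ` set p)" "track q \<inter> V = insert w (snd ` set q)"
    using walk_track_vertices[OF assms(2,4)] walk_track_vertices[OF assms(3,5)] .
  have "track p \<inter> track q \<subseteq> V"
  proof
    fix x assume "x \<in> track p \<inter> track q"
    then obtain e f where "e \<in> fst ` set p" "f \<in> fst ` set q" "x \<in> e" "x \<in> f"
      by (auto simp: track_def)
    moreover then have "e \<noteq> f"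
      using d(2) by auto
    moreover have "e \<in> E" "f \<in> E"
      using calculation(1,2) walk_edges[OF assms(2)] walk_edges[OF assms(3)] by blast+
    ultimately show "x \<in> V"
      using edge_Int[OF G, of e f] by blast
  qed
  then have "track p \<inter> track q = (track p \<inter> V) \<inter> (track q \<inter> V)"
    by blast
  also have "\<dots> = {u, w}"
    unfolding t using d(1) m by auto
  finally show "track p \<inter> track q = {u, w}" .
qed

lemma gcycle_first:
  assumes "gcycle V E u p"
  obtains e w q where "p = [(e, w)] @ q" "q \<noteq> []" "walk V E u [(e, w)] w" "walk V E w q u"
proof -
  obtain x q where "p = x # q" "q \<noteq> []"
    using assms by (auto simp: gcycle_def numeral_2_eq_2 Suc_le_length_iff)
  moreover obtain e w where "x = (e, w)" by force
  ultimately show ?thesis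
    using that[of e w q] assms by (auto simp: gcycle_def)
qed

lemma gcycle_count:
  assumes "gcycle V E u p" "v \<in> snd ` set p"
  shows "card {e \<in> fst ` set p. v \<in> e} = 2"
proof -
  obtain e w q where p: "p = [(e, w)] @ q" "q \<noteq> []" "walk V E u [(e, w)] w" "walk V E w q u"
    using gcycle_first[OF assms(1)] .
  note s = gcycle_split[OF assms(1)[unfolded p(1)] p(3,4) _ p(2)]
  have "e \<inter> V = {u, w}"
    using p(3) by simp
  have en: "e \<notin> fst ` set q"
    using assms(1) p(1) by (auto simp: gcycle_def)
  consider "v = u" | "v = w" | "v \<noteq> u" "v \<noteq> w" "v \<in> snd ` set q"
    using assms(2) p(1) by auto
  then show ?thesis
  proof cases
    case 1
    then have "{e' \<in> fst ` set p. v \<in> e'} = insert e {e' \<in> fst ` set q. v \<in> e'}"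
      using p(1) \<open>e \<inter> V = _\<close> by auto
    then show ?thesis
      using gpath_count(2)[OF s(2)] p(2) en 1 by simp
  next
    case 2
    then have "{e' \<in> fst ` set p. v \<in> e'} = insert e {e' \<in> fst ` set q. v \<in> e'}"
      using p(1) \<open>e \<inter> V = _\<close> by auto
    then show ?thesis
      using gpath_count(1)[OF s(2)] p(2) en 2 by simp
  next
    case 3
    then have "v \<notin> e"
      using \<open>e \<inter> V = _\<close> walk_vertices[OF p(4)] by blast
    then have "{e' \<in> fst ` set p. v \<in> e'} = {e' \<in> fst ` set q. v \<in> e'}"
      using p(1) by auto
    then show ?thesis
      using gpath_count(3)[OF s(2) p(2), of v] 3 by simp
  qed
qed

lemma gcycle_track_vertices: "gcycle V E u p \<Longrightarrow> track p \<inter> V = snd ` set p"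
proof -
  assume p: "gcycle V E u p"
  then have "p \<noteq> []" "walk V E u p u"
    by (auto simp: gcycle_def)
  then show ?thesis
    using walk_track_vertices walk_end_mem by (metis insert_absorb)
qed

lemma track_sphere: "fst ` set p \<subseteq> E \<Longrightarrow> track p \<subseteq> S2"
  using edge_sphere[OF G] unfolding track_def by blast

lemma track_supp: "fst ` set p \<subseteq> E \<Longrightarrow> track p \<subseteq> supp V E"
  unfolding track_def supp_def by blast

lemma gcycle_edges: "gcycle V E u p \<Longrightarrow> fst ` set p \<subseteq> E"
  unfolding gcycle_def by (elim conjE) (rule walk_edges)

lemma gcycle_Jordan:
  assumes "gcycle V E u p"
  obtains A B where "components (S2 - track p) = {A, B}" "A \<noteq> B"
    "closure A = A \<union> track p" "closure B = B \<union> track p"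
proof -
  obtain e w q where p: "p = [(e, w)] @ q" "q \<noteq> []" "walk V E u [(e, w)] w" "walk V E w q u"
    using gcycle_first[OF assms] .
  note s = gcycle_split[OF assms[unfolded p(1)] p(3,4) _ p(2)]
  obtain g1 where g1: "arc g1" "path_image g1 = track [(e, w)]" "pathstart g1 = u" "pathfinish g1 = w"
    using gpath_arc[OF s(1)] by blast
  obtain g2 where g2: "arc g2" "path_image g2 = track q" "pathstart g2 = w" "pathfinish g2 = u"
    using gpath_arc[OF s(2) p(2)] by blast
  have sp: "simple_path (g1 +++ g2)"
    using g1 g2 s(4) by (intro simple_path_join_loop) auto
  have pi: "path_image (g1 +++ g2) = track p"
    using g1 g2 p(1) by (simp add: path_image_join)
  have "pathfinish (g1 +++ g2) = pathstart (g1 +++ g2)" "path_image (g1 +++ g2) \<subseteq> S2"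
    using g1 g2 track_sphere[OF gcycle_edges[OF assms]] pi by simp_all
  then show ?thesis
    using Jordan_sphere[OF sp] that unfolding pi by metis
qed

end

section \<open>Discs bounded by cycles\<close>

text \<open>Either side of the cycle qualifies, so what lies beyond the boundary cycle of a face is
  a disc as much as the face itself. The direction of \<open>p\<close> is not tied to the
  side.\<close>

definition disc :: "point set \<Rightarrow> point set set \<Rightarrow> point \<Rightarrow> steps \<Rightarrow> point set \<Rightarrow> bool" where
  "disc V E u p D \<longleftrightarrow> gcycle V E u p \<and> D \<in> components (S2 - track p)"

context
  fixes V :: "point set" and E :: "point set set"
  assumes G: "planar_graph V E"
begin

lemma disc_subset: "disc V E u p D \<Longrightarrow> D \<subseteq> S2 - track p"
  unfolding disc_def by (elim conjE) (rule in_components_subset)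

lemma disc_closure:
  assumes "disc V E u p D"
  shows "closure D = D \<union> track p"
proof -
  have p: "gcycle V E u p" and D: "D \<in> components (S2 - track p)"
    using assms by (simp_all add: disc_def)
  obtain A B where AB: "components (S2 - track p) = {A, B}" "A \<noteq> B"
    "closure A = A \<union> track p" "closure B = B \<union> track p"
    by (rule gcycle_Jordan[OF G p])
  have "D = A \<or> D = B"
    using D AB(1) by simp
  then show ?thesis
    using AB(3,4) by (elim disjE) simp_all
qed

lemma disc_edges: "disc V E u p D \<Longrightarrow> fst ` set p \<subseteq> E"
  unfolding disc_def by (elim conjE) (rule gcycle_edges[OF G])

lemma disc_vertices: "disc V E u p D \<Longrightarrow> track p \<inter> V = snd ` set p"
  unfolding disc_def by (elim conjE) (rule gcycle_track_vertices[OF G])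

lemma disc_rotate:
  assumes "disc V E u (p @ q) D" "walk V E u p w" "walk V E w q u"
  shows "disc V E w (q @ p) D"
  using assms gcycle_rotate[OF G _ assms(2,3)] unfolding disc_def by (simp add: Un_commute)

lemma edge_disjoint_track:
  assumes "e \<in> E" "fst ` set p \<subseteq> E" "e \<notin> fst ` set p"
  shows "(e - V) \<inter> track p = {}"
  using track_disjoint_edge[OF G assms] by blast

lemma edge_in_track: "e \<in> fst ` set p \<Longrightarrow> e \<subseteq> track p"
  by (auto simp: track_def)

text \<open>With all ends except \<open>v\<close> deleted the edge is still connected, misses the
  cycle and meets \<open>D\<close> in \<open>v\<close>.\<close>

lemma edge_at_inner_vertex:
  assumes D: "disc V E u p D" and v: "v \<in> V" "v \<in> D" and e: "e \<in> E" "v \<in> e"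
  shows "e - V \<subseteq> D"
proof -
  have vt: "v \<notin> track p"
    using disc_subset[OF D] v by blast
  then have "e \<notin> fst ` set p"
    using e edge_in_track by blast
  then have "e \<inter> track p \<subseteq> V"
    using track_disjoint_edge[OF G e(1) disc_edges[OF D]] by blast
  then have "e - (V - {v}) \<subseteq> S2 - track p"
    using vt edge_sphere[OF G e(1)] by blast
  then have "e - (V - {v}) \<subseteq> D"
    using components_maximal[of D "S2 - track p" "e - (V - {v})"] D
      edge_ends_Diff(1)[OF G e(1), of "V - {v}"] v e(2)
    unfolding disc_def by blast
  then show ?thesis by blast
qed

lemma edge_inside_cases:
  assumes D: "disc V E u p D" and e: "e \<in> E" "e \<notin> fst ` set p"
  shows "e \<subseteq> closure D \<longleftrightarrow> e - V \<subseteq> D"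
proof
  assume "e \<subseteq> closure D"
  then show "e - V \<subseteq> D"
    using disc_closure[OF D] edge_disjoint_track[OF e(1) disc_edges[OF D] e(2)] by blast
next
  assume "e - V \<subseteq> D"
  then show "e \<subseteq> closure D"
    using closure_mono edge_closure[OF G e(1)] by metis
qed

text \<open>The theta curve formed by the two arcs of the cycle and the ear. The ear is run
  backwards in the first new cycle and forwards in the second, so both are based at
  \<open>u\<close>.\<close>

lemma ear_split:
  assumes D: "disc V E u (p1 @ p2) D"
    and w1: "walk V E u p1 w" "walk V E w p2 u" and ne: "p1 \<noteq> []" "p2 \<noteq> []"
    and q: "gpath V E u q w" "track q - {u, w} \<subseteq> D"
  obtains D1 D2 where "disc V E u (p1 @ rev_walk u q) D1" "disc V E u (q @ p2) D2"
    "D1 \<inter> D2 = {}" "D = D1 \<union> D2 \<union> (track q - {u, w})"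
proof -
  have cyc: "gcycle V E u (p1 @ p2)" and Dc: "D \<in> components (S2 - track (p1 @ p2))"
    using D by (auto simp: disc_def)
  note s = gcycle_split[OF G cyc w1 ne]
  have wq: "walk V E u q w" "distinct (u # map snd q)" "q \<noteq> []"
    using q s(3) by (auto simp: gpath_def)
  obtain a where a: "arc a" "path_image a = track p1" "pathstart a = u" "pathfinish a = w"
    using gpath_arc[OF G s(1) ne(1)] .
  obtain b where b: "arc b" "path_image b = track p2" "pathstart b = w" "pathfinish b = u"
    using gpath_arc[OF G s(2) ne(2)] .
  obtain c where c: "arc c" "path_image c = track q" "pathstart c = u" "pathfinish c = w"
    using gpath_arc[OF G q(1) wq(3)] .
  have tS: "track p1 \<subseteq> S2" "track p2 \<subseteq> S2"
    using track_sphere[OF G] walk_edges[OF w1(1)] walk_edges[OF w1(2)] by blast+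
  obtain D1 D2 where D12: "D1 \<in> components (S2 - (track p1 \<union> track q))"
    "D2 \<in> components (S2 - (track p2 \<union> track q))" "D1 \<inter> D2 = {}" "D = D1 \<union> D2 \<union> (track q - {u, w})"
    using theta_sphere[of a "reversepath b" c u w D, unfolded path_image_reversepath a(2) b(2) c(2)]
      a b c s(4) tS Dc q(2) by (auto simp: arc_reversepath)
  have dis: "(track q - {u, w}) \<inter> track (p1 @ p2) = {}"
    using q(2) disc_subset[OF D] by blast
  have qe: "fst ` set q \<subseteq> E"
    using walk_edges[OF wq(1)] .
  have qp: "fst ` set q \<inter> fst ` set (p1 @ p2) = {}"
  proof -
    have "e \<notin> fst ` set (p1 @ p2)" if "e \<in> fst ` set q" for e
    proof
      assume "e \<in> fst ` set (p1 @ p2)"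
      moreover have "e - V \<noteq> {}" "u \<in> V" "w \<in> V"
        using that qe edge_nonempty[OF G] walk_start[OF w1(1) ne(1)] walk_start[OF w1(2) ne(2)] by blast+
      ultimately show False
        using dis edge_in_track that by blast
    qed
    then show ?thesis by blast
  qed
  have qv: "snd ` set q - {w} \<subseteq> track q - {u, w}"
    using walk_track_vertices[OF wq(1,3)] wq(2) by auto
  have pv: "snd ` set (p1 @ p2) \<subseteq> track (p1 @ p2)"
    using gcycle_track_vertices[OF G cyc] by blast
  obtain qs e where qeq: "q = qs @ [(e, w)]"
    using wq(1,3) walk_last[OF wq(1,3)] by (metis append_butlast_last_id prod.collapse)
  have rq: "map snd (rev_walk u q) = rev (map snd qs) @ [u]" "map fst (rev_walk u q) = rev (map fst q)"
    unfolding qeq by (rule rev_walk_vertices rev_walk_edges)+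
  have qd: "distinct (map fst q)" "distinct (u # map snd qs @ [w])"
    using gpath_edge_distinct[OF q(1)] wq(2) qeq by auto
  have pd: "distinct (map fst p1 @ map fst p2)" "distinct (map snd p1 @ map snd p2)"
    using cyc by (auto simp: gcycle_def)
  have qsv: "snd ` set qs \<inter> snd ` set (p1 @ p2) = {}"
  proof -
    have "snd ` set qs \<subseteq> snd ` set q - {w}"
      using qd(2) qeq by auto
    then show ?thesis
      using qv pv dis by blast
  qed
  have uw: "w \<in> snd ` set p1" "u \<in> snd ` set p2"
    using walk_end_mem[OF w1(1) ne(1)] walk_end_mem[OF w1(2) ne(2)] .
  have len: "Suc 0 \<le> length p1" "Suc 0 \<le> length p2" "Suc 0 \<le> length q"
    using ne wq(3) by (simp_all add: Suc_le_eq)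
  have lr: "length (rev_walk u q) = length q"
    using rq(2) by (metis length_map length_rev)
  have "gcycle V E u (p1 @ rev_walk u q)"
    unfolding gcycle_def
  proof (intro conjI)
    show "walk V E u (p1 @ rev_walk u q) u"
      using w1(1) rev_walk_walk[OF wq(1)] by (auto simp: walk_append)
    show "2 \<le> length (p1 @ rev_walk u q)"
      using len lr by simp
    show "distinct (map snd (p1 @ rev_walk u q))"
      unfolding map_append rq using pd qd qsv uw by auto
    show "distinct (map fst (p1 @ rev_walk u q))"
      unfolding map_append rq using pd qd qp by auto
  qed
  moreover have "gcycle V E u (q @ p2)"
    unfolding gcycle_def
  proof (intro conjI)
    show "walk V E u (q @ p2) u"
      using w1(2) wq(1) by (auto simp: walk_append)
    show "2 \<le> length (q @ p2)"
      using len by simp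
    have "w \<notin> snd ` set p2"
      using pd uw by auto
    then show "distinct (map snd (q @ p2))"
      using pd qd qsv uw by (auto simp: qeq)
    show "distinct (map fst (q @ p2))"
      using pd qd qp by auto
  qed
  ultimately have "disc V E u (p1 @ rev_walk u q) D1" "disc V E u (q @ p2) D2"
    using D12(1,2) by (simp_all add: disc_def Un_commute)
  then show ?thesis
    using D12(3,4) that by blast
qed

text \<open>For edges of the three paths the closure of a disc, the disc with its cycle, decides.
  Any other edge without its ends is connected and misses the ear, so if it runs in \<open>D\<close>
  it runs in just one of the two parts. This prepares inclusion-exclusion over the edges in the
  closed discs.\<close>

lemma ear_edges:
  assumes D: "disc V E u (p1 @ p2) D"
    and D1: "disc V E u (p1 @ rev_walk u q) D1" and D2: "disc V E u (q @ p2) D2"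
    and split: "D1 \<inter> D2 = {}" "D = D1 \<union> D2 \<union> (track q - {u, w})" and uw: "u \<in> V" "w \<in> V"
    and e: "e \<in> E"
  shows "e \<subseteq> closure D \<longleftrightarrow> e \<subseteq> closure D1 \<or> e \<subseteq> closure D2"
    and "e \<subseteq> closure D1 \<and> e \<subseteq> closure D2 \<longleftrightarrow> e \<in> fst ` set q"
proof -
  have eq: "fst ` set p1 \<subseteq> E" "fst ` set p2 \<subseteq> E" "fst ` set q \<subseteq> E"
    using disc_edges[OF D] disc_edges[OF D2] by auto
  have cl: "closure D = D \<union> track p1 \<union> track p2" "closure D1 = D1 \<union> track p1 \<union> track q"
    "closure D2 = D2 \<union> track q \<union> track p2"
    using disc_closure[OF D] disc_closure[OF D1] disc_closure[OF D2] by (simp_all add: Un_assoc)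
  have dj: "D \<inter> track p1 = {}" "D \<inter> track p2 = {}" "D1 \<subseteq> D" "D2 \<subseteq> D"
    "D1 \<inter> track q = {}" "D2 \<inter> track q = {}"
    using disc_subset[OF D] disc_subset[OF D1] disc_subset[OF D2] split(2) by auto
  have qD: "track q - V \<subseteq> D"
    using split(2) uw by blast
  have ne: "e - V \<noteq> {}"
    using edge_nonempty[OF G e] .
  have cle: "e \<subseteq> closure X" if "e - V \<subseteq> X" for X
    using closure_mono[OF that] edge_closure[OF G e] by simp
  consider "e \<in> fst ` set p1" "e \<notin> fst ` set p2" "e \<notin> fst ` set q" | "e \<in> fst ` set p2" "e \<notin> fst ` set p1" "e \<notin> fst ` set q"
    | "e \<in> fst ` set q" | "e \<notin> fst ` set p1" "e \<notin> fst ` set p2" "e \<notin> fst ` set q"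
  proof -
    have "distinct (map fst (p1 @ p2))" "distinct (map fst (q @ p2))" "distinct (map fst (p1 @ rev_walk u q))"
      using D D1 D2 by (simp_all add: disc_def gcycle_def)
    moreover have "set (map fst (rev_walk u q)) = fst ` set q"
      by (simp only: rev_walk_edges) simp
    ultimately have "fst ` set p1 \<inter> fst ` set p2 = {}" "fst ` set q \<inter> fst ` set p2 = {}" "fst ` set p1 \<inter> fst ` set q = {}"
      by (auto simp only: map_append distinct_append set_map)
    then show ?thesis using that by blast
  qed
  then have "(e \<subseteq> closure D \<longleftrightarrow> e \<subseteq> closure D1 \<or> e \<subseteq> closure D2) \<and>
    (e \<subseteq> closure D1 \<and> e \<subseteq> closure D2 \<longleftrightarrow> e \<in> fst ` set q)"
  proof cases
    case 1
    then have "e \<subseteq> track p1" "(e - V) \<inter> track p2 = {}" "(e - V) \<inter> track q = {}"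
      using edge_in_track edge_disjoint_track[OF e] eq by blast+
    then have "e \<subseteq> closure D" "e \<subseteq> closure D1" "\<not> e \<subseteq> closure D2"
      unfolding cl using ne dj by blast+
    then show ?thesis using 1 by blast
  next
    case 2
    then have "e \<subseteq> track p2" "(e - V) \<inter> track p1 = {}" "(e - V) \<inter> track q = {}"
      using edge_in_track edge_disjoint_track[OF e] eq by blast+
    then have "e \<subseteq> closure D" "e \<subseteq> closure D2" "\<not> e \<subseteq> closure D1"
      unfolding cl using ne dj by blast+
    then show ?thesis using 2 by blast
  next
    case 3
    then have t: "e \<subseteq> track q"
      using edge_in_track by blast
    then have "e \<subseteq> closure D"
      using cle[of D] qD by blast
    then show ?thesis
      using t 3 unfolding cl by blast
  next
    case 4
    then have d: "(e - V) \<inter> track p1 = {}" "(e - V) \<inter> track p2 = {}" "(e - V) \<inter> track q = {}"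
      using edge_disjoint_track[OF e] eq by blast+
    have "\<not> (e \<subseteq> closure D1 \<and> e \<subseteq> closure D2)"
      unfolding cl using ne d split(1) by blast
    moreover have "e \<subseteq> closure D1 \<Longrightarrow> e \<subseteq> closure D" "e \<subseteq> closure D2 \<Longrightarrow> e \<subseteq> closure D"
      using closure_mono[OF dj(3)] closure_mono[OF dj(4)] by blast+
    moreover have "e \<subseteq> closure D1 \<or> e \<subseteq> closure D2" if "e \<subseteq> closure D"
    proof -
      have sub: "e - V \<subseteq> D1 \<union> D2"
        using that d split(2) unfolding cl by blast
      have eS: "e - V \<subseteq> S2 - track (p1 @ rev_walk u q)" "e - V \<subseteq> S2 - track (q @ p2)"
        using d edge_sphere[OF G e] by auto
      have "e - V \<subseteq> D1" if "D1 \<inter> (e - V) \<noteq> {}"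
        using components_maximal[OF _ edge_connected[OF G e] eS(1) that] D1 by (simp add: disc_def)
      moreover have "e - V \<subseteq> D2" if "D2 \<inter> (e - V) \<noteq> {}"
        using components_maximal[OF _ edge_connected[OF G e] eS(2) that] D2 by (simp add: disc_def)
      ultimately have "e - V \<subseteq> D1 \<or> e - V \<subseteq> D2"
        using sub ne by blast
      then show ?thesis using cle by blast
    qed
    ultimately show ?thesis using 4 by blast
  qed
  then show "e \<subseteq> closure D \<longleftrightarrow> e \<subseteq> closure D1 \<or> e \<subseteq> closure D2"
    and "e \<subseteq> closure D1 \<and> e \<subseteq> closure D2 \<longleftrightarrow> e \<in> fst ` set q"
    by blast+
qed

text \<open>An edge of \<open>p2\<close> lies in the closure of \<open>D\<close> but not in that of
  \<open>D1\<close>, and likewise for \<open>p1\<close> and \<open>D2\<close>; this makes the number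
  of edges in the closed disc an induction measure.\<close>

lemma ear_measure:
  assumes D: "disc V E u (p1 @ p2) D"
    and D1: "disc V E u (p1 @ rev_walk u q) D1" and D2: "disc V E u (q @ p2) D2"
    and split: "D1 \<inter> D2 = {}" "D = D1 \<union> D2 \<union> (track q - {u, w})" and uw: "u \<in> V" "w \<in> V"
    and ne: "p1 \<noteq> []" "p2 \<noteq> []"
  shows "card {e \<in> E. e \<subseteq> closure D1} < card {e \<in> E. e \<subseteq> closure D}"
    and "card {e \<in> E. e \<subseteq> closure D2} < card {e \<in> E. e \<subseteq> closure D}"
proof -
  note ee = ear_edges[OF D D1 D2 split uw]
  have d: "fst ` set q \<inter> fst ` set p2 = {}" "fst ` set q \<inter> fst ` set p1 = {}"
  proof -
    have "distinct (map fst (q @ p2))" "distinct (map fst (p1 @ rev_walk u q))"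
      using D1 D2 by (simp_all add: disc_def gcycle_def)
    moreover have "set (map fst (rev_walk u q)) = fst ` set q"
      by (simp only: rev_walk_edges) simp
    ultimately show "fst ` set q \<inter> fst ` set p2 = {}" "fst ` set q \<inter> fst ` set p1 = {}"
      by (auto simp only: map_append distinct_append set_map Int_commute)
  qed
  obtain e1 e2 where e: "e1 \<in> fst ` set p1" "e2 \<in> fst ` set p2"
    using ne by (metis ex_in_conv image_is_empty set_empty)
  then have eE: "e1 \<in> E" "e2 \<in> E"
    using disc_edges[OF D] by auto
  have "e1 \<subseteq> closure D1" "e2 \<subseteq> closure D2"
    using disc_closure[OF D1] disc_closure[OF D2] edge_in_track[OF e(1)] edge_in_track[OF e(2)] by auto
  moreover then have "\<not> e1 \<subseteq> closure D2" "\<not> e2 \<subseteq> closure D1"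
    using ee(2)[OF eE(1)] ee(2)[OF eE(2)] d e by blast+
  ultimately have "{e \<in> E. e \<subseteq> closure D1} \<subset> {e \<in> E. e \<subseteq> closure D}"
    "{e \<in> E. e \<subseteq> closure D2} \<subset> {e \<in> E. e \<subseteq> closure D}"
    using ee(1) eE by blast+
  then show "card {e \<in> E. e \<subseteq> closure D1} < card {e \<in> E. e \<subseteq> closure D}"
    "card {e \<in> E. e \<subseteq> closure D2} < card {e \<in> E. e \<subseteq> closure D}"
    using planar_graph_finite(2)[OF G] psubset_card_mono[of "{e \<in> E. e \<subseteq> closure D}"] by simp_all
qed

end

section \<open>Reachability, and graphs without cut vertices or loops\<close>

definition steps_within :: "point set \<Rightarrow> point set set \<Rightarrow> point set \<Rightarrow> (point \<times> point) set" where
  "steps_within V E X = {(a, b). a \<in> X \<and> b \<in> X \<and> (\<exists>e\<in>E. e \<inter> V = {a, b})}"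

lemma reach_within: "(a, b) \<in> (steps_within V E X)\<^sup>* \<Longrightarrow> a \<in> X \<Longrightarrow> b \<in> X"
  by (induction rule: rtrancl_induct) (auto simp: steps_within_def)

lemma reach_sym:
  assumes "(a, b) \<in> (steps_within V E X)\<^sup>*"
  shows "(b, a) \<in> (steps_within V E X)\<^sup>*"
proof -
  have "sym (steps_within V E X)"
    by (auto simp: sym_def steps_within_def insert_commute)
  then show ?thesis
    using assms by (meson sym_rtrancl symD)
qed

lemma reach_gpath:
  assumes "(a, b) \<in> (steps_within V E X)\<^sup>*" "a \<in> X"
  shows "\<exists>p. gpath V E a p b \<and> snd ` set p \<subseteq> X"
  using assms(1)
proof (induction rule: rtrancl_induct)
  case base
  have "gpath V E a [] a" by (simp add: gpath_def)
  then show ?case by (intro exI[of _ "[]"]) simp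
next
  case (step b b')
  then obtain p where p: "gpath V E a p b" "snd ` set p \<subseteq> X"
    by blast
  obtain e where e: "e \<in> E" "e \<inter> V = {b, b'}" "b' \<in> X"
    using step(2) by (auto simp: steps_within_def)
  consider "b' = a" | "b' \<noteq> a" "b' \<notin> snd ` set p" | "b' \<in> snd ` set p"
    by blast
  then show ?case
  proof cases
    case 1
    have "gpath V E a [] a" by (simp add: gpath_def)
    then show ?thesis
      unfolding 1 by (intro exI[of _ "[]"]) simp
  next
    case 2
    then have "gpath V E a (p @ [(e, b')]) b'"
      using p(1) e by (auto simp: gpath_def walk_append)
    then show ?thesis
      using p(2) e(3) by (intro exI[of _ "p @ [(e, b')]"]) simp
  next
    case 3
    then obtain f p1 p2 where f: "p = p1 @ [(f, b')] @ p2"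
      by (metis append_Cons append_Nil imageE prod.collapse split_list)
    then have "gpath V E a (p1 @ [(f, b')]) b'"
      using p(1) by (auto simp: gpath_def walk_append)
    then show ?thesis
      using p(2) f by (intro exI[of _ "p1 @ [(f, b')]"]) (simp add: image_Un)
  qed
qed

text \<open>Cut vertices are meant topologically: only the point \<open>v\<close> is deleted, and
  the edges at it stay without that end. Loops are excluded since they are not cycles in the sense
  of \<open>gcycle\<close>; they are treated separately.\<close>

locale nonseparable_graph =
  fixes V :: "point set" and E :: "point set set"
  assumes G: "planar_graph V E"
    and nonsep: "\<And>v. v \<in> V \<Longrightarrow> connected (supp V E - {v})"
    and loopless: "\<And>e v. e \<in> E \<Longrightarrow> e \<inter> V \<noteq> {v}"
begin

text \<open>If \<open>n\<close> is the only way out of \<open>X\<close>, the reached vertices with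
  their edges and the remaining vertices with theirs form closed sets \<open>Y\<close> and
  \<open>Z\<close> meeting at most in \<open>n\<close>. As \<open>n\<close> is no cut vertex,
  \<open>Y\<close> contains everything else.\<close>

lemma reach_all:
  assumes n: "n \<in> V" "n \<notin> X" and a: "a \<in> X" "X \<subseteq> V"
    and N: "\<And>b e v. (a, b) \<in> (steps_within V E X)\<^sup>* \<Longrightarrow> e \<in> E \<Longrightarrow> e \<inter> V = {b, v} \<Longrightarrow> v \<in> X \<or> v = n"
    and v: "v \<in> V" "v \<noteq> n"
  shows "(a, v) \<in> (steps_within V E X)\<^sup>*"
proof -
  define U where "U = (steps_within V E X)\<^sup>* `` {a}"
  define Y where "Y = U \<union> \<Union>{e \<in> E. e \<inter> U \<noteq> {}}"
  define Z where "Z = (V - U) \<union> \<Union>{e \<in> E. e \<inter> U = {}}"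
  have UX: "U \<subseteq> X"
    using reach_within a(1) by (auto simp: U_def)
  have aU: "a \<in> U"
    by (simp add: U_def)
  have fin: "finite U" "finite (V - U)" "finite {e \<in> E. e \<inter> U \<noteq> {}}" "finite {e \<in> E. e \<inter> U = {}}"
    using planar_graph_finite[OF G] finite_subset[OF order_trans[OF UX a(2)]] by simp_all
  have "closed e" if "e \<in> E" for e
    using compact_imp_closed[OF edge_compact[OF G that]] .
  then have "closed (\<Union>{e \<in> E. e \<inter> U \<noteq> {}})" "closed (\<Union>{e \<in> E. e \<inter> U = {}})"
    using fin by (simp_all add: closed_Union)
  then have cl: "closed Y" "closed Z"
    unfolding Y_def Z_def using fin by (simp_all add: closed_Un finite_imp_closed)
  have key: "e \<inter> V \<subseteq> insert n U" if e: "e \<in> E" "e \<inter> U \<noteq> {}" for e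
  proof -
    obtain b where b: "b \<in> e" "b \<in> U" using e(2) by blast
    then have "b \<in> e \<inter> V" using UX a(2) by blast
    moreover obtain x y where "e \<inter> V = {x, y}"
      using edge_ends[OF G e(1)] .
    ultimately obtain z where z: "e \<inter> V = {b, z}"
      by auto
    have "z \<in> X \<or> z = n"
      using N[of b e z] b(2) e(1) z by (simp add: U_def)
    moreover have "z \<in> U" if "z \<in> X"
    proof -
      have "(b, z) \<in> steps_within V E X"
        using that z e(1) b(2) UX by (auto simp: steps_within_def)
      then show ?thesis
        using b(2) unfolding U_def by (meson Image_singleton_iff rtrancl.rtrancl_into_rtrancl)
    qed
    ultimately show ?thesis
      unfolding z using b(2) by blast
  qed
  have YZ: "Y \<inter> Z \<subseteq> {n}"
  proof
    fix y assume y: "y \<in> Y \<inter> Z"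
    then have yU: "y \<notin> U"
      unfolding Z_def by blast
    then obtain e where e: "e \<in> E" "e \<inter> U \<noteq> {}" "y \<in> e"
      using y unfolding Y_def by blast
    have "y \<in> V"
    proof (cases "y \<in> V - U")
      case False
      then obtain f where "f \<in> E" "f \<inter> U = {}" "y \<in> f"
        using y unfolding Z_def by blast
      then show ?thesis
        using edge_Int[OF G e(1), of f] e by blast
    qed blast
    then show "y \<in> {n}"
      using key[OF e(1,2)] e(3) yU by blast
  qed
  have "supp V E - {n} \<subseteq> Y"
  proof (rule connected_subset_closed[OF nonsep[OF n(1)] cl])
    show "Y \<inter> Z \<inter> (supp V E - {n}) = {}"
      using YZ by blast
    show "supp V E - {n} \<subseteq> Y \<union> Z"
      unfolding supp_def Y_def Z_def by blast
    have "a \<in> supp V E - {n}"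
      using a n(2) by (auto simp: supp_def)
    then show "(supp V E - {n}) \<inter> Y \<noteq> {}"
      using aU unfolding Y_def by blast
  qed
  then have "v \<in> Y"
    using v by (auto simp: supp_def)
  then have "v \<in> U"
    using key v unfolding Y_def by blast
  then show ?thesis
    by (simp add: U_def)
qed

text \<open>Two edges at \<open>w\<close> are joined by a path between their other ends that avoids
  \<open>w\<close>. If the edges are parallel, this path is empty and the cycle has length
  two.\<close>

lemma gcycle_exists:
  assumes "w \<in> V" "2 \<le> vertex_degree V E w"
  obtains u p where "gcycle V E u p"
proof -
  have no_loops: "{e \<in> E. e \<inter> V = {w}} = {}"
    using loopless by blast
  have "2 \<le> card {e \<in> E. w \<in> e}"
    using assms(2) unfolding vertex_degree_def no_loops by simp
  then obtain e e' where e: "e \<in> E" "e' \<in> E" "w \<in> e" "w \<in> e'" "e \<noteq> e'"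
    by (auto simp: numeral_2_eq_2 card_le_Suc_iff)
  have ends: "\<exists>u. e \<inter> V = {w, u} \<and> u \<noteq> w" if "e \<in> E" "w \<in> e" for e
  proof -
    obtain x y where xy: "e \<inter> V = {x, y}"
      using edge_ends[OF G \<open>e \<in> E\<close>] .
    moreover have "w \<in> e \<inter> V" using that assms by blast
    moreover have "x \<noteq> y" using loopless[OF that(1)] xy by blast
    ultimately show ?thesis by auto
  qed
  obtain u where u: "e \<inter> V = {w, u}" "u \<noteq> w"
    using ends e by blast
  obtain z where z: "e' \<inter> V = {w, z}" "z \<noteq> w"
    using ends e by blast
  have uzV: "u \<in> V" "z \<in> V" using u z by blast+
  have "(z, u) \<in> (steps_within V E (V - {w}))\<^sup>*"
  proof (rule reach_all[OF assms(1)])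
    show "v \<in> V - {w} \<or> v = w" if "e \<in> E" "e \<inter> V = {b, v}" for b e v
      using that by blast
  qed (use uzV u z in auto)
  then obtain q where q: "gpath V E z q u" "snd ` set q \<subseteq> V - {w}"
    using reach_gpath[of z u V E "V - {w}"] uzV z by blast
  have nw: "w \<notin> f" if f: "f \<in> fst ` set q" for f
  proof
    assume "w \<in> f"
    then have "w \<in> track q" "q \<noteq> []"
      using f by (auto simp: track_def)
    moreover have "walk V E z q u"
      using q(1) by (simp add: gpath_def)
    ultimately have "w \<in> insert z (snd ` set q)"
      using walk_track_vertices[of V E z q u] assms(1) by blast
    then show False
      using z q(2) by blast
  qed
  have "gcycle V E u ((e, w) # (e', z) # q)"
    unfolding gcycle_def
  proof (intro conjI)
    show "walk V E u ((e, w) # (e', z) # q) u"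
      using u z e q(1) by (auto simp: gpath_def insert_commute)
    show "distinct (map snd ((e, w) # (e', z) # q))"
      using q z by (auto simp: gpath_def)
    show "distinct (map fst ((e, w) # (e', z) # q))"
      using gpath_edge_distinct[OF q(1)] nw e by auto
  qed simp
  then show ?thesis
    using that by blast
qed

lemma gcycle_two_vertices:
  assumes "gcycle V E u p" 
  obtains x where "x \<in> snd ` set p" "x \<noteq> n"
proof -
  have "card (snd ` set p) \<ge> 2"
    using assms distinct_card[of "map snd p"] by (simp add: gcycle_def)
  then have "\<not> snd ` set p \<subseteq> {n}"
    using card_mono[of "{n}" "snd ` set p"] by force
  then show ?thesis
    using that by blast
qed

text \<open>Since \<open>D\<close> is no face, it contains some of the graph. Without inner
  vertices, an inner edge is an ear, its ends being distinct for want of loops. Otherwise the inner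
  vertices reachable from some \<open>w\<close> within \<open>D\<close> attach to two vertices of
  the cycle, and a path between these attachments is an ear.\<close>

lemma ear_exists:
  assumes D: "disc V E u p D" and nf: "D \<notin> faces V E"
  obtains a q b where "a \<in> snd ` set p" "b \<in> snd ` set p" "a \<noteq> b" "gpath V E a q b" "track q - {a, b} \<subseteq> D"
proof -
  have Dc: "D \<in> components (S2 - track p)" and cyc: "gcycle V E u p"
    using D by (simp_all add: disc_def)
  have cl: "closure D = D \<union> track p"
    using disc_closure[OF G D] .
  have pV: "track p \<inter> V = snd ` set p"
    using disc_vertices[OF G D] .
  have Dp: "D \<inter> track p = {}"
    using disc_subset[OF G D] by blast
  have "D \<inter> supp V E \<noteq> {}"
  proof
    assume "D \<inter> supp V E = {}"
    then have "D \<subseteq> S2 - supp V E" "S2 - supp V E \<subseteq> S2 - track p"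
      using disc_subset[OF G D] track_supp[OF G disc_edges[OF G D]] by blast+
    then show False
      using components_intermediate_subset[OF Dc] nf unfolding faces_supp by blast
  qed
  then obtain x where x: "x \<in> D" "x \<in> supp V E" by blast
  have other_end: "b \<in> D \<or> b \<in> snd ` set p" if "a \<in> D" "e \<in> E" "e \<inter> V = {a, b}" for a b e
  proof -
    have "e - V \<subseteq> D"
      using edge_at_inner_vertex[OF G D _ that(1,2)] that(3) by blast
    then have "e \<subseteq> D \<union> track p"
      using closure_mono[of "e - V" D] edge_closure[OF G that(2)] cl by simp
    then show ?thesis
      using that(3) pV by blast
  qed
  have in_D: "e \<subseteq> D \<union> {a, b}" if "e - V \<subseteq> D" "e \<inter> V = {a, b}" for e a b
    using that by blast
  show ?thesis
  proof (cases "V \<inter> D = {}")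
    case True
    then obtain e where e: "e \<in> E" "x \<in> e"
      using x by (auto simp: supp_def)
    have en: "e \<notin> fst ` set p"
      using edge_in_track[OF G] e(2) x(1) Dp by blast
    have "e - V \<subseteq> S2 - track p"
      using edge_disjoint_track[OF G e(1) disc_edges[OF G D] en] edge_sphere[OF G e(1)] by blast
    moreover have "D \<inter> (e - V) \<noteq> {}"
      using e(2) x(1) True by blast
    ultimately have sub: "e - V \<subseteq> D"
      using components_maximal[OF Dc edge_connected[OF G e(1)]] by blast
    then have "e \<subseteq> D \<union> track p"
      using closure_mono[of "e - V" D] edge_closure[OF G e(1)] cl by simp
    then have "e \<inter> V \<subseteq> snd ` set p"
      using True pV by blast
    moreover obtain a b where ab: "e \<inter> V = {a, b}"
      using edge_ends[OF G e(1)] .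
    moreover have "a \<noteq> b"
      using loopless[OF e(1)] ab by blast
    ultimately show ?thesis
      using that[of a b "[(e, b)]"] e(1) in_D[OF sub ab] by (auto simp: gpath_def)
  next
    case False
    then obtain w where w: "w \<in> V" "w \<in> D" by blast
    let ?X = "V \<inter> D"
    let ?R = "(steps_within V E ?X)\<^sup>*"
    define N where "N = {n \<in> snd ` set p. \<exists>e\<in>E. \<exists>a. (w, a) \<in> ?R \<and> e \<inter> V = {a, n}}"
    \<comment> \<open>With a single attachment \<open>n\<close>, all vertices but \<open>n\<close>
      would be reachable within \<open>D\<close>, among them another vertex of the cycle, which
      \<open>D\<close> does not contain.\<close>
    have "\<not> N \<subseteq> {n}" if n: "n \<in> snd ` set p" for n
    proof
      assume N1: "N \<subseteq> {n}"
      obtain v where v: "v \<in> snd ` set p" "v \<noteq> n"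
        using gcycle_two_vertices[OF cyc] .
      have "(w, v) \<in> ?R"
      proof (rule reach_all[of n])
        show "n \<in> V" "n \<notin> ?X" "v \<in> V"
          using n v(1) pV Dp by blast+
        fix b e z assume b: "(w, b) \<in> ?R" "e \<in> E" "e \<inter> V = {b, z}"
        then have "b \<in> ?X"
          using reach_within w by blast
        then have "z \<in> D \<or> z \<in> snd ` set p"
          using other_end[OF _ b(2,3)] by blast
        moreover have "z \<in> V" using b(3) by blast
        ultimately show "z \<in> ?X \<or> z = n"
          using b N1 unfolding N_def by blast
      qed (use w v in auto)
      then have "v \<in> D"
        using reach_within w by blast
      then show False
        using v(1) pV Dp by blast
    qed
    then obtain n1 n2 where n12: "n1 \<in> N" "n2 \<in> N" "n1 \<noteq> n2"
      using gcycle_two_vertices[OF cyc] unfolding N_def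
      by (metis (no_types, lifting) insertI1 mem_Collect_eq subsetI singletonI)
    obtain e1 a1 where 1: "e1 \<in> E" "(w, a1) \<in> ?R" "e1 \<inter> V = {a1, n1}" "n1 \<in> snd ` set p"
      using n12(1) unfolding N_def by blast
    obtain e2 a2 where 2: "e2 \<in> E" "(w, a2) \<in> ?R" "e2 \<inter> V = {a2, n2}" "n2 \<in> snd ` set p"
      using n12(2) unfolding N_def by blast
    have a12: "a1 \<in> ?X" "a2 \<in> ?X"
      using reach_within 1(2) 2(2) w by blast+
    have "(a1, a2) \<in> ?R"
      using reach_sym[OF 1(2)] 2(2) by (rule rtrancl_trans)
    then obtain q where q: "gpath V E a1 q a2" "snd ` set q \<subseteq> ?X"
      using reach_gpath a12(1) by blast
    have nX: "n1 \<notin> ?X" "n2 \<notin> ?X"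
      using 1(4) 2(4) pV Dp by blast+
    let ?q = "(e1, a1) # q @ [(e2, n2)]"
    have "gpath V E n1 ?q n2"
      using q 1 2 n12(3) nX a12 by (auto simp: gpath_def walk_append insert_commute)
    moreover have "track ?q - {n1, n2} \<subseteq> D"
    proof -
      have e1: "e1 \<subseteq> D \<union> {a1, n1}" and e2: "e2 \<subseteq> D \<union> {a2, n2}"
        using in_D[OF edge_at_inner_vertex[OF G D _ _ 1(1)] 1(3)] in_D[OF edge_at_inner_vertex[OF G D _ _ 2(1)] 2(3)]
          a12 1(3) 2(3) by blast+
      have "track q \<subseteq> D"
      proof (cases "q = []")
        case False
        have wq: "walk V E a1 q a2"
          using q(1) by (simp add: gpath_def)
        have tq: "track q \<inter> V \<subseteq> ?X"
          unfolding walk_track_vertices[OF wq False] using q(2) a12(1) by (rule insert_subsetI[rotated])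
        have "f \<subseteq> D" if f: "f \<in> fst ` set q" for f
        proof -
          have fE: "f \<in> E" using walk_edges[OF wq] f by blast
          obtain y z where yz: "f \<inter> V = {y, z}"
            using edge_ends[OF G fE] .
          then have y: "y \<in> V" "y \<in> f"
            by blast+
          have "f \<inter> V \<subseteq> D"
            using tq edge_in_track[OF G f] by blast
          with y show ?thesis
            using edge_at_inner_vertex[OF G D _ _ fE, of y] by blast
        qed
        then show ?thesis by (auto simp: track_def)
      qed simp
      then show ?thesis
        using e1 e2 a12 by auto
    qed
    ultimately show ?thesis
      using that 1(4) 2(4) n12(3) by blast
  qed
qed

lemma walk_split:
  assumes "walk V E u p w" "v \<in> snd ` set p"
  obtains p1 p2 where "p = p1 @ p2" "walk V E u p1 v" "walk V E v p2 w" "p1 \<noteq> []"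
proof -
  obtain e where "(e, v) \<in> set p"
    using assms(2) by auto
  then obtain q1 q2 where "p = q1 @ (e, v) # q2"
    using split_list by metis
  then have q: "p = (q1 @ [(e, v)]) @ q2"
    by simp
  have "walk V E u (q1 @ [(e, v)]) v \<and> walk V E v q2 w"
    using assms(1) unfolding q walk_append by auto
  then show ?thesis
    using that[of "q1 @ [(e, v)]" q2] q by simp
qed

text \<open>The ends of an ear are arbitrary vertices of the cycle, but the case \<open>ear\<close>
  has it start at the base vertex; the case \<open>rotate\<close> moves the base vertex
  back.\<close>

lemma disc_induct [consumes 1, case_names face ear rotate]:
  assumes "disc V E u p D"
    and face: "\<And>u p D. disc V E u p D \<Longrightarrow> D \<in> faces V E \<Longrightarrow> P u p D"
    and ear: "\<And>u p1 w p2 q D D1 D2. disc V E u (p1 @ p2) D \<Longrightarrow> walk V E u p1 w \<Longrightarrow> walk V E w p2 u \<Longrightarrow>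
      p1 \<noteq> [] \<Longrightarrow> p2 \<noteq> [] \<Longrightarrow> gpath V E u q w \<Longrightarrow> u \<noteq> w \<Longrightarrow> track q - {u, w} \<subseteq> D \<Longrightarrow>
      disc V E u (p1 @ rev_walk u q) D1 \<Longrightarrow> disc V E u (q @ p2) D2 \<Longrightarrow> D1 \<inter> D2 = {} \<Longrightarrow>
      D = D1 \<union> D2 \<union> (track q - {u, w}) \<Longrightarrow>
      P u (p1 @ rev_walk u q) D1 \<Longrightarrow> P u (q @ p2) D2 \<Longrightarrow> P u (p1 @ p2) D"
    and rotate: "\<And>u p1 w p2 D. disc V E u (p1 @ p2) D \<Longrightarrow> walk V E u p1 w \<Longrightarrow> walk V E w p2 u \<Longrightarrow>
      P u (p1 @ p2) D \<Longrightarrow> P w (p2 @ p1) D"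
  shows "P u p D"
  using assms(1)
proof (induction "card {e \<in> E. e \<subseteq> closure D}" arbitrary: u p D rule: less_induct)
  case less
  note D = less.prems
  show ?case
  proof (cases "D \<in> faces V E")
    case False
    obtain a q b where ab: "a \<in> snd ` set p" "b \<in> snd ` set p" "a \<noteq> b" "gpath V E a q b"
      "track q - {a, b} \<subseteq> D"
      using ear_exists[OF D False] .
    have "walk V E u p u"
      using D by (simp add: disc_def gcycle_def)
    then obtain r1 r2 where r: "p = r1 @ r2" "walk V E u r1 a" "walk V E a r2 u"
      using walk_split[OF _ ab(1)] by blast
    have D': "disc V E a (r2 @ r1) D"
      using disc_rotate[OF G _ r(2,3)] D r(1) by simp
    have wa: "walk V E a (r2 @ r1) a"
      using D' by (simp add: disc_def gcycle_def)
    have "b \<in> snd ` set (r2 @ r1)"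
      using ab(2) r(1) by auto
    then obtain p1 p2 where p12: "r2 @ r1 = p1 @ p2" "walk V E a p1 b" "walk V E b p2 a" "p1 \<noteq> []"
      using walk_split[OF wa] by blast
    have p2: "p2 \<noteq> []"
      using p12(3) ab(3) by auto
    note D'' = D'[unfolded p12(1)]
    obtain D1 D2 where D12: "disc V E a (p1 @ rev_walk a q) D1" "disc V E a (q @ p2) D2"
      "D1 \<inter> D2 = {}" "D = D1 \<union> D2 \<union> (track q - {a, b})"
      using ear_split[OF G D'' p12(2,3,4) p2 ab(4,5)] .
    have abV: "a \<in> V" "b \<in> V"
      using walk_start[OF p12(2,4)] walk_start[OF p12(3) p2] .
    note m = ear_measure[OF G D'' D12 abV p12(4) p2]
    have "P a (p1 @ p2) D"
      using ear[OF D'' p12(2,3,4) p2 ab(4,3,5) D12 less.hyps[OF m(1) D12(1)] less.hyps[OF m(2) D12(2)]] .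
    then have "P a (r2 @ r1) D"
      unfolding p12(1) .
    then show ?thesis
      using rotate[OF D' r(3,2)] r(1) by simp
  qed (use face D in blast)
qed

end

section \<open>A triangle group\<close>

type_synonym cmat = "complex^2^2"

definition cmat :: "complex \<Rightarrow> complex \<Rightarrow> complex \<Rightarrow> complex \<Rightarrow> cmat" where
  "cmat p q r s = vector [vector [p, q], vector [r, s]]"

lemma cmat_mult:
  "cmat p q r s ** cmat p' q' r' s' =
     cmat (p * p' + q * r') (p * q' + q * s') (r * p' + s * r') (r * q' + s * s')"
  by (simp add: cmat_def vec_eq_iff forall_2 matrix_matrix_mult_def sum_2)

lemma cmat_one: "mat 1 = cmat 1 0 0 1"
  by (simp add: cmat_def vec_eq_iff forall_2 mat_def)

lemma cmat_eq_iff: "cmat p q r s = cmat p' q' r' s' \<longleftrightarrow> p = p' \<and> q = q' \<and> r = r' \<and> s = s'"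
  by (auto simp: cmat_def vec_eq_iff forall_2)

lemma cmat_cases: obtains p q r s where "M = cmat p q r s"
  using that[of "M$1$1" "M$1$2" "M$2$1" "M$2$2"] by (simp add: cmat_def vec_eq_iff forall_2)

lemma cmat_uminus: "- cmat p q r s = cmat (-p) (-q) (-r) (-s)"
  by (simp add: cmat_def vec_eq_iff forall_2)

fun mpow :: "cmat \<Rightarrow> nat \<Rightarrow> cmat" where
  "mpow M 0 = mat 1"
| "mpow M (Suc n) = M ** mpow M n"

lemma mpow_Suc_right: "mpow M (Suc n) = mpow M n ** M"
  by (induction n) (simp_all add: matrix_mul_assoc)

lemma mpow_inverse: "M' ** M = mat 1 \<Longrightarrow> mpow M' n ** mpow M n = mat 1"
proof (induction n)
  case (Suc n)
  have "mpow M' (Suc n) ** mpow M (Suc n) = mpow M' n ** (M' ** M) ** mpow M n"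
    by (simp only: mpow_Suc_right[of M'] mpow.simps(2)[of M] matrix_mul_assoc)
  then show ?case
    using Suc by simp
qed simp

definition conj_act :: "cmat \<Rightarrow> cmat \<Rightarrow> cmat \<Rightarrow> cmat" where
  "conj_act M M' N = M ** N ** M'"

lemma conj_act_pow: "(conj_act M M' ^^ n) N = mpow M n ** N ** mpow M' n"
proof (induction n)
  case (Suc n)
  then show ?case
    by (simp only: funpow.simps(2) comp_apply conj_act_def mpow_Suc_right[of M'] mpow.simps(2)[of M]
        matrix_mul_assoc)
qed simp

lemma conj_act_comp: "conj_act M M' \<circ> conj_act N N' = conj_act (M ** N) (N' ** M')"
  by (rule ext) (simp add: conj_act_def matrix_mul_assoc)

text \<open>A unimodular matrix of trace \<open>2 cos t\<close> is conjugate to a rotation by \<open>t\<close>; its powers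
  are Chebyshev polynomials in it.\<close>

lemma mpow_chebyshev:
  assumes "p + s = complex_of_real (2 * cos t)" "p * s - q * r = 1"
  defines "S \<equiv> \<lambda>n. complex_of_real (sin (real n * t))"
    and "S' \<equiv> \<lambda>n. complex_of_real (sin ((real n - 1) * t))"
    and "c \<equiv> complex_of_real (sin t)"
  shows "\<exists>p' q' r' s'. mpow (cmat p q r s) n = cmat p' q' r' s' \<and>
    c * p' = S n * p - S' n \<and> c * q' = S n * q \<and> c * r' = S n * r \<and> c * s' = S n * s - S' n"
proof (induction n)
  case 0
  then show ?case
    by (intro exI[of _ 1] exI[of _ 0]) (simp add: cmat_one S_def S'_def c_def)
next
  case (Suc n)
  then obtain p' q' r' s' where IH: "mpow (cmat p q r s) n = cmat p' q' r' s'"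
    "c * p' = S n * p - S' n" "c * q' = S n * q" "c * r' = S n * r" "c * s' = S n * s - S' n"
    by blast
  \<comment> \<open>For M = \<open>cmat p q r s\<close> the claim says c M^n = S n M - S' n 1. The
    recurrence of the sines is the one that Cayley-Hamilton gives for the powers: M^2 = 2 cos t M -
    1.\<close>
  have rec: "S (Suc n) = (p + s) * S n - S' n"
  proof -
    have "sin (real (Suc n) * t) + sin ((real n - 1) * t) = 2 * cos t * sin (real n * t)"
      by (simp add: algebra_simps sin_add sin_diff)
    then have "sin (real (Suc n) * t) = 2 * cos t * sin (real n * t) - sin ((real n - 1) * t)"
      by linarith
    then show ?thesis
      unfolding S_def S'_def assms(1) by (metis of_real_diff of_real_mult)
  qed
  have S': "S' (Suc n) = S n"
    by (simp add: S_def S'_def)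
  have qr: "q * r = p * s - 1"
    using assms(2) by (simp add: algebra_simps)
  have "c * (p * p' + q * r') = S (Suc n) * p - S' (Suc n)"
  proof -
    have "c * (p * p' + q * r') = p * (c * p') + q * (c * r')"
      by (simp add: algebra_simps)
    also have "\<dots> = p * (S n * p - S' n) + S n * (q * r)"
      unfolding IH by (simp add: algebra_simps)
    finally show ?thesis
      unfolding qr rec S' by (simp add: algebra_simps)
  qed
  moreover have "c * (p * q' + q * s') = S (Suc n) * q"
  proof -
    have "c * (p * q' + q * s') = p * (c * q') + q * (c * s')"
      by (simp add: algebra_simps)
    then show ?thesis
      unfolding IH rec by (simp add: algebra_simps)
  qed
  moreover have "c * (r * p' + s * r') = S (Suc n) * r"
  proof -
    have "c * (r * p' + s * r') = r * (c * p') + s * (c * r')"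
      by (simp add: algebra_simps)
    then show ?thesis
      unfolding IH rec by (simp add: algebra_simps)
  qed
  moreover have "c * (r * q' + s * s') = S (Suc n) * s - S' (Suc n)"
  proof -
    have "c * (r * q' + s * s') = r * (c * q') + s * (c * s')"
      by (simp add: algebra_simps)
    also have "\<dots> = S n * (q * r) + s * (S n * s - S' n)"
      unfolding IH by (simp add: algebra_simps)
    finally show ?thesis
      unfolding qr rec S' by (simp add: algebra_simps)
  qed
  ultimately show ?case
    using IH(1) by (auto simp: cmat_mult)
qed

lemma sin_pi_div_pos: "2 \<le> l \<Longrightarrow> 0 < sin (pi / real l)"
  by (rule sin_gt_zero) (auto simp: divide_less_eq)

text \<open>For t = pi / l the two coefficients at n = l are sin pi = 0 and sin (pi - t) = sin t,
  which leaves minus the identity.\<close>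

lemma mpow_order:
  assumes "2 \<le> l" "p + s = complex_of_real (2 * cos (pi / real l))" "p * s - q * r = 1"
  shows "mpow (cmat p q r s) l = - mat 1"
proof -
  have l: "real l * (pi / real l) = pi" "(real l - 1) * (pi / real l) = pi - pi / real l"
    using assms(1) by (simp_all add: field_simps)
  have sl: "sin (pi / real l) \<noteq> 0"
    using sin_pi_div_pos[OF assms(1)] by simp
  have "z = - 1" if "complex_of_real (sin (pi / real l)) * z = - complex_of_real (sin (pi / real l))" for z
  proof -
    have "complex_of_real (sin (pi / real l)) * (z + 1) = 0"
      using that by (simp add: algebra_simps)
    then show ?thesis
      using sl by (simp add: eq_neg_iff_add_eq_0)
  qed
  then show ?thesis
    using mpow_chebyshev[OF assms(2,3), of l] sl unfolding l
    by (auto simp: cmat_one cmat_uminus cmat_eq_iff)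
qed

lemma sin_multiple_zero_dvd:
  assumes "2 \<le> l" "sin (real n * (pi / real l)) = 0"
  shows "l dvd n"
proof -
  obtain i :: int where "real n * (pi / real l) = of_int i * pi"
    using assms(2) sin_zero_iff_int2 by blast
  then have "real n = of_int i * real l"
    using assms(1) by (simp add: field_simps)
  then have "int n = i * int l"
    by (metis of_int_eq_iff of_int_mult of_int_of_nat_eq)
  then show ?thesis
    by (metis dvd_triv_right int_dvd_int_iff)
qed

text \<open>Two matrix units suffice: \<open>cmat 1 0 0 0\<close> kills the off-diagonal entries,
  \<open>cmat 0 1 0 0\<close> equates the diagonal ones.\<close>

lemma central_cmat:
  assumes "\<And>N. Z ** N = N ** Z"
  obtains z where "Z = cmat z 0 0 z"
proof -
  obtain p q r s where Z: "Z = cmat p q r s" by (rule cmat_cases)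
  show ?thesis
    using assms[of "cmat 1 0 0 0"] assms[of "cmat 0 1 0 0"] that[of p]
    by (auto simp: Z cmat_mult cmat_eq_iff)
qed

text \<open>The rotation group of the tiling of type (2, k, l), over the complex numbers: \<open>X\<close> and \<open>A X\<close>
  have traces \<open>2 cos (pi / l)\<close> and \<open>2 cos (pi / k)\<close>, and \<open>A\<close> has trace 0. Acting by conjugation
  identifies \<open>M\<close> with \<open>-M\<close>.\<close>

lemma triangle_group_exists:
  assumes k: "2 \<le> k" and l: "2 \<le> l"
  obtains x a :: "cmat \<Rightarrow> cmat" where "a \<circ> a = id" "x ^^ l = id" "(x \<circ> a) ^^ k = id"
    "\<And>m n. x ^^ m = (a \<circ> x) ^^ n \<Longrightarrow> l dvd m \<and> k dvd n"
proof -
  define \<zeta> where "\<zeta> = cis (pi / real l)"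
  define \<omega> where "\<omega> = cis (- (pi / real l))"
  \<comment> \<open>The product \<open>X ** A\<close> will have trace
    \<open>p * (\<zeta> - \<omega>)\<close>, and \<open>\<zeta> - \<omega>\<close> is 2 \<i> sin (pi
    / l); this \<open>p\<close> makes the trace 2 cos (pi / k).\<close>
  define p where "p = complex_of_real (cos (pi / real k)) / (\<i> * complex_of_real (sin (pi / real l)))"
  have zw: "\<zeta> * \<omega> = 1" "\<omega> * \<zeta> = 1"
    by (simp_all add: \<zeta>_def \<omega>_def cis_mult)
  have sl: "sin (pi / real l) \<noteq> 0" and sk: "sin (pi / real k) \<noteq> 0"
    using sin_pi_div_pos l k by (metis less_irrefl)+
  have zpw: "\<zeta> + \<omega> = complex_of_real (2 * cos (pi / real l))"
    by (simp add: \<zeta>_def \<omega>_def complex_eq_iff)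
  have zmw: "\<zeta> - \<omega> = 2 * (\<i> * complex_of_real (sin (pi / real l)))"
    by (simp add: \<zeta>_def \<omega>_def complex_eq_iff)
  have tr: "p * \<zeta> + (- p) * \<omega> = complex_of_real (2 * cos (pi / real k))"
  proof -
    have "p * \<zeta> + (- p) * \<omega> = p * (\<zeta> - \<omega>)"
      by (simp add: algebra_simps)
    also have "\<dots> = 2 * complex_of_real (cos (pi / real k))"
      unfolding zmw p_def using sl by simp
    finally show ?thesis by simp
  qed
  define X where "X = cmat \<zeta> 0 0 \<omega>"
  define X' where "X' = cmat \<omega> 0 0 \<zeta>"
  \<comment> \<open>Trace 0 and determinant 1 give \<open>A\<close> the square minus the identity.
    The nonzero upper right entry keeps \<open>A\<close> from being diagonal, which later separates
    the powers of \<open>A ** X\<close> from those of \<open>X\<close>.\<close>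
  define A where "A = cmat p 1 (- 1 - p * p) (- p)"
  have XX: "X ** X' = mat 1" "X' ** X = mat 1"
    by (simp_all add: X_def X'_def cmat_mult cmat_one zw)
  have AA: "A ** - A = mat 1" "- A ** A = mat 1"
    by (simp_all add: A_def cmat_mult cmat_uminus cmat_one cmat_eq_iff algebra_simps)
  define x where "x = conj_act X X'"
  define a where "a = conj_act A (- A)"
  have pow_id: "conj_act M M' ^^ n = id" if "mpow M n = - mat 1" "M' ** M = mat 1" for M M' n
  proof
    fix N
    have "mpow M' n ** - mat 1 = mat 1"
      using mpow_inverse[OF that(2), of n] that(1) by simp
    then have "mpow M' n = - mat 1"
      by (cases "mpow M' n" rule: cmat_cases) (auto simp: cmat_one cmat_uminus cmat_mult cmat_eq_iff minus_equation_iff[of _ 1])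
    then show "(conj_act M M' ^^ n) N = id N"
      unfolding conj_act_pow that(1)
      by (cases N rule: cmat_cases) (simp add: cmat_one cmat_uminus cmat_mult)
  qed
  have "mpow X l = - mat 1"
    unfolding X_def by (rule mpow_order[OF l zpw]) (simp add: zw)
  then have xl: "x ^^ l = id"
    unfolding x_def by (rule pow_id[OF _ XX(2)])
  have aa: "a \<circ> a = id"
  proof
    fix N
    obtain p1 q1 r1 s1 where N: "N = cmat p1 q1 r1 s1" by (rule cmat_cases)
    have "(a \<circ> a) N = (A ** A) ** N ** (A ** A)"
      unfolding a_def conj_act_comp conj_act_def
      by (cases A rule: cmat_cases) (simp add: cmat_uminus cmat_mult)
    moreover have "A ** A = - mat 1"
      by (simp add: A_def cmat_mult cmat_uminus cmat_one cmat_eq_iff algebra_simps)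
    ultimately show "(a \<circ> a) N = id N"
      by (simp add: N cmat_one cmat_uminus cmat_mult)
  qed
  have xa: "(x \<circ> a) ^^ k = id"
    unfolding x_def a_def conj_act_comp
  proof (rule pow_id)
    have e: "X ** A = cmat (\<zeta> * p) \<zeta> (\<omega> * (- 1 - p * p)) (- (\<omega> * p))"
      by (simp add: X_def A_def cmat_mult)
    show "mpow (X ** A) k = - mat 1"
      unfolding e
    proof (rule mpow_order[OF k])
      show "\<zeta> * p + - (\<omega> * p) = complex_of_real (2 * cos (pi / real k))"
        using tr by (simp add: mult.commute)
      have "\<zeta> * p * - (\<omega> * p) - \<zeta> * (\<omega> * (- 1 - p * p)) = (\<zeta> * \<omega>) * 1"
        by (simp add: algebra_simps)
      then show "\<zeta> * p * - (\<omega> * p) - \<zeta> * (\<omega> * (- 1 - p * p)) = 1"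
        using zw by simp
    qed
    have "- A ** X' ** (X ** A) = - A ** (X' ** X) ** A"
      by (simp only: matrix_mul_assoc)
    then show "- A ** X' ** (X ** A) = mat 1"
      using XX AA by simp
  qed
  \<comment> \<open>Matrices that conjugate alike differ by a scalar \<open>Z\<close>. So the power
    of \<open>Y\<close> is diagonal like that of \<open>X\<close>; its upper right entry is a
    nonzero multiple of sin (n pi / k), which therefore vanishes. Then both powers are scalar, and
    comparing the diagonal entries of the power of \<open>X\<close> makes sin (m pi / l)
    vanish.\<close>
  have sep: "l dvd m \<and> k dvd n" if eq: "x ^^ m = (a \<circ> x) ^^ n" for m n
  proof -
    define Y where "Y = A ** X"
    define Y' where "Y' = X' ** - A"
    have YY: "Y' ** Y = mat 1" "Y ** Y' = mat 1"
    proof -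
      have "X' ** - A ** (A ** X) = X' ** (- A ** A) ** X" "A ** X ** (X' ** - A) = A ** (X ** X') ** - A"
        by (simp_all only: matrix_mul_assoc)
      then show "Y' ** Y = mat 1" "Y ** Y' = mat 1"
        using XX AA by (simp_all add: Y_def Y'_def)
    qed
    have *: "mpow X m ** N ** mpow X' m = mpow Y n ** N ** mpow Y' n" for N
      using fun_cong[OF eq, of N]
      unfolding x_def a_def conj_act_comp conj_act_pow Y_def Y'_def .
    define Z where "Z = mpow Y' n ** mpow X m"
    have XZ: "mpow X m ** N = mpow Y n ** N ** Z" for N
    proof -
      have "mpow X m ** N = mpow X m ** N ** (mpow X' m ** mpow X m)"
        using mpow_inverse[OF XX(2), of m] by simp
      also have "\<dots> = mpow X m ** N ** mpow X' m ** mpow X m"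
        by (simp only: matrix_mul_assoc)
      finally show ?thesis
        unfolding * Z_def by (simp only: matrix_mul_assoc)
    qed
    have "Z ** N = N ** Z" for N
    proof -
      have "Z ** N = mpow Y' n ** (mpow X m ** N)"
        by (simp only: Z_def matrix_mul_assoc)
      also have "\<dots> = (mpow Y' n ** mpow Y n) ** N ** Z"
        unfolding XZ by (simp only: matrix_mul_assoc)
      finally show ?thesis
        using mpow_inverse[OF YY(1), of n] by simp
    qed
    then obtain z where z: "Z = cmat z 0 0 z"
      by (rule central_cmat)
    have "mpow X' m ** mpow Y n ** Z = mat 1"
    proof -
      have "mpow X' m ** mpow Y n ** Z = mpow X' m ** (mpow Y n ** mat 1 ** Z)"
        by (simp add: matrix_mul_assoc)
      also have "\<dots> = mpow X' m ** mpow X m"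
        unfolding XZ[symmetric] by simp
      finally show ?thesis
        using mpow_inverse[OF XX(2)] by simp
    qed
    then have z0: "z \<noteq> 0"
      by (cases "mpow X' m ** mpow Y n" rule: cmat_cases) (auto simp: z cmat_mult cmat_one cmat_eq_iff)
    have XYz: "mpow X m = mpow Y n ** Z"
      using XZ[of "mat 1"] by simp
    have Ye: "Y = cmat (p * \<zeta>) \<omega> ((- 1 - p * p) * \<zeta>) (- p * \<omega>)"
      by (simp add: Y_def X_def A_def cmat_mult)
    have Ydet: "p * \<zeta> * (- p * \<omega>) - \<omega> * ((- 1 - p * p) * \<zeta>) = 1"
    proof -
      have "p * \<zeta> * (- p * \<omega>) - \<omega> * ((- 1 - p * p) * \<zeta>) = \<zeta> * \<omega>"
        by (simp add: algebra_simps)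
      then show ?thesis using zw by simp
    qed
    obtain p1 q1 r1 s1 where X1: "mpow X m = cmat p1 q1 r1 s1"
      "complex_of_real (sin (pi / real l)) * p1 = complex_of_real (sin (real m * (pi / real l))) * \<zeta>
        - complex_of_real (sin ((real m - 1) * (pi / real l)))"
      "complex_of_real (sin (pi / real l)) * q1 = 0"
      "complex_of_real (sin (pi / real l)) * s1 = complex_of_real (sin (real m * (pi / real l))) * \<omega>
        - complex_of_real (sin ((real m - 1) * (pi / real l)))"
      using mpow_chebyshev[OF zpw, of 0 0 m] zw unfolding X_def by auto
    obtain p2 q2 r2 s2 where Y1: "mpow Y n = cmat p2 q2 r2 s2"
      "complex_of_real (sin (pi / real k)) * p2 = complex_of_real (sin (real n * (pi / real k))) * (p * \<zeta>)
        - complex_of_real (sin ((real n - 1) * (pi / real k)))"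
      "complex_of_real (sin (pi / real k)) * q2 = complex_of_real (sin (real n * (pi / real k))) * \<omega>"
      "complex_of_real (sin (pi / real k)) * s2 = complex_of_real (sin (real n * (pi / real k))) * (- p * \<omega>)
        - complex_of_real (sin ((real n - 1) * (pi / real k)))"
      using mpow_chebyshev[OF tr Ydet, of n] unfolding Ye by blast
    have ent: "p1 = p2 * z" "q1 = q2 * z" "s1 = s2 * z"
      using XYz unfolding X1(1) Y1(1) z by (simp_all add: cmat_mult cmat_eq_iff)
    have "q1 = 0"
      using X1(3) sl by simp
    then have "q2 = 0"
      using ent(2) z0 by simp
    moreover have "\<omega> \<noteq> 0"
      using zw by auto
    ultimately have sn: "sin (real n * (pi / real k)) = 0"
      using Y1(3) by simp
    then have "complex_of_real (sin (pi / real k)) * p2 = complex_of_real (sin (pi / real k)) * s2"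
      using Y1(2,4) by simp
    then have "p1 = s1"
      using sk ent by simp
    then have "complex_of_real (sin (real m * (pi / real l))) * \<zeta> = complex_of_real (sin (real m * (pi / real l))) * \<omega>"
      using X1(2,4) by auto
    moreover have "\<zeta> \<noteq> \<omega>"
      using zmw sl by auto
    ultimately have "sin (real m * (pi / real l)) = 0"
      by simp
    then show ?thesis
      using sn sin_multiple_zero_dvd k l by blast
  qed
  show ?thesis
    by (rule that[OF aa xl xa sep])
qed

section \<open>Products around discs\<close>

definition word :: "('t \<Rightarrow> 't) \<Rightarrow> ('t \<Rightarrow> 't) \<Rightarrow> nat list \<Rightarrow> 't \<Rightarrow> 't" where
  "word x a ds = foldr (\<lambda>d f. (x ^^ d) \<circ> a \<circ> f) ds id"

lemma word_simps [simp]: "word x a [] = id" "word x a (d # ds) = (x ^^ d) \<circ> a \<circ> word x a ds"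
  by (simp_all add: word_def)

lemma word_append: "word x a (ds @ es) = word x a ds \<circ> word x a es"
  by (induction ds) (simp_all add: comp_assoc)

lemma word_replicate: "word x a (replicate n d) = ((x ^^ d) \<circ> a) ^^ n"
  by (induction n) simp_all

lemma funpow_dvd_id: "f ^^ l = id \<Longrightarrow> l dvd n \<Longrightarrow> f ^^ n = id"
  by (elim dvdE) (simp add: funpow_mult[symmetric])

context
  fixes x a :: "'t \<Rightarrow> 't" and l :: nat
  assumes aa: "a \<circ> a = id" and xl: "x ^^ l = id" and l: "0 < l"
begin

lemma inv_a: "a (a t) = t"
  using aa by (metis comp_apply id_apply)

lemma inj_pow: "inj (x ^^ n)"
proof -
  have "inj x"
  proof (rule inj_on_inverseI)
    fix t
    have "(x ^^ (l - 1)) (x t) = (x ^^ Suc (l - 1)) t"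
      by (simp only: funpow_Suc_right comp_apply)
    then show "(x ^^ (l - 1)) (x t) = t"
      using xl l by simp
  qed
  then show ?thesis
    by (induction n) (auto intro: inj_compose)
qed

lemma inj_word: "inj (word x a ds)"
proof (induction ds)
  case (Cons d ds)
  have "inj a"
    by (rule inj_on_inverseI[of _ a]) (rule inv_a)
  then show ?case
    unfolding word_simps by (intro inj_compose inj_pow Cons)
qed simp

text \<open>The rotated word is a conjugate of the identity; injectivity of
  \<open>word x a ds\<close> stands in for an inverse.\<close>

lemma word_rotate:
  assumes "word x a (ds @ es) = id"
  shows "word x a (es @ ds) = id"
proof
  fix t
  have "word x a ds (word x a es (word x a ds t)) = word x a ds t"
    using fun_cong[OF assms, of "word x a ds t"] by (simp add: word_append)
  then show "word x a (es @ ds) t = id t"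
    using inj_word[of ds] by (simp add: word_append inj_def)
qed

text \<open>The product telescopes from the inside: the inner part equals \<open>a\<close>, which
  cancels against a neighbouring \<open>a\<close>, so that the powers \<open>f y\<close> and
  \<open>g y\<close> of \<open>x\<close> meet and vanish.\<close>

lemma word_reverse:
  assumes "\<And>y. y \<in> set ys \<Longrightarrow> l dvd f y + g y"
  shows "word x a (map f ys) (a (word x a (map g (rev ys)) t)) = a t"
  using assms
proof (induction ys arbitrary: t)
  case (Cons y ys)
  have "word x a (map f ys) (a (word x a (map g (rev ys)) ((x ^^ g y) (a t)))) = a ((x ^^ g y) (a t))"
    by (rule Cons.IH) (use Cons.prems in auto)
  moreover have "(x ^^ f y) ((x ^^ g y) s) = s" for s
    using funpow_dvd_id[OF xl, of "f y + g y"] Cons.prems[of y]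
    by (metis comp_apply funpow_add id_apply list.set_intros(1))
  ultimately show ?case
    by (simp add: word_append inv_a)
qed simp

text \<open>Gluing two discs along an ear: the ear is run through in both directions, and its inner
  vertices cancel.\<close>

lemma word_glue:
  assumes 1: "word x a (A @ [pw] @ map g (rev ys) @ [pu]) = id"
    and 2: "word x a (map f ys @ [qw] @ B @ [qu]) = id"
    and ys: "\<And>y. y \<in> set ys \<Longrightarrow> l dvd f y + g y"
  shows "word x a (A @ [pw + qw] @ B @ [pu + qu]) = id"
proof
  fix t
  \<comment> \<open>This is what the first relation leaves behind its factor at \<open>w\<close>.
    Solved for the part behind the ear, the second relation yields \<open>r\<close>, and
    \<open>r = z\<close> allows one to be substituted for the other.\<close>
  define z where "z = a (word x a (map g (rev ys)) ((x ^^ pu) (a t)))"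
  have glue: "word x a A ((x ^^ pw) z) = t"
    using fun_cong[OF 1, of t] by (simp add: word_append z_def)
  have Yz: "word x a (map f ys) z = a ((x ^^ pu) (a t))"
    unfolding z_def by (rule word_reverse[OF ys])
  define r where "r = (x ^^ qw) (a (word x a B ((x ^^ qu) ((x ^^ pu) (a t)))))"
  have "word x a (map f ys) r = word x a (map f ys) z"
    using fun_cong[OF 2, of "a ((x ^^ pu) (a t))"] by (simp add: word_append r_def inv_a Yz)
  then have "r = z"
    using inj_word[of "map f ys"] by (simp add: inj_def)
  moreover have "(x ^^ (pu + qu)) s = (x ^^ qu) ((x ^^ pu) s)" for s
    by (simp add: add.commute[of pu] funpow_add)
  ultimately show "word x a (A @ [pw + qw] @ B @ [pu + qu]) t = id t"
    using glue by (simp add: word_append funpow_add r_def)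
qed

end

text \<open>Edges of the bounding cycle are included. For a vertex on the cycle, one less than this
  number counts the sectors which the edges cut out of the disc there, the quantity that is additive
  when discs are glued.\<close>

definition inner_degree :: "point set set \<Rightarrow> point set \<Rightarrow> point \<Rightarrow> nat" where
  "inner_degree E D v = card {e \<in> E. v \<in> e \<and> e \<subseteq> closure D}"

section \<open>Faces and boundary words of discs in a nonseparable graph\<close>

context nonseparable_graph
begin

lemma degree_loopless: "vertex_degree V E v = card {e \<in> E. v \<in> e}"
proof -
  have "{e \<in> E. e \<inter> V = {v}} = {}"
    using loopless by blast
  then show ?thesis
    unfolding vertex_degree_def by (simp only: card.empty add_0_right)
qed

lemma finite_edges_at: "finite {e \<in> E. P e}"
  using planar_graph_finite(2)[OF G] by simp

lemma track_closed: "fst ` set p \<subseteq> E \<Longrightarrow> closed (track p)"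
  unfolding track_def by (intro closed_Union) (use compact_imp_closed[OF edge_compact[OF G]] in auto)

text \<open>Meant to be applied to both sides of a cycle: an edge of it then borders faces on both
  sides, and these are different.\<close>

lemma disc_boundary_edge_face:
  assumes "disc V E u p D"
  shows "\<forall>e \<in> fst ` set p. \<exists>F\<in>faces V E. F \<subseteq> D \<and> e \<subseteq> closure F"
  using assms
proof (induction rule: disc_induct)
  case (face u p D)
  have "e \<subseteq> closure D" if "e \<in> fst ` set p" for e
    using disc_closure[OF G face(1)] edge_in_track[OF G that] by blast
  then show ?case
    using face(2) by blast
next
  case (ear u p1 w p2 q D D1 D2)
  have "D1 \<subseteq> D" "D2 \<subseteq> D"
    using ear(12) by blast+
  moreover have "e \<in> fst ` set (p1 @ rev_walk u q) \<or> e \<in> fst ` set (q @ p2)"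
    if "e \<in> fst ` set (p1 @ p2)" for e
    using that by auto
  ultimately show ?case
    using ear(13,14) by (meson order_trans)
next
  case (rotate u p1 w p2 D)
  then show ?case by auto
qed

text \<open>A face avoids every ear and is connected, so it passes to one of the two parts until the
  part is the face. Thus faces are bounded by cycles.\<close>

lemma face_is_disc:
  assumes "disc V E u p D" "F \<in> faces V E" "F \<subseteq> D"
  shows "\<exists>u p. disc V E u p F"
proof -
  have "F \<subseteq> D \<longrightarrow> (\<exists>u p. disc V E u p F)"
    using assms(1)
  proof (induction rule: disc_induct)
    case (face u p D)
    have "F = D" if "F \<subseteq> D"
      using faces_disjoint[OF assms(2) face(2)] that in_components_nonempty assms(2)
      unfolding faces_supp by blast
    then show ?case
      using face(1) by blast
  next
    case (ear u p1 w p2 q D D1 D2)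
    show ?case
    proof
      assume "F \<subseteq> D"
      moreover have "F \<inter> track q = {}"
      proof -
        have "walk V E u q w"
          using ear(6) by (simp add: gpath_def)
        then have "track q \<subseteq> supp V E"
          using track_supp[OF G walk_edges] by blast
        then show ?thesis
          using face_subset[OF assms(2)] by blast
      qed
      ultimately have F12: "F \<subseteq> D1 \<union> D2"
        using ear(12) by blast
      have con: "connected F" "F \<noteq> {}"
        using assms(2) in_components_connected in_components_nonempty unfolding faces_supp by blast+
      have "openin (top_of_set S2) D1" "openin (top_of_set S2) D2"
        using openin_component_sphere[OF track_closed[OF disc_edges[OF G ear(9)]]]
          openin_component_sphere[OF track_closed[OF disc_edges[OF G ear(10)]]] ear(9,10)
        unfolding disc_def by blast+
      then have "F \<subseteq> D1" if "F \<inter> D1 \<noteq> {}"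
        using connected_subset_openin[OF con(1), of S2 D1 D2] F12 ear(11) face_subset[OF assms(2)] that
        by blast
      then show "\<exists>u p. disc V E u p F"
        using ear(13,14) F12 by blast
    qed
  next
    case (rotate u p1 w p2 D)
    then show ?case by simp
  qed
  then show ?thesis
    using assms(3) by blast
qed

lemma face_disc_edges:
  assumes D: "disc V E u p D" and F: "D \<in> faces V E" and e: "e \<in> E"
  shows "e \<subseteq> closure D \<longleftrightarrow> e \<in> fst ` set p"
proof
  assume sub: "e \<subseteq> closure D"
  show "e \<in> fst ` set p"
  proof (rule ccontr)
    assume "e \<notin> fst ` set p"
    then have "e - V \<subseteq> D"
      using edge_inside_cases[OF G D e] sub by simp
    moreover have "e \<inter> D = {}"
      using face_subset[OF F] e by (auto simp: supp_def)
    ultimately show False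
      using edge_nonempty[OF G e] by blast
  qed
next
  assume "e \<in> fst ` set p"
  then show "e \<subseteq> closure D"
    using disc_closure[OF G D] edge_in_track[OF G, of e p] by blast
qed

text \<open>The opposite side of the cycle provides each boundary edge with a second face, so every
  such edge counts once and no edge counts twice.\<close>

lemma face_degree_disc:
  assumes D: "disc V E u p D" and F: "D \<in> faces V E"
  shows "face_degree V E D = length p"
proof -
  have cyc: "gcycle V E u p"
    using D by (simp add: disc_def)
  obtain D' where D': "disc V E u p D'" "D' \<noteq> D"
  proof -
    obtain A B where "components (S2 - track p) = {A, B}" "A \<noteq> B"
      by (rule gcycle_Jordan[OF G cyc])
    then have "A \<in> components (S2 - track p)" "B \<in> components (S2 - track p)" "A \<noteq> D \<or> B \<noteq> D"
      by auto
    then show ?thesis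
      using that cyc by (auto simp: disc_def)
  qed
  have "sides V E D e = (if e \<in> fst ` set p then 1 else 0)" if e: "e \<in> E" for e
  proof (cases "e \<in> fst ` set p")
    case True
    obtain F' where F': "F' \<in> faces V E" "F' \<subseteq> D'" "e \<subseteq> closure F'"
      using disc_boundary_edge_face[OF D'(1)] True by blast
    have "D \<inter> D' = {}"
      using components_nonoverlap D D' unfolding disc_def by blast
    then have "F' \<noteq> D"
      using F' F in_components_nonempty unfolding faces_supp by blast
    then show ?thesis
      using True F' face_disc_edges[OF D F e] by (auto simp: sides_def)
  qed (use face_disc_edges[OF D F e] in \<open>simp add: sides_def\<close>)
  then have "face_degree V E D = (\<Sum>e\<in>E. if e \<in> fst ` set p then 1 else 0)"
    by (simp add: face_degree_def)
  also have "\<dots> = card (E \<inter> fst ` set p)"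
    using planar_graph_finite(2)[OF G] by (simp add: sum.If_cases)
  also have "E \<inter> fst ` set p = fst ` set p"
    using disc_edges[OF G D] by blast
  also have "card (fst ` set p) = length p"
    using cyc distinct_card[of "map fst p"] by (simp add: gcycle_def)
  finally show ?thesis .
qed

text \<open>Inclusion-exclusion, the edges common to both closed parts being those of the ear. The
  two inequalities guarantee that subtracting 1 from an inner degree at a vertex of the ear is not
  truncated.\<close>

lemma inner_degree_ear:
  assumes D: "disc V E u (p1 @ p2) D"
    and D1: "disc V E u (p1 @ rev_walk u q) D1" and D2: "disc V E u (q @ p2) D2"
    and split: "D1 \<inter> D2 = {}" "D = D1 \<union> D2 \<union> (track q - {u, w})" and uw: "u \<in> V" "w \<in> V"
  shows "inner_degree E D1 v + inner_degree E D2 v = inner_degree E D v + card {e \<in> fst ` set q. v \<in> e}"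
    and "card {e \<in> fst ` set q. v \<in> e} \<le> inner_degree E D1 v"
    and "card {e \<in> fst ` set q. v \<in> e} \<le> inner_degree E D2 v"
proof -
  note ee = ear_edges[OF G D D1 D2 split uw]
  have qE: "fst ` set q \<subseteq> E"
    using disc_edges[OF G D2] by auto
  let ?S = "\<lambda>D. {e \<in> E. v \<in> e \<and> e \<subseteq> closure D}"
  have u: "?S D1 \<union> ?S D2 = ?S D"
    using ee(1) by blast
  have i: "?S D1 \<inter> ?S D2 = {e \<in> fst ` set q. v \<in> e}"
    using ee(2) qE by blast
  show "inner_degree E D1 v + inner_degree E D2 v = inner_degree E D v + card {e \<in> fst ` set q. v \<in> e}"
    unfolding inner_degree_def u[symmetric] i[symmetric] by (rule card_Un_Int) (rule finite_edges_at)+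
  show "card {e \<in> fst ` set q. v \<in> e} \<le> inner_degree E D1 v" "card {e \<in> fst ` set q. v \<in> e} \<le> inner_degree E D2 v"
    unfolding inner_degree_def i[symmetric] using finite_edges_at by (auto intro!: card_mono)
qed

lemma inner_degree_zero: "v \<notin> closure D \<Longrightarrow> inner_degree E D v = 0"
proof -
  assume "v \<notin> closure D"
  then have "{e \<in> E. v \<in> e \<and> e \<subseteq> closure D} = {}" by blast
  then show ?thesis by (simp only: inner_degree_def card.empty)
qed

lemma disc_word:
  fixes x a :: "'t \<Rightarrow> 't"
  assumes aa: "a \<circ> a = id" and xl: "x ^^ l = id" and l: "0 < l" and xa: "(x \<circ> a) ^^ k = id"
    and D: "disc V E u p D"
    and good: "\<forall>v\<in>V. v \<in> D \<longrightarrow> l dvd vertex_degree V E v"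
      "\<forall>F\<in>faces V E. F \<subseteq> D \<longrightarrow> k dvd face_degree V E F"
  shows "word x a (map (\<lambda>v. inner_degree E D v - 1) (map snd p)) = id"
proof -
  have "(\<forall>v\<in>V. v \<in> D \<longrightarrow> l dvd vertex_degree V E v) \<longrightarrow> (\<forall>F\<in>faces V E. F \<subseteq> D \<longrightarrow> k dvd face_degree V E F) \<longrightarrow>
    word x a (map (\<lambda>v. inner_degree E D v - 1) (map snd p)) = id"
    using D
  proof (induction rule: disc_induct)
    case (face u p D)
    \<comment> \<open>A face has only its two boundary edges at each vertex, so all exponents are 1
      and the word is a power of \<open>x \<circ> a\<close>.\<close>
    have "inner_degree E D v = 2" if "v \<in> snd ` set p" for v
    proof -
      have "{e \<in> E. v \<in> e \<and> e \<subseteq> closure D} = {e \<in> fst ` set p. v \<in> e}"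
        using face_disc_edges[OF face] disc_edges[OF G face(1)] by blast
      moreover have "gcycle V E u p"
        using face(1) by (simp add: disc_def)
      ultimately show ?thesis
        using gcycle_count[OF G _ that, of u] by (simp add: inner_degree_def)
    qed
    then have "map (\<lambda>v. inner_degree E D v - 1) (map snd p) = replicate (length p) 1"
      by (intro replicate_eqI) auto
    then have "word x a (map (\<lambda>v. inner_degree E D v - 1) (map snd p)) = (x \<circ> a) ^^ length p"
      using word_replicate[of x a "length p" 1] by simp
    then show ?case
      using funpow_dvd_id[OF xa] face_degree_disc[OF face] face(2) by auto
  next
    case (ear u p1 w p2 q D D1 D2)
    note D = ear(1) and D1 = ear(9) and D2 = ear(10) and split = ear(11,12)
    have wq: "walk V E u q w" "q \<noteq> []"
      using ear(6,7) by (auto simp: gpath_def)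
    have uw: "u \<in> V" "w \<in> V"
      using walk_start[OF ear(2,4)] walk_start[OF ear(3,5)] .
    obtain qs f where q: "q = qs @ [(f, w)]"
      using wq walk_last[OF wq] by (metis append_butlast_last_id prod.collapse)
    obtain r1 f1 where p1: "p1 = r1 @ [(f1, w)]"
      using ear(2,4) walk_last[OF ear(2,4)] by (metis append_butlast_last_id prod.collapse)
    obtain r2 f2 where p2: "p2 = r2 @ [(f2, u)]"
      using ear(3,5) walk_last[OF ear(3,5)] by (metis append_butlast_last_id prod.collapse)
    have rq: "map snd (rev_walk u q) = rev (map snd qs) @ [u]"
      unfolding q by (rule rev_walk_vertices)
    have dist: "distinct (map snd (p1 @ p2))" "distinct (map snd p1 @ map snd (rev_walk u q))" "distinct (map snd (q @ p2))"
      using D D1 D2 by (auto simp: disc_def gcycle_def)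
    note dist' = dist[unfolded rq, unfolded p1 p2 q]
    have tr: "track (p1 @ p2) \<inter> V = snd ` set (p1 @ p2)" "track (q @ p2) \<inter> V = snd ` set (q @ p2)"
      "track (p1 @ rev_walk u q) \<inter> V = snd ` set p1 \<union> insert u (snd ` set qs)"
      using disc_vertices[OF G D] disc_vertices[OF G D2] disc_vertices[OF G D1]
        arg_cong[OF rq, of set] by (simp_all add: image_Un Un_commute)
    have pD: "snd ` set (p1 @ p2) \<inter> D = {}" and pV: "snd ` set (p1 @ p2) \<subseteq> V"
      using disc_subset[OF G D] tr(1) by blast+
    have D12: "D1 \<subseteq> D" "D2 \<subseteq> D"
      using split(2) by blast+
    note id = inner_degree_ear[OF D D1 D2 split uw]
    have w1: "inner_degree E D1 v = inner_degree E D v" if v: "v \<in> snd ` set r1" for v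
    proof -
      have "v \<in> V" "v \<notin> D2"
        using v p1 pV pD D12 by auto
      moreover have "v \<notin> snd ` set (q @ p2)"
        using v dist' by (auto simp: p2 q)
      ultimately have "v \<notin> closure D2" "v \<notin> track q"
        using tr(2) disc_closure[OF G D2] by auto
      then show ?thesis
        using id(1,3)[of v] inner_degree_zero[of v D2] by simp
    qed
    have w2: "inner_degree E D2 v = inner_degree E D v" if v: "v \<in> snd ` set r2" for v
    proof -
      have "v \<in> V" "v \<notin> D1"
        using v p2 pV pD D12 by auto
      moreover have "v \<notin> snd ` set p1 \<union> insert u (snd ` set qs)"
        using v dist' by (auto simp: p1)
      ultimately have "v \<notin> closure D1"
        using tr(3) disc_closure[OF G D1] by auto
      then show ?thesis
        using id(1,2)[of v] inner_degree_zero[of v D1] by simp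
    qed
    \<comment> \<open>At an end of the ear one edge is counted in both parts; this surplus makes up
      for subtracting 1 twice instead of once.\<close>
    have wuw: "inner_degree E D v - 1 = (inner_degree E D1 v - 1) + (inner_degree E D2 v - 1)" if "v = u \<or> v = w" for v
    proof -
      have "card {e \<in> fst ` set q. v \<in> e} = 1"
        using gpath_count(1,2)[OF G ear(6) wq(2)] that by blast
      then show ?thesis
        using id[of v] by simp
    qed
    \<comment> \<open>At an inner vertex of the ear two edges are counted twice, which balances the
      two subtractions exactly; all edges there lie in the closure of \<open>D\<close>, so the full
      degree remains.\<close>
    have wy: "(inner_degree E D2 v - 1) + (inner_degree E D1 v - 1) = vertex_degree V E v" "v \<in> V" "v \<in> D"
      if v: "v \<in> snd ` set qs" for v
    proof -
      have vq: "v \<in> snd ` set q" "v \<noteq> w" "v \<noteq> u"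
        using v dist' by (auto simp: q p2)
      then have c: "card {e \<in> fst ` set q. v \<in> e} = 2"
        using gpath_count(3)[OF G ear(6) wq(2)] by blast
      have "v \<in> track q \<inter> V"
        using walk_track_vertices[OF wq] vq by simp
      then show vD: "v \<in> V" "v \<in> D"
        using ear(8) vq by blast+
      have "e \<subseteq> closure D" if "e \<in> E" "v \<in> e" for e
        using edge_at_inner_vertex[OF G D vD that] closure_mono[of "e - V" D] edge_closure[OF G that(1)]
        by simp
      then have "{e \<in> E. v \<in> e \<and> e \<subseteq> closure D} = {e \<in> E. v \<in> e}"
        by blast
      then have "inner_degree E D v = vertex_degree V E v"
        by (simp add: inner_degree_def degree_loopless)
      then show "(inner_degree E D2 v - 1) + (inner_degree E D1 v - 1) = vertex_degree V E v"
        using id[of v] c by simp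
    qed
    show ?case
    proof (intro impI)
      assume good: "\<forall>v\<in>V. v \<in> D \<longrightarrow> l dvd vertex_degree V E v"
        "\<forall>F\<in>faces V E. F \<subseteq> D \<longrightarrow> k dvd face_degree V E F"
      let ?h = "\<lambda>D v. inner_degree E D v - 1"
      have IH1: "word x a (map (?h D1) (map snd (p1 @ rev_walk u q))) = id"
        using ear(13) good D12 by blast
      have IH2: "word x a (map (?h D2) (map snd (q @ p2))) = id"
        using ear(14) good D12 by blast
      have m1: "map (?h D1) (map snd r1) = map (?h D) (map snd r1)"
        using w1 by auto
      have m2: "map (?h D2) (map snd r2) = map (?h D) (map snd r2)"
        using w2 by auto
      have 1: "word x a (map (?h D) (map snd r1) @ [?h D1 w] @ map (?h D1) (rev (map snd qs)) @ [?h D1 u]) = id"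
        using IH1 unfolding map_append rq p1 m1[symmetric] by simp
      have 2: "word x a (map (?h D2) (map snd qs) @ [?h D2 w] @ map (?h D) (map snd r2) @ [?h D2 u]) = id"
        using IH2 unfolding map_append p2 q m2[symmetric] by simp
      have "word x a (map (?h D) (map snd r1) @ [?h D1 w + ?h D2 w] @ map (?h D) (map snd r2) @ [?h D1 u + ?h D2 u]) = id"
      proof (rule word_glue[OF aa xl l 1 2])
        fix y assume "y \<in> set (map snd qs)"
        then have "y \<in> snd ` set qs" by simp
        from wy[OF this] show "l dvd ?h D2 y + ?h D1 y"
          using good(1) by simp
      qed
      moreover have "?h D w = ?h D1 w + ?h D2 w" "?h D u = ?h D1 u + ?h D2 u"
        by (rule wuw, simp)+
      moreover have "map (?h D) (map snd (p1 @ p2)) =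
          map (?h D) (map snd r1) @ [?h D w] @ map (?h D) (map snd r2) @ [?h D u]"
        unfolding p1 p2 by simp
      ultimately show "word x a (map (?h D) (map snd (p1 @ p2))) = id"
        by (simp only:)
    qed
  next
    case (rotate u p1 w p2 D)
    show ?case
    proof (intro impI)
      assume "\<forall>v\<in>V. v \<in> D \<longrightarrow> l dvd vertex_degree V E v"
        "\<forall>F\<in>faces V E. F \<subseteq> D \<longrightarrow> k dvd face_degree V E F"
      then have "word x a (map (\<lambda>v. inner_degree E D v - 1) (map snd (p1 @ p2))) = id"
        using rotate(4) by blast
      then show "word x a (map (\<lambda>v. inner_degree E D v - 1) (map snd (p2 @ p1))) = id"
        unfolding map_append by (rule word_rotate[OF aa xl l])
    qed
  qed
  then show ?thesis
    using good by blast
qed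

text \<open>An edge has an end other than \<open>c\<close>. Its degree is positive and divisible by
  \<open>l\<close>, hence at least 2, which suffices for a cycle.\<close>

lemma good_degree_gcycle:
  assumes l: "2 \<le> l" and ne: "E \<noteq> {}" and good: "\<And>v. v \<in> V \<Longrightarrow> v \<noteq> c \<Longrightarrow> l dvd vertex_degree V E v"
  obtains u p where "gcycle V E u p"
proof -
  obtain e where e: "e \<in> E" using ne by blast
  obtain u w where uw: "e \<inter> V = {u, w}"
    using edge_ends[OF G e] .
  have "u \<noteq> w" using loopless[OF e] uw by blast
  then obtain v where v: "v \<in> V" "v \<in> e" "v \<noteq> c" using uw by blast
  have "0 < vertex_degree V E v"
    using e v(2) finite_edges_at by (auto simp: degree_loopless card_gt_0_iff)
  then have "2 \<le> vertex_degree V E v"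
    using good[OF v(1,3)] l dvd_imp_le le_trans by blast
  then show ?thesis
    using gcycle_exists[OF v(1)] that by blast
qed

lemma disc_incident_face:
  assumes "disc V E u p D" "v \<in> V" "v \<in> D \<union> track p"
  shows "\<exists>F\<in>faces V E. F \<subseteq> D \<and> v \<in> closure F"
proof -
  have "v \<in> D \<union> track p \<longrightarrow> (\<exists>F\<in>faces V E. F \<subseteq> D \<and> v \<in> closure F)"
    using assms(1)
  proof (induction rule: disc_induct)
    case (face u p D)
    then show ?case
      using disc_closure[OF G face(1)] by blast
  next
    case (ear u p1 w p2 q D D1 D2)
    have "D1 \<subseteq> D" "D2 \<subseteq> D" "D \<union> track (p1 @ p2) \<subseteq> (D1 \<union> track (p1 @ rev_walk u q)) \<union> (D2 \<union> track (q @ p2))"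
      using ear(12) by auto
    then show ?case
      using ear(13,14) by (meson UnE order_trans subsetD)
  next
    case (rotate u p1 w p2 D)
    then show ?case by (simp add: Un_commute)
  qed
  then show ?thesis
    using assms(3) by blast
qed

lemma incident_face:
  assumes cyc: "gcycle V E u p" and v: "v \<in> V"
  obtains F where "F \<in> faces V E" "v \<in> closure F"
proof -
  obtain A B where AB: "components (S2 - track p) = {A, B}" "A \<noteq> B"
    by (rule gcycle_Jordan[OF G cyc])
  have discs: "disc V E u p A" "disc V E u p B"
    using AB cyc by (simp_all add: disc_def)
  have "S2 - track p = A \<union> B"
    using Union_components[of "S2 - track p"] AB(1) by simp
  then have "v \<in> A \<union> track p \<or> v \<in> B \<union> track p"
    using v planar_graph_vertices[OF G] by blast
  then show ?thesis
    using disc_incident_face[OF discs(1) v] disc_incident_face[OF discs(2) v] that by blast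
qed

lemma nonseparable_good:
  fixes x a :: "'t \<Rightarrow> 't"
  assumes aa: "a \<circ> a = id" and xl: "x ^^ l = id" and l: "2 \<le> l" and xa: "(x \<circ> a) ^^ k = id"
    and sep: "\<And>m n. x ^^ m = (a \<circ> x) ^^ n \<Longrightarrow> l dvd m \<and> k dvd n"
    and ne: "E \<noteq> {}" and c: "c \<in> V" and A: "A \<in> faces V E" and cA: "c \<in> closure A"
    and good: "\<And>v. v \<in> V \<Longrightarrow> v \<noteq> c \<Longrightarrow> l dvd vertex_degree V E v"
      "\<And>F. F \<in> faces V E \<Longrightarrow> F \<noteq> A \<Longrightarrow> k dvd face_degree V E F"
  shows "l dvd vertex_degree V E c \<and> k dvd face_degree V E A"
proof -
  have l0: "0 < l" using l by simp
  have pos: "0 < vertex_degree V E v" if "e \<in> E" "v \<in> e" for e v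
    using that finite_edges_at by (auto simp: degree_loopless card_gt_0_iff)
  \<comment> \<open>Any cycle will do: \<open>A\<close> lies on one side of it, and splitting that
    side by ears leads to a cycle bounding \<open>A\<close> itself.\<close>
  obtain u0 p0 where p0: "gcycle V E u0 p0"
    by (rule good_degree_gcycle[OF l ne good(1)])
  have A': "connected A" "A \<noteq> {}" "A \<subseteq> S2 - supp V E"
    using A in_components_connected in_components_nonempty face_subset unfolding faces_supp by blast+
  then have "A \<subseteq> S2 - track p0"
    using track_supp[OF G gcycle_edges[OF G p0]] by blast
  then obtain D0 where "D0 \<in> components (S2 - track p0)" "A \<subseteq> D0"
    using exists_component_superset[OF _ _ A'(1)] A'(2) by blast
  then obtain u p where "disc V E u p A"
    using face_is_disc[of u0 p0 D0 A] A p0 by (auto simp: disc_def)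
  note pA = this
  have "c \<in> track p \<inter> V"
    using cA c disc_closure[OF G pA] A'(3) by (auto simp: supp_def)
  then have "c \<in> snd ` set p"
    using disc_vertices[OF G pA] by simp
  moreover have "walk V E u p u"
    using pA by (simp add: disc_def gcycle_def)
  ultimately obtain p1 p2 where p12: "p = p1 @ p2" "walk V E u p1 c" "walk V E c p2 u"
    using walk_split by blast
  \<comment> \<open>The cycle is based at \<open>c\<close>, so the possibly exceptional factor comes
    last in the word.\<close>
  define r where "r = p2 @ p1"
  have rA: "disc V E c r A"
    unfolding r_def using disc_rotate[OF G _ p12(2,3)] pA p12(1) by simp
  have cyc: "gcycle V E c r"
    using rA by (simp add: disc_def)
  have rw: "walk V E c r c" "r \<noteq> []" "distinct (map snd r)"
    using cyc by (auto simp: gcycle_def)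
  obtain D where D: "components (S2 - track r) = {A, D}" "A \<noteq> D"
  proof -
    obtain X Y where XY: "components (S2 - track r) = {X, Y}" "X \<noteq> Y"
      by (rule gcycle_Jordan[OF G cyc])
    have "A \<in> {X, Y}"
      using rA XY(1) by (simp add: disc_def)
    then show ?thesis
      using that[of X] that[of Y] XY by (auto simp: insert_commute)
  qed
  have rD: "disc V E c r D"
    using D cyc by (simp add: disc_def)
  have AD: "A \<inter> D = {}" "S2 - track r = A \<union> D"
    using components_nonoverlap[of A "S2 - track r" D] D Union_components[of "S2 - track r"] by auto
  \<comment> \<open>No edge enters \<open>A\<close>, so all of them lie in the closed disc on the
    other side and inner degrees are full degrees.\<close>
  have inner: "inner_degree E D v = vertex_degree V E v" for v
  proof -
    have "e \<subseteq> closure D" if "e \<in> E" for e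
    proof -
      have "e \<inter> A = {}" "e \<subseteq> S2"
        using A'(3) that edge_sphere[OF G that] by (auto simp: supp_def)
      then show ?thesis
        unfolding disc_closure[OF G rD] using AD(2) by blast
    qed
    then have "{e \<in> E. v \<in> e \<and> e \<subseteq> closure D} = {e \<in> E. v \<in> e}"
      by blast
    then show ?thesis
      by (simp add: inner_degree_def degree_loopless)
  qed
  have cD: "c \<notin> D"
    using disc_vertices[OF G rD] walk_end_mem[OF rw(1,2)] disc_subset[OF G rD] by blast
  have DA: "F \<noteq> A" if "F \<subseteq> D" "F \<in> faces V E" for F
    using that AD(1) A'(2) by blast
  have W: "word x a (map (\<lambda>v. inner_degree E D v - 1) (map snd r)) = id"
    by (rule disc_word[OF aa xl l0 xa rD]) (use good cD DA in blast)+
  obtain s f where s: "r = s @ [(f, c)]"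
    using rw walk_last[OF rw(1,2)] by (metis append_butlast_last_id prod.collapse)
  define d where "d = vertex_degree V E c"
  define n where "n = length s"
  have fd: "face_degree V E A = Suc n"
    using face_degree_disc[OF rA A] by (simp add: s n_def)
  \<comment> \<open>The degree is positive and divisible by \<open>l\<close>, so subtracting 1 is
    proper and leaves \<open>l - 1\<close> modulo \<open>l\<close>. Every factor except the one of
    \<open>c\<close> is therefore \<open>y\<close>, the inverse of
    \<open>a \<circ> x\<close>.\<close>
  have step: "x ^^ (vertex_degree V E v - 1) = x ^^ (l - 1)" "0 < vertex_degree V E v" if v: "v \<in> snd ` set s" for v
  proof -
    have "v \<in> track r \<inter> V"
      using disc_vertices[OF G rA] v s by auto
    then obtain e where "e \<in> E" "v \<in> e" "v \<in> V"
      using disc_edges[OF G rA] by (auto simp: track_def)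
    then show vp: "0 < vertex_degree V E v"
      using pos by blast
    have "v \<noteq> c"
      using rw(3) v s by auto
    then obtain m where m: "vertex_degree V E v = l * m"
      using good(1) \<open>v \<in> V\<close> by (meson dvdE)
    then obtain m' where "m = Suc m'"
      using vp by (cases m) auto
    then have "vertex_degree V E v - 1 = l * m' + (l - 1)"
      using m l0 by simp
    then show "x ^^ (vertex_degree V E v - 1) = x ^^ (l - 1)"
      using funpow_dvd_id[OF xl, of "l * m'"] by (simp add: funpow_add)
  qed
  have ws: "word x a (map (\<lambda>v. vertex_degree V E v - 1) (map snd s')) = ((x ^^ (l - 1)) \<circ> a) ^^ length s'"
    if "set s' \<subseteq> set s" for s'
    using that by (induction s') (use step in auto)
  define y where "y = (x ^^ (l - 1)) \<circ> a"
  have W': "(y ^^ n) ((x ^^ (d - 1)) (a t)) = t" for t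
    using fun_cong[OF W, of t] ws[of s]
    by (simp add: s word_append inner y_def n_def d_def)
  have ax_y: "a (x (y t)) = t" for t
  proof -
    have "x ((x ^^ (l - 1)) (a t)) = (x ^^ Suc (l - 1)) (a t)"
      by simp
    also have "\<dots> = a t"
      using xl l0 by simp
    finally show ?thesis
      using inv_a[OF aa xl l0] by (simp add: y_def)
  qed
  have cancel: "((a \<circ> x) ^^ n) ((y ^^ n) t) = t" for n t
  proof (induction n arbitrary: t)
    case (Suc n)
    have "((a \<circ> x) ^^ Suc n) s = ((a \<circ> x) ^^ n) (a (x s))" for s
      by (subst funpow_Suc_right) simp
    then show ?case
      by (simp only:) (simp add: Suc ax_y)
  qed simp
  have d0: "0 < d"
  proof -
    obtain e where "e \<in> E" "c \<in> e"
      using \<open>c \<in> track p \<inter> V\<close> disc_edges[OF G pA] by (auto simp: track_def)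
    then show ?thesis using pos d_def by blast
  qed
  \<comment> \<open>The word reads \<open>y ^^ n\<close> followed by the factor
    \<open>(x ^^ (d - 1)) \<circ> a\<close>. Inverting the power of \<open>y\<close> and composing
    with \<open>a \<circ> x\<close> on the right raises both exponents by one, to the degree of
    \<open>c\<close> and, by \<open>fd\<close>, to that of \<open>A\<close>.\<close>
  have "x ^^ d = (a \<circ> x) ^^ Suc n"
  proof
    fix t
    have "(x ^^ d) t = (x ^^ (d - 1)) (x t)"
      using d0 funpow_Suc_right[of "d - 1" x] by simp
    also have "\<dots> = ((a \<circ> x) ^^ n) ((y ^^ n) ((x ^^ (d - 1)) (x t)))"
      by (simp only: cancel)
    also have "(y ^^ n) ((x ^^ (d - 1)) (x t)) = a (x t)"
      using W'[of "a (x t)"] inv_a[OF aa xl l0] by simp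
    also have "((a \<circ> x) ^^ n) (a (x t)) = ((a \<circ> x) ^^ Suc n) t"
      by (subst funpow_Suc_right) simp
    finally show "(x ^^ d) t = ((a \<circ> x) ^^ Suc n) t" .
  qed
  then show ?thesis
    using sep fd d_def by metis
qed

end

section \<open>Divisibility at a vertex and an incident face\<close>

text \<open>In a graph with a loop and no cut vertex, the loop is the only edge.\<close>

lemma loop_face_degree:
  assumes G: "planar_graph V E" and nonsep: "\<And>v. v \<in> V \<Longrightarrow> connected (supp V E - {v})"
    and e: "e \<in> E" "e \<inter> V = {v}"
  obtains F F' where "F \<in> faces V E" "F' \<in> faces V E" "F \<noteq> F'" "face_degree V E F = 1" "face_degree V E F' = 1"
proof -
  have vV: "v \<in> V" "v \<in> e" using e(2) by blast+
  let ?Z = "(V - {v}) \<union> \<Union>(E - {e})"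
  have cl: "closed e" "closed ?Z"
  proof -
    have "closed (\<Union>(E - {e}))"
      using planar_graph_finite(2)[OF G] compact_imp_closed[OF edge_compact[OF G]] by (intro closed_Union) auto
    then show "closed ?Z"
      using planar_graph_finite(1)[OF G] by (simp add: closed_Un finite_imp_closed)
    show "closed e"
      using compact_imp_closed[OF edge_compact[OF G e(1)]] .
  qed
  have "e \<inter> f \<subseteq> {v}" if "f \<in> E" "f \<noteq> e" for f
    using edge_Int[OF G e(1), of f] that e(2) by blast
  \<comment> \<open>The loop and the rest of the graph are closed and meet at most in
    \<open>v\<close>; since deleting \<open>v\<close> does not disconnect the support, nothing but
    the loop is left.\<close>
  then have int: "e \<inter> ?Z \<inter> (supp V E - {v}) = {}"
    using e(2) by blast
  have "supp V E - {v} \<subseteq> e"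
  proof (rule connected_subset_closed[OF nonsep[OF vV(1)] cl int])
    show "supp V E - {v} \<subseteq> e \<union> ?Z"
      by (auto simp: supp_def)
    have "e - V \<noteq> {}" using edge_nonempty[OF G e(1)] .
    then show "(supp V E - {v}) \<inter> e \<noteq> {}"
      using e(1) vV by (auto simp: supp_def)
  qed
  then have K: "supp V E = e"
    using vV e(1) by (auto simp: supp_def)
  have Ee: "E = {e}"
  proof -
    have "f = e" if "f \<in> E" for f
    proof (rule ccontr)
      assume "f \<noteq> e"
      then have "f \<inter> e \<subseteq> V"
        using edge_Int[OF G that e(1)] by simp
      moreover have "f \<subseteq> e"
        using K that by (auto simp: supp_def)
      ultimately show False
        using edge_nonempty[OF G that] by blast
    qed
    then show ?thesis using e(1) by blast
  qed
  obtain g where g: "simple_path g" "path_image g = e" "e \<inter> V = {pathstart g, pathfinish g}" "e \<subseteq> S2"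
    using edge_path[OF G e(1)] .
  then have "pathfinish g = pathstart g"
    using e(2) by (metis insertI1 insert_iff singletonD)
  then obtain P Q where PQ: "components (S2 - e) = {P, Q}" "P \<noteq> Q"
    "closure P = P \<union> e" "closure Q = Q \<union> e"
    using Jordan_sphere[OF g(1)] g(2,4) by metis
  have fs: "faces V E = {P, Q}"
    unfolding faces_supp K by (rule PQ(1))
  have "face_degree V E F = 1" if "F \<in> faces V E" for F
  proof -
    have "e \<subseteq> closure F" "\<exists>F'\<in>faces V E. F' \<noteq> F \<and> e \<subseteq> closure F'"
      using that PQ(2-4) unfolding fs by auto
    then show ?thesis
      unfolding face_degree_def Ee by (simp add: sides_def)
  qed
  then show ?thesis
    using that[of P Q] fs PQ(2) by blast
qed

text \<open>Without cut vertices, \<open>c \<in> closure A\<close> puts \<open>c\<close> on the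
  boundary cycle of \<open>A\<close>, so that the walk around \<open>A\<close> can be based at
  \<open>c\<close>.\<close>

definition rigid :: "nat \<Rightarrow> nat \<Rightarrow> point set \<Rightarrow> point set set \<Rightarrow> bool" where
  "rigid k l V E \<longleftrightarrow>
     (\<forall>c\<in>V. \<forall>A\<in>faces V E. c \<in> closure A \<longrightarrow>
        (\<forall>v\<in>V - {c}. l dvd vertex_degree V E v) \<longrightarrow> (\<forall>F\<in>faces V E - {A}. k dvd face_degree V E F) \<longrightarrow>
        l dvd vertex_degree V E c \<and> k dvd face_degree V E A)"

lemma rigidD:
  assumes "rigid k l V E" "c \<in> V" "A \<in> faces V E" "c \<in> closure A"
    "\<And>v. v \<in> V \<Longrightarrow> v \<noteq> c \<Longrightarrow> l dvd vertex_degree V E v"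
    "\<And>F. F \<in> faces V E \<Longrightarrow> F \<noteq> A \<Longrightarrow> k dvd face_degree V E F"
  shows "l dvd vertex_degree V E c" "k dvd face_degree V E A"
  using assms unfolding rigid_def by auto

text \<open>With \<open>c\<close> in the first part, only the gluing vertex and the face that held
  the first part can be exceptional in the second. These are incident, so rigidity makes both
  good.\<close>

lemma wedge_second_good:
  assumes w: "wedge V E c' V1 E1 A1 V2 E2 A2" and r: "rigid k l V2 E2" and c: "c \<in> V1"
    and vert: "\<And>v. v \<in> V \<Longrightarrow> v \<noteq> c \<Longrightarrow> l dvd vertex_degree V E v"
    and face: "\<And>F. F \<in> faces V2 E2 \<Longrightarrow> F \<noteq> A2 \<Longrightarrow> k dvd face_degree V E F"
  shows "l dvd vertex_degree V2 E2 c'" "k dvd face_degree V2 E2 A2"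
proof -
  note s = wedge_sets[OF w] and w' = wedge_sym[OF w]
  have "c' \<in> V2" using s(2) by blast
  have v: "l dvd vertex_degree V2 E2 v" if "v \<in> V2" "v \<noteq> c'" for v
    using vert[of v] wedge_degree[OF w' that] that s(1,2) c by auto
  have f: "k dvd face_degree V2 E2 F" if "F \<in> faces V2 E2" "F \<noteq> A2" for F
    using face[OF that] wedge_face_degree[OF w' that] by simp
  show "l dvd vertex_degree V2 E2 c'" "k dvd face_degree V2 E2 A2"
    using rigidD[OF r \<open>c' \<in> V2\<close> wedge_faces(2)[OF w] wedge_apex_closure[OF w] v f] by blast+
qed

text \<open>Removing the second part changes the degrees of \<open>c'\<close> and of the merged face
  by multiples of \<open>l\<close> and \<open>k\<close>. The exceptions thus pass to the first part,
  with \<open>A1\<close> replacing \<open>A\<close> when \<open>A\<close> is the merged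
  face.\<close>

lemma wedge_rigid_first:
  assumes w: "wedge V E c' V1 E1 A1 V2 E2 A2" and r: "rigid k l V1 E1" "rigid k l V2 E2"
    and c: "c \<in> V1" "c \<in> closure A" and A: "A \<in> faces V E" "A \<notin> faces V2 E2 - {A2}"
    and vert: "\<And>v. v \<in> V \<Longrightarrow> v \<noteq> c \<Longrightarrow> l dvd vertex_degree V E v"
    and face: "\<And>F. F \<in> faces V E \<Longrightarrow> F \<noteq> A \<Longrightarrow> k dvd face_degree V E F"
  shows "l dvd vertex_degree V E c \<and> k dvd face_degree V E A"
proof -
  note s = wedge_sets[OF w] and w' = wedge_sym[OF w] and fs = wedge_faces_eq[OF w]
  have A1: "A1 \<in> faces V1 E1" using wedge_faces[OF w] by blast
  have face2: "k dvd face_degree V E F" if "F \<in> faces V2 E2" "F \<noteq> A2" for F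
    using face[of F] wedge_proper_face[OF w' that] that A(2) by blast
  have g2: "l dvd vertex_degree V2 E2 c'" "k dvd face_degree V2 E2 A2"
    using wedge_second_good[OF w r(2) c(1) vert face2] by blast+
  have v1: "l dvd vertex_degree V1 E1 v" if "v \<in> V1" "v \<noteq> c" for v
  proof (cases "v = c'")
    case True
    then show ?thesis
      using vert[of v] that s(1) wedge_degree_apex[OF w] g2(1) by (simp add: dvd_add_left_iff)
  next
    case False
    then show ?thesis
      using vert[of v] that s(1) wedge_degree[OF w that(1)] by simp
  qed
  have proper: "face_degree V E F = face_degree V1 E1 F" "F \<in> faces V E" "F \<noteq> A1 \<inter> A2"
    if "F \<in> faces V1 E1" "F \<noteq> A1" for F
    using wedge_face_degree[OF w that] wedge_proper_face[OF w that]
      faces_disjoint[OF that(1) A1 that(2)] wedge_merged_nonempty[OF w] by blast+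
  have degc: "l dvd vertex_degree V E c \<longleftrightarrow> l dvd vertex_degree V1 E1 c"
  proof (cases "c = c'")
    case True
    then show ?thesis
      using wedge_degree_apex[OF w] g2(1) by (simp add: dvd_add_left_iff)
  next
    case False
    then show ?thesis
      using wedge_degree[OF w c(1)] by simp
  qed
  have merged: "k dvd face_degree V E (A1 \<inter> A2) \<longleftrightarrow> k dvd face_degree V1 E1 A1"
    using wedge_face_degree_merged[OF w] g2(2) by (simp add: dvd_add_left_iff)
  show ?thesis
  proof (cases "A = A1 \<inter> A2")
    case True
    have f1: "k dvd face_degree V1 E1 F" if "F \<in> faces V1 E1" "F \<noteq> A1" for F
      using proper[OF that] face[of F] True by simp
    have "c \<in> closure A1"
      using c(2) closure_mono[of "A1 \<inter> A2" A1] True by blast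
    then show ?thesis
      using rigidD[OF r(1) c(1) A1 _ v1 f1] degc merged True by blast
  next
    case False
    then have AF: "A \<in> faces V1 E1" "A \<noteq> A1"
      using A fs by blast+
    have f1: "k dvd face_degree V1 E1 F" if "F \<in> faces V1 E1" "F \<noteq> A" for F
    proof (cases "F = A1")
      case True
      then show ?thesis
        using face[of "A1 \<inter> A2"] wedge_merged_face[OF w] False merged by auto
    next
      case False
      then show ?thesis
        using proper[OF that(1)] face[of F] that by simp
    qed
    show ?thesis
      using rigidD[OF r(1) c(1) AF(1) c(2) v1 f1] degc proper(1)[OF AF] by simp
  qed
qed

lemma wedge_rigid:
  assumes w: "wedge V E c' V1 E1 A1 V2 E2 A2" and r: "rigid k l V1 E1" "rigid k l V2 E2"
  shows "rigid k l V E"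
  unfolding rigid_def
proof (intro ballI impI)
  fix c A
  assume c: "c \<in> V" "c \<in> closure A" and A: "A \<in> faces V E"
    and "\<forall>v\<in>V - {c}. l dvd vertex_degree V E v" "\<forall>F\<in>faces V E - {A}. k dvd face_degree V E F"
  then have v: "\<And>v. v \<in> V \<Longrightarrow> v \<noteq> c \<Longrightarrow> l dvd vertex_degree V E v"
    and f: "\<And>F. F \<in> faces V E \<Longrightarrow> F \<noteq> A \<Longrightarrow> k dvd face_degree V E F"
    by blast+
  note s = wedge_sets[OF w] and w' = wedge_sym[OF w]
  \<comment> \<open>A vertex of the first part other than \<open>c'\<close> lies in the open face
    \<open>A2\<close>, away from the closure of any other face of the second part.\<close>
  have side: "A \<notin> faces V2 E2 - {A2}"
    if w: "wedge V E c' V1 E1 A1 V2 E2 A2" and "c \<in> V1" "c \<noteq> c'" for V1 E1 A1 V2 E2 A2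
  proof
    assume *: "A \<in> faces V2 E2 - {A2}"
    then have "closure A \<inter> A2 = {}"
      using closure_face_disjoint[OF wedge_graphs(3)[OF w] _ wedge_faces(2)[OF w]] by blast
    then show False
      using c(2) that wedge_faces(3)[OF w] by (auto simp: supp_def)
  qed
  \<comment> \<open>If \<open>c\<close> is the gluing vertex, either part may be kept as long as the
    other does not own \<open>A\<close>. Both cannot: a proper face of the first part borders a
    point lying in \<open>A2\<close>, which no proper face of the second part approaches.\<close>
  have excl: "A \<notin> faces V1 E1 - {A1} \<or> A \<notin> faces V2 E2 - {A2}"
  proof (rule ccontr)
    assume "\<not> ?thesis"
    then have *: "A \<in> faces V1 E1" "A \<noteq> A1" "A \<in> faces V2 E2" "A \<noteq> A2" by blast+
    obtain z where z: "z \<in> closure A" "z \<in> supp V1 E1" "z \<noteq> c'"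
      using closure_component_meets[OF compact_imp_closed[OF supp_compact[OF wedge_graphs(2)[OF w]]]
          supp_sphere[OF wedge_graphs(2)[OF w]] wedge_not_singleton[OF w, of c'] *(1)[unfolded faces_supp]]
      by blast
    then have "z \<in> A2"
      using wedge_faces(3)[OF w] by blast
    then show False
      using closure_face_disjoint[OF wedge_graphs(3)[OF w] *(3) wedge_faces(2)[OF w] *(4)] z by blast
  qed
  consider "c \<in> V1" "c \<noteq> c'" | "c \<in> V2" "c \<noteq> c'" | "c = c'" "c \<in> V1" "c \<in> V2"
    using c(1) s(1,2) by blast
  then show "l dvd vertex_degree V E c \<and> k dvd face_degree V E A"
  proof cases
    case 1
    show ?thesis
      by (rule wedge_rigid_first[OF w r 1(1) c(2) A side[OF w 1] v f])
  next
    case 2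
    show ?thesis
      by (rule wedge_rigid_first[OF w' r(2,1) 2(1) c(2) A side[OF w' 2] v f])
  next
    case 3
    from excl show ?thesis
    proof
      assume "A \<notin> faces V2 E2 - {A2}"
      then show ?thesis
        by (rule wedge_rigid_first[OF w r 3(2) c(2) A _ v f])
    next
      assume "A \<notin> faces V1 E1 - {A1}"
      then show ?thesis
        by (rule wedge_rigid_first[OF w' r(2,1) 3(3) c(2) A _ v f])
    qed
  qed
qed

lemma wedge_card:
  assumes w: "wedge V E c V1 E1 A1 V2 E2 A2"
  shows "card E1 < card E"
proof -
  have "E1 \<subset> E"
    using wedge_sets(3,4)[OF w] wedge_con(2)[OF wedge_sym[OF w]] by blast
  then show ?thesis
    using psubset_card_mono planar_graph_finite(2) wedge_graphs(1)[OF w] by blast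
qed

lemma planar_graph_rigid:
  assumes k: "2 \<le> k" and l: "2 \<le> l" and G: "planar_graph V E" and con: "connected (supp V E)"
  shows "rigid k l V E"
  using G con
proof (induction "card E" arbitrary: V E rule: less_induct)
  case less
  note G = less.prems(1) and con = less.prems(2)
  show ?case
  proof (cases "\<forall>c\<in>V. connected (supp V E - {c})")
    case False
    then obtain c where c: "c \<in> V" "\<not> connected (supp V E - {c})" by blast
    obtain V1 E1 A1 V2 E2 A2 where w: "wedge V E c V1 E1 A1 V2 E2 A2"
      using wedge_exists[OF G con c] .
    note w' = wedge_sym[OF w]
    have "rigid k l V1 E1" "rigid k l V2 E2"
      using less.hyps[OF wedge_card[OF w] wedge_graphs(2)[OF w] wedge_con(1)[OF w]]
        less.hyps[OF wedge_card[OF w'] wedge_graphs(2)[OF w'] wedge_con(1)[OF w']] .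
    then show ?thesis
      by (rule wedge_rigid[OF w])
  next
    case True
    show ?thesis
      unfolding rigid_def
    proof (intro ballI impI)
      fix c A
      assume c: "c \<in> V" "c \<in> closure A" and A: "A \<in> faces V E"
        and good: "\<forall>v\<in>V - {c}. l dvd vertex_degree V E v" "\<forall>F\<in>faces V E - {A}. k dvd face_degree V E F"
      show "l dvd vertex_degree V E c \<and> k dvd face_degree V E A"
      proof (cases "\<exists>e\<in>E. \<exists>v. e \<inter> V = {v}")
        case True': True
        then obtain e v where e: "e \<in> E" "e \<inter> V = {v}" by blast
        \<comment> \<open>Two faces have degree 1 and only one of them can be \<open>A\<close>, so
          \<open>k\<close> would divide 1.\<close>
        obtain F F' where "F \<in> faces V E" "F' \<in> faces V E" "F \<noteq> F'" "face_degree V E F = 1" "face_degree V E F' = 1"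
          using loop_face_degree[OF G _ e] True by blast
        then have "k dvd 1"
          using good(2) by (metis DiffI singletonD)
        then show ?thesis
          using k by simp
      next
        case loopless: False
        interpret nonseparable_graph V E
          using G True loopless by unfold_locales blast+
        show ?thesis
        proof (cases "E = {}")
          case ne: False
          obtain x a :: "cmat \<Rightarrow> cmat" where xa: "a \<circ> a = id" "x ^^ l = id" "(x \<circ> a) ^^ k = id"
            "\<And>m n. x ^^ m = (a \<circ> x) ^^ n \<Longrightarrow> l dvd m \<and> k dvd n"
            by (rule triangle_group_exists[OF k l]) (rule that)
          show ?thesis
            by (rule nonseparable_good[OF xa(1,2) l xa(3,4) ne c(1) A c(2)]) (use good in blast)+
        qed (simp add: vertex_degree_def face_degree_def)
      qed
    qed
  qed
qed

text \<open>Rigidity needs some face incident with \<open>c\<close>. The existence of one has been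
  shown from a cycle in a nonseparable graph, so the graph is once more reduced at its cut vertices,
  keeping the part that contains \<open>c\<close>.\<close>

lemma planar_graph_good_faces:
  assumes k: "2 \<le> k" and l: "2 \<le> l" and G: "planar_graph V E" and con: "connected (supp V E)"
    and c: "c \<in> V" and vert: "\<And>v. v \<in> V \<Longrightarrow> v \<noteq> c \<Longrightarrow> l dvd vertex_degree V E v"
    and face: "\<And>F. F \<in> faces V E \<Longrightarrow> k dvd face_degree V E F"
  shows "l dvd vertex_degree V E c"
  using G con c vert face
proof (induction "card E" arbitrary: V E rule: less_induct)
  case less
  note G = less.prems(1) and con = less.prems(2) and c = less.prems(3)
  note vert = less.prems(4) and face = less.prems(5)
  show ?case
  proof (cases "\<forall>c\<in>V. connected (supp V E - {c})")
    case False
    then obtain c' where c': "c' \<in> V" "\<not> connected (supp V E - {c'})" by blast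
    obtain U1 D1 B1 U2 D2 B2 where w0: "wedge V E c' U1 D1 B1 U2 D2 B2"
      using wedge_exists[OF G con c'] .
    have "\<exists>V1 E1 A1 V2 E2 A2. wedge V E c' V1 E1 A1 V2 E2 A2 \<and> c \<in> V1"
      using w0 wedge_sym[OF w0] wedge_sets(1)[OF w0] c by blast
    then obtain V1 E1 A1 V2 E2 A2 where w: "wedge V E c' V1 E1 A1 V2 E2 A2" and c1: "c \<in> V1"
      by blast
    note w' = wedge_sym[OF w] and s = wedge_sets[OF w]
    have r2: "rigid k l V2 E2"
      using planar_graph_rigid[OF k l wedge_graphs(3)[OF w] wedge_con(1)[OF w']] .
    have g2: "l dvd vertex_degree V2 E2 c'" "k dvd face_degree V2 E2 A2"
      using wedge_second_good[OF w r2 c1 vert] face wedge_proper_face[OF w'] by blast+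
    have "l dvd vertex_degree V1 E1 c"
    proof (rule less.hyps[OF wedge_card[OF w] wedge_graphs(2)[OF w] wedge_con(1)[OF w] c1])
      fix v assume v: "v \<in> V1" "v \<noteq> c"
      then have "l dvd vertex_degree V E v"
        using vert s(1) by blast
      then show "l dvd vertex_degree V1 E1 v"
        using wedge_degree[OF w v(1)] wedge_degree_apex[OF w] g2(1)
        by (cases "v = c'") (simp_all add: dvd_add_left_iff)
    next
      fix F assume F: "F \<in> faces V1 E1"
      show "k dvd face_degree V1 E1 F"
      proof (cases "F = A1")
        case True
        then show ?thesis
          using face[OF wedge_merged_face[OF w]] wedge_face_degree_merged[OF w] g2(2)
          by (simp add: dvd_add_left_iff)
      next
        case False
        then show ?thesis
          using face[OF wedge_proper_face[OF w F False]] wedge_face_degree[OF w F False] by simp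
      qed
    qed
    then show ?thesis
      using wedge_degree[OF w c1] wedge_degree_apex[OF w] g2(1) by (cases "c = c'") simp_all
  next
    case True
    show ?thesis
    proof (cases "\<exists>e\<in>E. \<exists>v. e \<inter> V = {v}")
      case True': True
      then obtain e v where e: "e \<in> E" "e \<inter> V = {v}" by blast
      obtain F where "F \<in> faces V E" "face_degree V E F = 1"
        using loop_face_degree[OF G _ e] True by blast
      then have "k dvd 1"
        using face by metis
      then show ?thesis
        using k by simp
    next
      case loopless: False
      interpret nonseparable_graph V E
        using G True loopless by unfold_locales blast+
      show ?thesis
      proof (cases "E = {}")
        case ne: False
        obtain u p where "gcycle V E u p"
          by (rule good_degree_gcycle[OF l ne vert])
        then obtain A where A: "A \<in> faces V E" "c \<in> closure A"
          by (rule incident_face[OF _ c])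
        show ?thesis
          by (rule rigidD(1)[OF planar_graph_rigid[OF k l G con] c A vert face])
      qed (simp add: vertex_degree_def)
    qed
  qed
qed

section \<open>From combinatorial to topological connectedness, and the conclusion\<close>

lemma connected_graph_supp:
  assumes G: "planar_graph V E" and con: "connected_graph V E"
  shows "connected (supp V E)"
proof -
  obtain c where c: "c \<in> V"
    using con by (auto simp: connected_graph_def)
  have e: "connected e" "e \<subseteq> supp V E" if "e \<in> E" for e
    using connected_imp_connected_closure[OF edge_connected[OF G that]] edge_closure[OF G that] that
    by (auto simp: supp_def)
  have vert: "connected_component (supp V E) c v" if "v \<in> V" for v
  proof -
    have "(c, v) \<in> (adjacency V E)\<^sup>*"
      using con c that by (auto simp: connected_graph_def)
    then show ?thesis
    proof (induction rule: rtrancl_induct)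
      case base
      then show ?case
        using c by (simp add: supp_def)
    next
      case (step u w)
      then obtain f where "f \<in> E" "f \<inter> V = {u, w}"
        by (auto simp: adjacency_def)
      then have "connected_component (supp V E) u w"
        unfolding connected_component_def using e[of f] by (intro exI[of _ f]) blast
      then show ?case
        using step.IH connected_component_trans by blast
    qed
  qed
  have "connected_component (supp V E) c z" if z: "z \<in> supp V E" for z
  proof (cases "z \<in> V")
    case False
    then obtain f where f: "f \<in> E" "z \<in> f"
      using z by (auto simp: supp_def)
    obtain u w where "f \<inter> V = {u, w}"
      using edge_ends[OF G f(1)] .
    then have u: "u \<in> V" "u \<in> f" by blast+
    then have "connected_component (supp V E) u z"
      unfolding connected_component_def using e[OF f(1)] f(2) by (intro exI[of _ f]) blast
    then show ?thesis
      using vert[OF u(1)] connected_component_trans by blast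
  qed (rule vert)
  then show ?thesis
    by (meson connected_component_sym connected_component_trans connected_iff_connected_component)
qed

theorem corollary1p3:
  fixes k l :: nat
  assumes "k \<ge> 2" and "l \<ge> 2"
  shows "\<nexists>V E. planar_graph V E \<and> connected_graph V E \<and>
           (\<forall>F\<in>faces V E. k dvd face_degree V E F) \<and>
           (\<exists>!v. v \<in> V \<and> \<not> l dvd vertex_degree V E v)"
proof
  assume "\<exists>V E. planar_graph V E \<and> connected_graph V E \<and>
           (\<forall>F\<in>faces V E. k dvd face_degree V E F) \<and>
           (\<exists>!v. v \<in> V \<and> \<not> l dvd vertex_degree V E v)"
  then obtain V E c where G: "planar_graph V E" and con: "connected_graph V E"
    and face: "\<And>F. F \<in> faces V E \<Longrightarrow> k dvd face_degree V E F"
    and c: "c \<in> V" "\<not> l dvd vertex_degree V E c"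
    and vert: "\<And>v. v \<in> V \<Longrightarrow> v \<noteq> c \<Longrightarrow> l dvd vertex_degree V E v"
    by blast
  then show False
    using planar_graph_good_faces[OF assms G connected_graph_supp[OF G con] c(1) vert face] by blast
qed

end
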